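(* Let $f$ satisfy the Standing Assumption in the context, let $m_0\in\mathbb{R}^D$, and let $C_0\in\mathbb{R}^{D\times D}$ be positive semi-definite. For $\epsilon>0$ let $\mu^\epsilon$ be the law in $C([0,T],\mathbb{R}^D)$ of the solution $v^\epsilon$ of $$dv^\epsilon(t)=f\bigl(v^\epsilon(t)\bigr)\,dt+\sqrt{\epsilon\Sigma}\,dW(t),\quad t\in[0,T],\qquad v^\epsilon(0)\sim\mu_0^\epsilon .$$ For $K\in\mathbb{N}$, $K\ge 1$, let $\Delta t=T/K$, and let $\nu^{\epsilon,\Delta t}$ be the Gaussian measure on $C([0,T],\mathbb{R}^D)$ defined in the context (the law of the piecewise linear SDE driven by the Euler discretization of the ODE $\frac{dm}{dt}=f(m)$, $m(0)=m_0$). Then there is $c>0$, independent of all sufficiently small $\Delta t$ and $\epsilon$, such that for all sufficiently small $\Delta t$ and $\epsilon$ $$D_{\mathrm{KL}}(\nu^{\epsilon,\Delta t}\|\mu^\epsilon)\le D_{\mathrm{KL}}(\nu_0^{\epsilon,\Delta t}\|\mu_0^\epsilon)+c\,\epsilon+c\,\frac{(\Delta t)^2}{\epsilon}.$$ Moreover, for $t\in(0,T]$, $$D_{\mathrm{KL}}(\nu_t^{\epsilon,\Delta t}\|\mu_t^\epsilon)\le D_{\mathrm{KL}}(\nu_0^{\epsilon,\Delta t}\|\mu_0^\epsilon)+c\,\epsilon+c\,\frac{(\Delta t)^2}{\epsilon},$$ where $\nu_t^{\epsilon,\Delta t}$ and $\mu_t^{\epsilon}$ denote the time-marginals of $\nu^{\epsilon,\Delta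 t}$ and $\mu^{\epsilon}$ at time $t$.
   Context: $T>0$ is finite and fixed; $D\in\mathbb{N}$; $\Sigma\in\mathbb{R}^{D\times D}$ is a fixed (symmetric) positive-definite matrix; $W$ is a standard $D$-dimensional Wiener process, independent of the initial condition; $\mu_0^\epsilon$ is a probability measure on $\mathbb{R}^D$ for each $\epsilon>0$. It is assumed that the SDE for $v^\epsilon$ has solution paths that are continuous on $[0,T]$. Standing Assumption: $f\in C^2(\mathbb{R}^D,\mathbb{R}^D)$ and there exist a constant $c>0$ and $s\in\mathbb{N}$ such that, for $1\le d\le D$ and every multi-index $\alpha$ with $|\alpha|=2$, $|\partial^\alpha f_d(u)|\le c(1+|u|^s)$ for all $u\in\mathbb{R}^D$. Moreover, for any $m_0\in\mathbb{R}^D$, the ODE $\frac{dm}{dt}=f(m)$, $t\in[0,T]$, $m(0)=m_0$, has a unique solution on $[0,T]$. Construction of $\nu^{\epsilon,\Delta t}$: with $\Delta t=T/K$ and $t_k=k\Delta t$, $0\le k\le K$, let $$m_{k+1}^{\Delta t}=m_k^{\Delta t}+\Delta t\,f(m_k^{\Delta t}),\quad 0\le k\le K-1,\qquad m_0^{\Delta t}=m_0,$$ and let $m^{\Delta t}:[0,T]\to\mathbb{R}^D$ be the piecewise linear interpolant, $m^{\Delta t}(t)=m_k^{\Delta t}+(t-t_k)f(m_k^{\Delta t})$ for $t\in[t_k,t_{k+1}]$. Define $$g_t^{\Delta t}(u)=f(m_k^{\Delta t})+Df(m_k^{\Delta t})\bigl(u-m^{\Delta t}(t)\bigr),\qquad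 t\in(t_k,t_{k+1}),\ u\in\mathbb{R}^D,$$ where $Df$ is the Jacobian of $f$. Then $\nu^{\epsilon,\Delta t}$ is the law in $C([0,T],\mathbb{R}^D)$ of the solution of $$dl^{\epsilon,\Delta t}=g_t^{\Delta t}(l^{\epsilon,\Delta t})\,dt+\sqrt{\epsilon\Sigma}\,dW,\qquad l^{\epsilon,\Delta t}(0)\sim N(m_0,\epsilon C_0),$$ so $\nu_0^{\epsilon,\Delta t}=N(m_0,\epsilon C_0)$ (a Dirac measure at $m_0$ if $C_0=0$). For a measure $\mu$ on $C([0,T],\mathbb{R}^D)$ and $t\in[0,T]$, $\mu_t$ is the push-forward of $\mu$ under the evaluation map $h\mapsto h(t)$. The Kullback-Leibler divergence is $D_{\mathrm{KL}}(\nu\|\mu)=\mathbb{E}^\nu\log\frac{d\nu}{d\mu}$ if $\nu\ll\mu$, and $+\infty$ otherwise. *)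

theory Defs
  imports "HOL-Probability.Probability"
begin

section \<open>Matrices\<close>

definition sym_pos_semidef :: "real^'n^'n \<Rightarrow> bool" where
  "sym_pos_semidef A \<longleftrightarrow> transpose A = A \<and> (\<forall>x. 0 \<le> x \<bullet> (A *v x))"

definition sym_pos_def :: "real^'n^'n \<Rightarrow> bool" where
  "sym_pos_def A \<longleftrightarrow> transpose A = A \<and> (\<forall>x. x \<noteq> 0 \<longrightarrow> 0 < x \<bullet> (A *v x))"

text \<open>The unique symmetric positive semi-definite square root; meaningful only if the
  argument is itself symmetric positive semi-definite.\<close>

definition matrix_sqrt :: "real^'n^'n \<Rightarrow> real^'n^'n" where
  "matrix_sqrt A = (THE B. sym_pos_semidef B \<and> B ** B = A)"


section \<open>The standing assumption on the drift\<close>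

definition partial :: "'n \<Rightarrow> (real^'n \<Rightarrow> real) \<Rightarrow> real^'n \<Rightarrow> real" where
  "partial i g u = deriv (\<lambda>h. g (u + h *\<^sub>R axis i 1)) 0"

definition has_partial :: "'n \<Rightarrow> (real^'n \<Rightarrow> real) \<Rightarrow> bool" where
  "has_partial i g \<longleftrightarrow> (\<forall>u. (\<lambda>h. g (u + h *\<^sub>R axis i 1)) differentiable at 0)"

text \<open>All partial derivatives of order at most \<open>k\<close> exist and are continuous.\<close>

primrec Ck :: "nat \<Rightarrow> (real^'n \<Rightarrow> real) \<Rightarrow> bool" where
  "Ck 0 g \<longleftrightarrow> continuous_on UNIV g"
| "Ck (Suc k) g \<longleftrightarrow> continuous_on UNIV g \<and> (\<forall>i. has_partial i g \<and> Ck k (partial i g))"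

definition ode_solution :: "real \<Rightarrow> (real^'n \<Rightarrow> real^'n) \<Rightarrow> real^'n \<Rightarrow> (real \<Rightarrow> real^'n) \<Rightarrow> bool" where
  "ode_solution T f x m \<longleftrightarrow>
     m 0 = x \<and> (\<forall>t\<in>{0..T}. (m has_vector_derivative f (m t)) (at t within {0..T}))"

definition standing_assumption :: "real \<Rightarrow> (real^'n \<Rightarrow> real^'n) \<Rightarrow> bool" where
  "standing_assumption T f \<longleftrightarrow>
     (\<forall>d. Ck 2 (\<lambda>u. f u $ d)) \<and>
     (\<exists>c>0. \<exists>s::nat. \<forall>d i j u.
        \<bar>partial i (partial j (\<lambda>u. f u $ d)) u\<bar> \<le> c * (1 + norm u ^ s)) \<and>
     (\<forall>x. \<exists>m. ode_solution T f x m \<and>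
        (\<forall>m'. ode_solution T f x m' \<longrightarrow> (\<forall>t\<in>{0..T}. m' t = m t)))"


section \<open>Gaussian measures, Wiener process and additive-noise SDEs\<close>

text \<open>The law of \<open>m + C\<^sup>1\<^sup>/\<^sup>2 \<xi>\<close> with \<open>\<xi>\<close> a vector of independent standard normals;
  \<open>C\<close> may be singular, and \<open>C = 0\<close> gives the Dirac measure at \<open>m\<close>.\<close>

definition multivariate_normal :: "real^'n \<Rightarrow> real^'n^'n \<Rightarrow> (real^'n) measure" where
  "multivariate_normal m C =
     distr (Pi\<^sub>M UNIV (\<lambda>_. density lborel std_normal_density)) borel
       (\<lambda>\<xi>. m + matrix_sqrt C *v (\<chi> i. \<xi> i))"

definition wiener_process :: "'a measure \<Rightarrow> (real \<Rightarrow> 'a \<Rightarrow> real^'n) \<Rightarrow> bool" where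
  "wiener_process M W \<longleftrightarrow>
     prob_space M \<and>
     (\<forall>t\<ge>0. W t \<in> borel_measurable M) \<and>
     (AE \<omega> in M. W 0 \<omega> = 0) \<and>
     (AE \<omega> in M. continuous_on {0..} (\<lambda>t. W t \<omega>)) \<and>
     (\<forall>s t. 0 \<le> s \<and> s < t \<longrightarrow>
        distr M borel (\<lambda>\<omega>. W t \<omega> - W s \<omega>) = multivariate_normal 0 ((t - s) *\<^sub>R mat 1)) \<and>
     (\<forall>(n::nat) \<tau>. 0 \<le> \<tau> 0 \<and> mono \<tau> \<longrightarrow>
        prob_space.indep_vars M (\<lambda>_. borel) (\<lambda>i \<omega>. W (\<tau> (Suc i)) \<omega> - W (\<tau> i) \<omega>) {..<n})"

text \<open>\<open>X\<close> solves \<open>dX = b\<^sub>t(X) dt + S dW\<close> on \<open>[0,T]\<close> with \<open>X(0)\<close> distributed according to \<open>\<mu>0\<close>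
  and independent of the whole process \<open>W\<close>, and has continuous paths. Since \<open>S\<close> is constant, the
  stochastic integral is \<open>S W(t)\<close> (up to the null set where \<open>W(0) \<noteq> 0\<close>), so the integral equation
  is a pathwise one. No adaptedness is demanded: for the drifts used here, which are locally
  Lipschitz in the state, pathwise uniqueness makes \<open>X\<close> adapted automatically.\<close>

definition sde_solution ::
  "'a measure \<Rightarrow> (real \<Rightarrow> 'a \<Rightarrow> real^'n) \<Rightarrow> real \<Rightarrow> (real \<Rightarrow> real^'n \<Rightarrow> real^'n) \<Rightarrow> real^'n^'n \<Rightarrow>
   (real^'n) measure \<Rightarrow> (real \<Rightarrow> 'a \<Rightarrow> real^'n) \<Rightarrow> bool" where
  "sde_solution M W T b S \<mu>0 X \<longleftrightarrow>
     (\<forall>t\<in>{0..T}. X t \<in> borel_measurable M) \<and>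
     (\<forall>\<omega>\<in>space M. continuous_on {0..T} (\<lambda>t. X t \<omega>)) \<and>
     distr M borel (X 0) = \<mu>0 \<and>
     prob_space.indep_set M
       (sets (vimage_algebra (space M) (X 0) borel))
       (sets (vimage_algebra (space M) (\<lambda>\<omega>. \<lambda>t\<in>{0..}. W t \<omega>) (Pi\<^sub>M {0..} (\<lambda>_. borel)))) \<and>
     (AE \<omega> in M. \<forall>t\<in>{0..T}.
        ((\<lambda>s. b s (X s \<omega>)) has_integral (X t \<omega> - X 0 \<omega> - S *v W t \<omega>)) {0..t})"


section \<open>Laws on path space and Kullback-Leibler divergence\<close>

text \<open>\<open>C([0,T],\<real>\<^sup>D)\<close> as functions that are continuous on \<open>[0,T]\<close> and \<open>undefined\<close> outside it, with
  the \<open>\<sigma>\<close>-algebra generated by the evaluation maps. By separability this is the Borel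
  \<open>\<sigma>\<close>-algebra of the supremum metric.\<close>

definition path_space :: "real \<Rightarrow> (real \<Rightarrow> real^'n) measure" where
  "path_space T = restrict_space (Pi\<^sub>M {0..T} (\<lambda>_. borel)) {h. continuous_on {0..T} h}"

definition path_law :: "'a measure \<Rightarrow> real \<Rightarrow> (real \<Rightarrow> 'a \<Rightarrow> real^'n) \<Rightarrow> (real \<Rightarrow> real^'n) measure" where
  "path_law M T X = distr M (path_space T) (\<lambda>\<omega>. \<lambda>t\<in>{0..T}. X t \<omega>)"

definition marginal :: "real \<Rightarrow> (real \<Rightarrow> real^'n) measure \<Rightarrow> (real^'n) measure" where
  "marginal t \<mu> = distr \<mu> borel (\<lambda>h. h t)"

text \<open>The extended-real divergence \<open>D(\<nu> || \<mu>)\<close>, for probability measures on the same measurable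
  space. The library's real-valued \<open>KL_divergence b \<mu> \<nu>\<close>, with the arguments in this order, is the
  \<open>\<nu>\<close>-integral of \<open>log d\<nu>/d\<mu>\<close>, and is \<open>0\<close> by convention if that is not integrable. The negative
  part of \<open>log d\<nu>/d\<mu>\<close> always has a finite \<open>\<nu>\<close>-integral, so in the non-integrable case the
  expectation is \<open>+\<infinity>\<close>.\<close>

definition KL :: "'a measure \<Rightarrow> 'a measure \<Rightarrow> ereal" where
  "KL \<nu> \<mu> =
     (if absolutely_continuous \<mu> \<nu> \<and> integrable \<nu> (entropy_density (exp 1) \<mu> \<nu>)
      then ereal (KL_divergence (exp 1) \<mu> \<nu>) else \<infinity>)"


section \<open>Linearisation along the Euler scheme\<close>

context
  fixes f :: "real^'n \<Rightarrow> real^'n" and m0 :: "real^'n" and h :: real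
begin

primrec euler :: "nat \<Rightarrow> real^'n" where
  "euler 0 = m0"
| "euler (Suc k) = euler k + h *\<^sub>R f (euler k)"

text \<open>For a step size \<open>h > 0\<close>, the index \<open>k\<close> with \<open>t \<in> [k h, (k + 1) h)\<close>.\<close>

definition step_index :: "real \<Rightarrow> nat" where
  "step_index t = nat \<lfloor>t / h\<rfloor>"

definition euler_interp :: "real \<Rightarrow> real^'n" where
  "euler_interp t = (let k = step_index t in euler k + (t - real k * h) *\<^sub>R f (euler k))"

text \<open>The value chosen at the grid points is irrelevant, as the drift is only ever integrated
  in time.\<close>

definition euler_linear_drift :: "real \<Rightarrow> real^'n \<Rightarrow> real^'n" where
  "euler_linear_drift t u =
     (let k = step_index t
      in f (euler k) + jacobian f (at (euler k)) *v (u - euler_interp t))"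

end

end

theory Submission
  imports Defs
begin

text \<open>
  The divergence is handled in its Donsker--Varadhan form: \<open>KL \<nu> \<mu> \<le> C\<close> if and only if
  \<open>\<integral>\<phi> d\<nu> \<le> ln (\<integral>exp \<phi> d\<mu>) + C\<close> for all bounded measurable \<open>\<phi>\<close>. These inequalities pass to
  push-forwards and to weak limits, so that Girsanov's theorem is not needed. Both equations have
  additive noise, hence for almost every Wiener path their Euler--Maruyama chains, driven by the same
  increments, converge to the solutions. For two chains the chain rule and the Cameron--Martin shift
  of one Gaussian increment give the bound
  \<open>KL(\<nu>\<^sub>0, \<mu>\<^sub>0) + 1/2 \<Sum>\<^sub>j h E|(\<epsilon>\<Sigma>)\<^sup>-\<^sup>1\<^sup>/\<^sup>2 (g - f)(X\<^sub>j)|\<^sup>2\<close>. The chain of the linearised equation is Gaussian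
  around the Euler polygon, with moment generating function bounded by that of a variance of order
  \<open>\<epsilon>\<close> uniformly in the mesh, and Taylor's formula bounds \<open>|g - f|\<close> by a quadratic term in the deviation plus
  \<open>O(\<Delta>t)\<close>; so every summand is of order \<open>h (\<epsilon>\<^sup>2 + \<Delta>t\<^sup>2) / \<epsilon>\<close>.
\<close>

section \<open>Square roots of positive semi-definite matrices\<close>

text \<open>The obstacle is the polynomial growth of \<open>f\<close>: Euler--Maruyama chains of the
  equation for \<open>v\<close> may have uncontrolled moments. They enter only through almost sure
  convergence; every expectation in the cost is taken under the chain of the linearised equation,
  whose exponential moments are explicit. Two grids occur. The coarse one, with \<open>K\<close>
  cells, belongs to the statement and stays fixed; the fine one, with \<open>K * q\<close> cells,
  refines it and disappears as \<open>q\<close> grows. The fine sum has \<open>K * q\<close> terms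
  of weight \<open>T / (2 * K * q)\<close>, so a uniform bound on the terms gives a total that does
  not depend on \<open>q\<close>. The factor \<open>1 / \<epsilon>\<close> is the squared size of
  the inverse noise matrix; a deviation of size \<open>sqrt \<epsilon>\<close> enters the squared
  Taylor error with power at least four, which supplies \<open>\<epsilon>^2\<close>. A small coarse
  mesh keeps the Euler nodes in a fixed ball, where \<open>f\<close> and its Jacobian have fixed
  bounds, and \<open>\<epsilon> < 1\<close> lets the higher moments be absorbed into the
  fourth.\<close>

lemma symmetric_matrix_inner:
  fixes A :: "real^'n^'n"
  shows "transpose A = A \<longleftrightarrow> (\<forall>x y. x \<bullet> (A *v y) = (A *v x) \<bullet> y)"
proof
  assume "transpose A = A"
  then show "\<forall>x y. x \<bullet> (A *v y) = (A *v x) \<bullet> y"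
    by (metis dot_lmul_matrix transpose_matrix_vector)
next
  assume *: "\<forall>x y. x \<bullet> (A *v y) = (A *v x) \<bullet> y"
  have "transpose A *v x = A *v x" for x
  proof -
    have "(transpose A *v x) \<bullet> y = (A *v x) \<bullet> y" for y
      using * by (metis dot_lmul_matrix transpose_matrix_vector)
    then show ?thesis by (metis vector_eq_rdot)
  qed
  then show "transpose A = A" by (simp add: matrix_eq)
qed

text \<open>A maximiser \<open>x\<close> of the Rayleigh quotient on the unit sphere of
  \<open>V\<close> is an eigenvector: the form \<open>Q\<close> is nonnegative on \<open>V\<close>
  and zero at \<open>x\<close>, and a small move along the residual \<open>r\<close> would make it
  negative unless \<open>r = 0\<close>.\<close>

lemma symmetric_matrix_eigenvector_in_subspace:
  fixes A :: "real^'n^'n"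
  assumes A: "transpose A = A" and V: "subspace V" "\<And>x. x \<in> V \<Longrightarrow> A *v x \<in> V" "V \<noteq> {0}"
  shows "\<exists>x\<in>V. norm x = 1 \<and> (\<exists>c. A *v x = c *\<^sub>R x)"
proof -
  obtain y where y: "y \<in> V" "y \<noteq> 0" using V subspace_0 by blast
  have "compact (V \<inter> sphere 0 1)"
    using closed_Int_compact[OF closed_subspace[OF V(1)] compact_sphere] .
  moreover have "(1 / norm y) *\<^sub>R y \<in> V \<inter> sphere 0 1"
    using y V(1) by (auto simp: subspace_scale)
  moreover have "continuous_on (V \<inter> sphere 0 1) (\<lambda>x. x \<bullet> (A *v x))"
    by (intro continuous_intros linear_continuous_on matrix_vector_mul_bounded_linear)
  ultimately obtain x where "x \<in> V \<inter> sphere 0 1"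
      "\<forall>z\<in>V \<inter> sphere 0 1. z \<bullet> (A *v z) \<le> x \<bullet> (A *v x)"
    using continuous_attains_sup[of "V \<inter> sphere 0 1" "\<lambda>x. x \<bullet> (A *v x)"] by blast
  then have x: "x \<in> V" "norm x = 1"
    and max: "\<And>z. z \<in> V \<Longrightarrow> norm z = 1 \<Longrightarrow> z \<bullet> (A *v z) \<le> x \<bullet> (A *v x)"
    by auto
  define c where "c = x \<bullet> (A *v x)"
  define Q where "Q z = c * (z \<bullet> z) - z \<bullet> (A *v z)" for z
  have Q: "0 \<le> Q z" if "z \<in> V" for z
  proof (cases "z = 0")
    case False
    have "((1 / norm z) *\<^sub>R z) \<bullet> (A *v ((1 / norm z) *\<^sub>R z)) \<le> c"
      unfolding c_def using False that V(1) by (intro max) (auto simp: subspace_scale)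
    then have "(z \<bullet> (A *v z)) / (norm z)^2 \<le> c"
      by (simp add: matrix_vector_mult_scaleR power2_eq_square)
    then have "z \<bullet> (A *v z) \<le> c * (norm z)^2"
      using False by (simp add: divide_le_eq)
    then show ?thesis by (simp add: Q_def power2_norm_eq_inner)
  qed (simp add: Q_def)
  define r where "r = A *v x - c *\<^sub>R x"
  have rV: "r \<in> V" unfolding r_def using V x by (intro subspace_diff subspace_scale) auto
  have sym: "x \<bullet> (A *v r) = (A *v x) \<bullet> r" using A symmetric_matrix_inner by blast
  \<comment> \<open>Symmetry of \<open>A\<close> turns the cross term into
    \<open>- 2 * t * (r \<bullet> r)\<close>: the residual is, up to sign, half the gradient of
    \<open>Q\<close> at \<open>x\<close>.\<close>
  have expand: "Q (x + t *\<^sub>R r) = t * (t * Q r - 2 * (r \<bullet> r))" for t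
  proof -
    have xx: "x \<bullet> x = 1" using x by (simp add: dot_square_norm)
    have "Q (x + t *\<^sub>R r) = Q x + 2 * t * (c * (x \<bullet> r) - (A *v x) \<bullet> r) + t * t * Q r"
      unfolding Q_def
      by (simp add: matrix_vector_right_distrib matrix_vector_mult_scaleR inner_add_left
          inner_add_right sym inner_commute[of r "A *v x"] inner_commute[of r x] algebra_simps)
    moreover have "Q x = 0" by (simp add: Q_def c_def xx)
    moreover have "c * (x \<bullet> r) - (A *v x) \<bullet> r = - (r \<bullet> r)"
      by (simp add: r_def inner_diff_left inner_diff_right algebra_simps inner_commute)
    ultimately show ?thesis by (simp add: algebra_simps)
  qed
  have "r \<bullet> r = 0"
  proof (rule ccontr)
    assume "r \<bullet> r \<noteq> 0"
    then have a: "r \<bullet> r > 0" by simp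
    \<comment> \<open>Small enough that the quadratic term \<open>t * Q r\<close> uses up at most
      half of \<open>2 * (r \<bullet> r)\<close>; the \<open>+ 1\<close> keeps the denominator
      positive.\<close>
    define t where "t = (r \<bullet> r) / (Q r + 1)"
    have q: "0 \<le> Q r" using Q rV by auto
    have t: "t > 0" using a q by (simp add: t_def)
    have "t * Q r \<le> r \<bullet> r" using a q by (simp add: t_def field_simps)
    then have "t * (t * Q r - 2 * (r \<bullet> r)) < 0" using a t by (intro mult_pos_neg) linarith+
    moreover have "0 \<le> Q (x + t *\<^sub>R r)"
      using x rV V by (intro Q subspace_add subspace_scale) auto
    ultimately show False using expand[of t] by linarith
  qed
  then have "A *v x = c *\<^sub>R x" by (simp add: r_def)
  then show ?thesis using x by blast
qed

text \<open>Induction on the dimension: split off one unit eigenvector \<open>x\<close>; by symmetry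
  the orthogonal complement of \<open>x\<close> inside \<open>V\<close> is again invariant.\<close>

lemma symmetric_matrix_eigenbasis_of_subspace:
  fixes A :: "real^'n^'n"
  assumes A: "transpose A = A"
  shows "subspace V \<Longrightarrow> (\<And>x. x \<in> V \<Longrightarrow> A *v x \<in> V) \<Longrightarrow>
    \<exists>B. pairwise orthogonal B \<and> (\<forall>b\<in>B. norm b = 1 \<and> (\<exists>c. A *v b = c *\<^sub>R b)) \<and> span B = V"
proof (induction "dim V" arbitrary: V rule: less_induct)
  case less
  show ?case
  proof (cases "V = {0}")
    case True
    then show ?thesis by (intro exI[of _ "{}"]) auto
  next
    case False
    obtain x c where x: "x \<in> V" "norm x = 1" "A *v x = c *\<^sub>R x"
      using symmetric_matrix_eigenvector_in_subspace[OF A less.prems False] by blast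
    have xx: "x \<bullet> x = 1" using x by (simp add: dot_square_norm)
    define V' where "V' = {y \<in> V. x \<bullet> y = 0}"
    have V': "subspace V'"
      using less.prems(1) by (auto simp: V'_def subspace_def inner_add_right)
    have "x \<notin> V'" using xx by (simp add: V'_def)
    then have "V' \<subset> V" using x(1) unfolding V'_def by blast
    then have "dim V' < dim V"
      using V' less.prems(1) by (intro dim_psubset) (simp add: span_eq_iff[THEN iffD2])
    moreover have "A *v y \<in> V'" if "y \<in> V'" for y
    proof -
      have "x \<bullet> (A *v y) = (A *v x) \<bullet> y" using A symmetric_matrix_inner by blast
      then show ?thesis using that x less.prems(2) by (auto simp: V'_def)
    qed
    ultimately obtain B where B: "pairwise orthogonal B"
        "\<forall>b\<in>B. norm b = 1 \<and> (\<exists>c. A *v b = c *\<^sub>R b)" "span B = V'"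
      using less.hyps V' by blast
    have BV: "B \<subseteq> V'" using B(3) span_superset by blast
    have "span (insert x B) = V"
    proof
      show "span (insert x B) \<subseteq> V"
        using BV x \<open>V' \<subset> V\<close> less.prems(1) by (intro span_minimal) auto
      show "V \<subseteq> span (insert x B)"
      proof
        fix y assume y: "y \<in> V"
        have "y - (x \<bullet> y) *\<^sub>R x \<in> V'"
          using y x less.prems(1) xx by (auto simp: V'_def inner_diff_right intro!: subspace_diff subspace_scale)
        then have "y - (x \<bullet> y) *\<^sub>R x \<in> span B" using B by simp
        then show "y \<in> span (insert x B)" by (auto simp: span_insert)
      qed
    qed
    moreover have "pairwise orthogonal (insert x B)"
      using B(1) BV by (auto simp: pairwise_insert orthogonal_def V'_def inner_commute)
    ultimately show ?thesis using B(2) x by (intro exI[of _ "insert x B"]) auto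
  qed
qed

lemma symmetric_matrix_orthonormal_eigenbasis:
  fixes A :: "real^'n^'n"
  assumes "transpose A = A"
  obtains B where "finite B" "\<And>a b. a \<in> B \<Longrightarrow> b \<in> B \<Longrightarrow> a \<bullet> b = (if a = b then 1 else 0)"
    "span B = UNIV" "\<And>b. b \<in> B \<Longrightarrow> A *v b = (b \<bullet> (A *v b)) *\<^sub>R b"
proof -
  obtain B where B: "pairwise orthogonal B" "\<forall>b\<in>B. norm b = 1 \<and> (\<exists>c. A *v b = c *\<^sub>R b)" "span B = UNIV"
    using symmetric_matrix_eigenbasis_of_subspace[OF assms, of UNIV] by auto
  have "0 \<notin> B" using B(2) by auto
  then have "independent B" using B(1) by (rule pairwise_orthogonal_independent[rotated])
  then have "finite B" using independent_imp_finite by blast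
  moreover have "a \<bullet> b = (if a = b then 1 else 0)" if "a \<in> B" "b \<in> B" for a b
    using that B(1,2) by (auto simp: pairwise_def orthogonal_def dot_square_norm)
  moreover have "A *v b = (b \<bullet> (A *v b)) *\<^sub>R b" if "b \<in> B" for b
    using that B(2) by (auto simp: dot_square_norm)
  ultimately show ?thesis using that B(3) by blast
qed

text \<open>Compare on an eigenvector \<open>b\<close> of \<open>S\<close> with eigenvalue
  \<open>s\<close>. If \<open>s > 0\<close>, then \<open>y = R *v b - s *\<^sub>R b\<close>
  satisfies \<open>R *v y = - s *\<^sub>R y\<close>, which semi-definiteness of \<open>R\<close>
  allows only for \<open>y = 0\<close>. If \<open>s = 0\<close>, then \<open>R *v b\<close> has norm
  zero.\<close>

lemma sym_pos_semidef_sqrt_unique: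
  fixes S R :: "real^'n^'n"
  assumes S: "sym_pos_semidef S" and R: "sym_pos_semidef R" and eq: "S ** S = R ** R"
  shows "S = R"
proof -
  have Ssym: "transpose S = S" and Rsym: "transpose R = R"
    using S R by (auto simp: sym_pos_semidef_def)
  obtain B where B: "finite B" "\<And>a b. a \<in> B \<Longrightarrow> b \<in> B \<Longrightarrow> a \<bullet> b = (if a = b then 1 else 0)"
    "span B = UNIV" "\<And>b. b \<in> B \<Longrightarrow> S *v b = (b \<bullet> (S *v b)) *\<^sub>R b"
    by (rule symmetric_matrix_orthonormal_eigenbasis[OF Ssym]) blast
  have "R *v b = S *v b" if b: "b \<in> B" for b
  proof -
    define s where "s = b \<bullet> (S *v b)"
    have s: "s \<ge> 0" "S *v b = s *\<^sub>R b"
      using S B(4)[OF b] unfolding s_def sym_pos_semidef_def by blast+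
    have RR: "R *v (R *v b) = (s * s) *\<^sub>R b"
      using eq s(2) by (metis matrix_vector_mul_assoc matrix_vector_mult_scaleR scaleR_scaleR)
    show ?thesis
    proof (cases "s = 0")
      case True
      have "(R *v b) \<bullet> (R *v b) = b \<bullet> (R *v (R *v b))"
        using Rsym symmetric_matrix_inner by metis
      also have "\<dots> = 0" using RR True by simp
      finally show ?thesis using s True by simp
    next
      case False
      define y where "y = R *v b - s *\<^sub>R b"
      have "R *v y = - s *\<^sub>R y"
        by (simp add: y_def matrix_vector_mult_diff_distrib matrix_vector_mult_scaleR RR scaleR_diff_right)
      then have "y \<bullet> (R *v y) = - s * (y \<bullet> y)" by simp
      moreover have "0 \<le> y \<bullet> (R *v y)" using R by (auto simp: sym_pos_semidef_def)
      ultimately have "s * (y \<bullet> y) \<le> 0" by simp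
      then have "y \<bullet> y \<le> 0" using s False by (simp add: mult_le_0_iff)
      then have "y = 0" using inner_eq_zero_iff[of y] inner_ge_zero[of y] by linarith
      then show ?thesis using s by (simp add: y_def)
    qed
  qed
  then have "R *v y = S *v y" for y
    using linear_eq_on[OF matrix_vector_mul_linear matrix_vector_mul_linear, of y B R S] B(3) by simp
  then show ?thesis by (simp add: matrix_eq)
qed

text \<open>Spectral construction: \<open>g\<close> multiplies each vector of an orthonormal
  eigenbasis by the square root of its eigenvalue.\<close>

lemma sym_pos_semidef_sqrt_exists:
  fixes A :: "real^'n^'n"
  assumes A: "sym_pos_semidef A"
  shows "\<exists>S. sym_pos_semidef S \<and> S ** S = A"
proof -
  have Asym: "transpose A = A" using A by (auto simp: sym_pos_semidef_def)
  obtain B where B: "finite B" "\<And>a b. a \<in> B \<Longrightarrow> b \<in> B \<Longrightarrow> a \<bullet> b = (if a = b then 1 else 0)"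
    "span B = UNIV" "\<And>b. b \<in> B \<Longrightarrow> A *v b = (b \<bullet> (A *v b)) *\<^sub>R b"
    by (rule symmetric_matrix_orthonormal_eigenbasis[OF Asym]) blast
  define c where "c b = sqrt (b \<bullet> (A *v b))" for b
  have c: "0 \<le> c b" "c b * c b = b \<bullet> (A *v b)" for b
    using A by (auto simp: sym_pos_semidef_def c_def)
  define g where "g x = (\<Sum>b\<in>B. (c b * (b \<bullet> x)) *\<^sub>R b)" for x
  have lin: "linear g"
    unfolding g_def by (intro linearI) (auto simp: inner_add_right algebra_simps sum.distrib scaleR_sum_right)
  define S where "S = matrix g"
  have Sg: "S *v x = g x" for x unfolding S_def using lin by (simp add: matrix_works)
  have inner: "x \<bullet> (S *v y) = (\<Sum>b\<in>B. c b * (b \<bullet> x) * (b \<bullet> y))" for x y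
    by (simp add: Sg g_def inner_sum_right inner_commute mult_ac)
  have "transpose S = S"
    unfolding symmetric_matrix_inner inner inner_commute[of "S *v _"] by (simp add: mult_ac)
  moreover have "0 \<le> x \<bullet> (S *v x)" for x
    unfolding inner by (intro sum_nonneg) (simp add: c(1) mult.assoc)
  ultimately have psd: "sym_pos_semidef S" by (auto simp: sym_pos_semidef_def)
  have gb: "g b = c b *\<^sub>R b" if b: "b \<in> B" for b
  proof -
    have "g b = (\<Sum>a\<in>B. if a = b then c b *\<^sub>R b else 0)"
      unfolding g_def using B(2) b by (intro sum.cong) auto
    then show ?thesis using B(1) b by simp
  qed
  have "S *v (S *v b) = A *v b" if "b \<in> B" for b
  proof -
    have "S *v (S *v b) = (b \<bullet> (A *v b)) *\<^sub>R b"
      unfolding Sg gb[OF that] linear_scale[OF lin] using c(2) by simp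
    then show ?thesis using B(4)[OF that] by simp
  qed
  then have "(S ** S) *v y = A *v y" for y
    using linear_eq_on[OF matrix_vector_mul_linear matrix_vector_mul_linear, of y B "S ** S" A] B(3)
    by (simp add: matrix_vector_mul_assoc)
  then have "S ** S = A" by (simp add: matrix_eq)
  then show ?thesis using psd by blast
qed

lemma matrix_sqrt:
  fixes A :: "real^'n^'n"
  assumes "sym_pos_semidef A"
  shows "sym_pos_semidef (matrix_sqrt A)" "matrix_sqrt A ** matrix_sqrt A = A"
proof -
  have "\<exists>!B. sym_pos_semidef B \<and> B ** B = A"
    using sym_pos_semidef_sqrt_exists[OF assms] sym_pos_semidef_sqrt_unique by metis
  from theI'[OF this]
  show "sym_pos_semidef (matrix_sqrt A)" "matrix_sqrt A ** matrix_sqrt A = A"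
    by (auto simp: matrix_sqrt_def)
qed

lemma matrix_sqrt_unique:
  fixes A :: "real^'n^'n"
  assumes "sym_pos_semidef B" "B ** B = A"
  shows "matrix_sqrt A = B"
  unfolding matrix_sqrt_def using assms sym_pos_semidef_sqrt_unique by (intro the_equality) auto

lemma sym_pos_semidef_scaleR: "sym_pos_semidef A \<Longrightarrow> 0 \<le> c \<Longrightarrow> sym_pos_semidef (c *\<^sub>R A)"
  unfolding sym_pos_semidef_def symmetric_matrix_inner
  by (auto simp: scaleR_matrix_vector_assoc[symmetric] zero_le_mult_iff)

text \<open>Isolates the dependence on \<open>\<epsilon>\<close>: the noise matrix is
  \<open>sqrt \<epsilon>\<close> times a fixed one, so its norm and that of its inverse scale
  explicitly.\<close>

lemma matrix_sqrt_scaleR: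
  fixes A :: "real^'n^'n"
  assumes A: "sym_pos_semidef A" and c: "0 \<le> c"
  shows "matrix_sqrt (c *\<^sub>R A) = sqrt c *\<^sub>R matrix_sqrt A"
proof (intro matrix_sqrt_unique sym_pos_semidef_scaleR)
  show "(sqrt c *\<^sub>R matrix_sqrt A) ** (sqrt c *\<^sub>R matrix_sqrt A) = c *\<^sub>R A"
    using c matrix_sqrt(2)[OF A]
    by (simp add: matrix_scalar_ac scalar_matrix_assoc[symmetric])
qed (use c matrix_sqrt(1)[OF A] in auto)

lemma matrix_sqrt_scaleR_mat:
  "0 \<le> c \<Longrightarrow> matrix_sqrt (c *\<^sub>R mat 1 :: real^'n^'n) = sqrt c *\<^sub>R mat 1"
  by (subst matrix_sqrt_scaleR)
    (auto simp: sym_pos_semidef_def transpose_mat matrix_sqrt_unique)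

lemma sym_pos_def_imp_semidef: "sym_pos_def A \<Longrightarrow> sym_pos_semidef A"
  by (metis inner_zero_left order_le_less sym_pos_def_def sym_pos_semidef_def)

text \<open>A right inverse solves \<open>S *v u = h *\<^sub>R (a - b)\<close> for \<open>u\<close>;
  this is how a difference of drifts is absorbed into a shift of the noise.\<close>

lemma matrix_sqrt_right_inverse:
  fixes A :: "real^'n^'n"
  assumes "sym_pos_def A"
  obtains R where "matrix_sqrt A ** R = mat 1"
proof -
  let ?S = "matrix_sqrt A"
  have eq: "?S ** ?S = A" using matrix_sqrt sym_pos_def_imp_semidef assms by blast
  have "x = 0" if "?S *v x = 0" for x
  proof (rule ccontr)
    assume "x \<noteq> 0"
    moreover have "A *v x = 0" using that eq by (metis matrix_vector_mul_assoc mult_zero_right matrix_vector_mult_0_right)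
    ultimately show False using assms by (auto simp: sym_pos_def_def)
  qed
  then obtain R where "R ** ?S = mat 1"
    using matrix_left_invertible_ker[of ?S] by auto
  then show ?thesis using that matrix_left_right_inverse by blast
qed

section \<open>Taylor estimates from partial derivatives\<close>

text \<open>Telescoping along the coordinate directions reduces a bound on an increment to the
  one-dimensional mean value theorem, without assuming differentiability.\<close>
lemma increment_bound_of_partials:
  fixes g :: "real^'n \<Rightarrow> real"
  assumes g: "\<And>i. has_partial i g"
    and B: "\<And>i c. norm (c - p) \<le> norm (u - p) \<Longrightarrow> \<bar>partial i g c\<bar> \<le> B"
  shows "\<bar>g u - g p\<bar> \<le> B * (\<Sum>i\<in>UNIV. \<bar>u $ i - p $ i\<bar>)"
proof -
  define mix where "mix I = (\<chi> k. if k \<in> I then u $ k else p $ k)" for I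
  have B0: "0 \<le> B" using B[of p undefined] by (simp add: order_trans[OF abs_ge_zero])
  have "\<bar>g (mix I) - g p\<bar> \<le> B * (\<Sum>i\<in>I. \<bar>u $ i - p $ i\<bar>)" if "finite I" for I
    using that
  proof (induction I)
    case empty
    have "mix {} = p" by (simp add: mix_def vec_eq_iff)
    then show ?case by simp
  next
    case (insert i I)
    define w where "w = mix I"
    define a where "a = u $ i - p $ i"
    have wi: "w $ i = p $ i" using insert by (simp add: w_def mix_def)
    have mixI: "mix (insert i I) = w + a *\<^sub>R axis i 1"
      using insert by (auto simp: vec_eq_iff mix_def w_def a_def axis_def)
    define \<phi> where "\<phi> h = g (w + h *\<^sub>R axis i 1)" for h
    have deriv: "(\<phi> has_real_derivative partial i g (w + h *\<^sub>R axis i 1)) (at h)" for h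
    proof -
      let ?c = "w + h *\<^sub>R axis i 1"
      have "((\<lambda>k. g (?c + k *\<^sub>R axis i 1)) has_real_derivative partial i g ?c) (at 0)"
        using g[of i] unfolding has_partial_def partial_def
        by (metis DERIV_deriv_iff_real_differentiable)
      then have "((\<lambda>k. \<phi> (h + k)) has_real_derivative partial i g ?c) (at 0)"
        by (simp add: \<phi>_def scaleR_left_distrib add.assoc)
      then have "((\<lambda>k. \<phi> (k + h)) has_real_derivative partial i g ?c) (at 0)" by (simp add: add.commute)
      then show ?thesis using DERIV_shift[of \<phi> _ 0 h] by simp
    qed
    \<comment> \<open>The intermediate points stay in the ball where \<open>B\<close> is assumed,
      because each coordinate of their displacement from \<open>p\<close> is at most that of
      \<open>u - p\<close>.\<close>
    have bnd: "\<bar>partial i g (w + h *\<^sub>R axis i 1)\<bar> \<le> B" if h: "\<bar>h\<bar> \<le> \<bar>a\<bar>" for h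
    proof (rule B)
      show "norm (w + h *\<^sub>R axis i 1 - p) \<le> norm (u - p)"
        using h insert by (intro norm_le_componentwise_cart) (auto simp: w_def mix_def a_def axis_def)
    qed
    have "\<bar>\<phi> a - \<phi> 0\<bar> \<le> B * \<bar>a - 0\<bar>"
    proof -
      have "norm (\<phi> a - \<phi> 0) \<le> B * norm (a - 0)"
      proof (rule field_differentiable_bound[where S = "cball 0 \<bar>a\<bar>" and f' = "\<lambda>h. partial i g (w + h *\<^sub>R axis i 1)"])
        show "(\<phi> has_field_derivative partial i g (w + z *\<^sub>R axis i 1)) (at z within cball 0 \<bar>a\<bar>)" for z
          using deriv has_field_derivative_at_within by blast
      qed (use bnd in auto)
      then show ?thesis by simp
    qed
    moreover have "\<phi> a = g (mix (insert i I))" "\<phi> 0 = g (mix I)"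
      by (simp_all add: \<phi>_def mixI w_def)
    ultimately have "\<bar>g (mix (insert i I)) - g (mix I)\<bar> \<le> B * \<bar>a\<bar>" by simp
    then have "\<bar>g (mix (insert i I)) - g p\<bar> \<le> B * \<bar>a\<bar> + B * (\<Sum>i\<in>I. \<bar>u $ i - p $ i\<bar>)"
      using insert.IH by linarith
    then show ?case using insert by (simp add: a_def algebra_simps)
  qed
  from this[of UNIV] show ?thesis by (simp add: mix_def)
qed

lemma sum_component_le_card_norm:
  fixes x :: "real^'n"
  shows "(\<Sum>i\<in>UNIV. \<bar>x $ i\<bar>) \<le> real CARD('n) * norm x"
  using sum_bounded_above[of UNIV "\<lambda>i. \<bar>x $ i\<bar>" "norm x"] component_le_norm_cart by auto

lemma norm_le_card_component:
  fixes x :: "real^'n"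
  assumes "\<And>i. \<bar>x $ i\<bar> \<le> B"
  shows "norm x \<le> real CARD('n) * B"
proof -
  have "norm x \<le> (\<Sum>i\<in>UNIV. \<bar>x $ i\<bar>)" by (rule norm_le_l1_cart)
  also have "\<dots> \<le> real CARD('n) * B" using sum_bounded_above[of UNIV "\<lambda>i. \<bar>x $ i\<bar>" B] assms by auto
  finally show ?thesis .
qed

text \<open>Two uses of \<open>increment_bound_of_partials\<close>: one on each first partial of
  \<open>g\<close>, one on \<open>q\<close>, which is \<open>g\<close> minus its linear part at
  \<open>p\<close>. Each use loses a factor \<open>CARD('n)\<close> in passing from the sum of
  coordinates to the norm.\<close>

lemma taylor_bound_of_second_partials:
  fixes g :: "real^'n \<Rightarrow> real"
  assumes g: "\<And>i. has_partial i g" "\<And>i j. has_partial i (partial j g)"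
    and B: "\<And>i j c. norm (c - p) \<le> norm (u - p) \<Longrightarrow> \<bar>partial i (partial j g) c\<bar> \<le> B"
  shows "\<bar>g u - g p - (\<Sum>i\<in>UNIV. partial i g p * (u $ i - p $ i))\<bar>
    \<le> B * (real CARD('n))\<^sup>2 * (norm (u - p))\<^sup>2"
proof -
  let ?D = "real CARD('n)"
  have B0: "0 \<le> B" using B[of p undefined undefined] by (simp add: order_trans[OF abs_ge_zero])
  define q where "q x = g x - (\<Sum>k\<in>UNIV. partial k g p * (x $ k))" for x
  have der: "((\<lambda>h. q (c + h *\<^sub>R axis i 1)) has_real_derivative partial i g c - partial i g p) (at 0)" for i c
  proof -
    have g': "((\<lambda>h. g (c + h *\<^sub>R axis i 1)) has_real_derivative partial i g c) (at 0)"
      using g(1)[of i] unfolding has_partial_def partial_def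
      by (metis DERIV_deriv_iff_real_differentiable)
    have "(\<Sum>k\<in>UNIV. partial k g p * ((c + h *\<^sub>R axis i 1) $ k))
        = (\<Sum>k\<in>UNIV. partial k g p * (c $ k)) + partial i g p * h" for h
    proof -
      have "(\<Sum>k\<in>UNIV. partial k g p * ((c + h *\<^sub>R axis i 1) $ k))
        = (\<Sum>k\<in>UNIV. partial k g p * (c $ k) + (if k = i then partial i g p * h else 0))"
        by (intro sum.cong) (auto simp: axis_def algebra_simps)
      then show ?thesis by (simp add: sum.distrib)
    qed
    then have "q (c + h *\<^sub>R axis i 1) = g (c + h *\<^sub>R axis i 1) - ((\<Sum>k\<in>UNIV. partial k g p * (c $ k)) + partial i g p * h)" for h
      by (simp add: q_def)
    then show ?thesis by (auto intro!: derivative_eq_intros g')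
  qed
  have "has_partial i q" "partial i q c = partial i g c - partial i g p" for i c
    using der DERIV_imp_deriv unfolding has_partial_def partial_def real_differentiable_def by blast+
  note q = this
  have "\<bar>partial i q c\<bar> \<le> B * ?D * norm (u - p)" if c: "norm (c - p) \<le> norm (u - p)" for i c
  proof -
    have "\<bar>partial i g c - partial i g p\<bar> \<le> B * (\<Sum>k\<in>UNIV. \<bar>c $ k - p $ k\<bar>)"
      using g(2) B c by (intro increment_bound_of_partials) (auto intro: order_trans)
    also have "\<dots> \<le> B * (?D * norm (c - p))"
      using sum_component_le_card_norm[of "c - p"] B0 by (intro mult_left_mono) auto
    also have "\<dots> \<le> B * (?D * norm (u - p))" using c B0 by (intro mult_left_mono) auto
    finally show ?thesis by (simp add: q mult_ac)
  qed
  then have "\<bar>q u - q p\<bar> \<le> (B * ?D * norm (u - p)) * (\<Sum>k\<in>UNIV. \<bar>u $ k - p $ k\<bar>)"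
    using q(1) by (intro increment_bound_of_partials) auto
  also have "\<dots> \<le> (B * ?D * norm (u - p)) * (?D * norm (u - p))"
    using sum_component_le_card_norm[of "u - p"] B0 by (intro mult_left_mono) auto
  finally show ?thesis
    by (simp add: q_def power2_eq_square mult_ac sum_subtractf right_diff_distrib algebra_simps)
qed

text \<open>Everything about \<open>f\<close> that the sequel uses, apart from solvability of the
  ODE. The Taylor bound keeps the growth exponent \<open>s\<close>, since it is applied at random,
  unbounded \<open>u\<close>; the Lipschitz bounds are local.\<close>

lemma standing_assumption_derivatives:
  fixes f :: "real^'n \<Rightarrow> real^'n"
  assumes "standing_assumption T f"
  obtains C s where "0 < C"
    "\<And>u p. norm (f u - f p - jacobian f (at p) *v (u - p)) \<le> C * (1 + (norm p + norm (u - p)) ^ s) * (norm (u - p))\<^sup>2"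
    "\<And>p. f differentiable (at p)"
    "\<And>r. \<exists>L\<ge>0. (\<forall>u u'. norm u \<le> r \<longrightarrow> norm u' \<le> r \<longrightarrow> norm (f u - f u') \<le> L * norm (u - u')) \<and>
        (\<forall>p x. norm p \<le> r \<longrightarrow> norm (jacobian f (at p) *v x) \<le> L * norm x)"
proof -
  obtain c s where c: "c > 0" and bnd:
    "\<And>d i j u. \<bar>partial i (partial j (\<lambda>u. f u $ d)) u\<bar> \<le> c * (1 + norm u ^ s)"
    and ck: "\<And>d. Ck 2 (\<lambda>u. f u $ d)"
    using assms unfolding standing_assumption_def by blast
  let ?D = "real CARD('n)"
  have ck0: "continuous_on UNIV (partial i (\<lambda>u. f u $ d))" for i d
    using ck[of d] by (auto simp: numeral_2_eq_2)
  have ck1: "has_partial i (\<lambda>u. f u $ d)" and ck2: "has_partial i (partial j (\<lambda>u. f u $ d))" for i j d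
    using ck[of d] by (auto simp: numeral_2_eq_2)
  define J where "J p = (\<chi> d i. partial i (\<lambda>u. f u $ d) p)" for p
  define C where "C = c * ?D ^ 3"
  have C: "C > 0" using c by (simp add: C_def)
  have tay: "norm (f u - f p - J p *v (u - p)) \<le> C * (1 + (norm p + norm (u - p)) ^ s) * (norm (u - p))\<^sup>2" for u p
  proof -
    have "\<bar>(f u - f p - J p *v (u - p)) $ d\<bar> \<le> (c * (1 + (norm p + norm (u - p)) ^ s)) * ?D\<^sup>2 * (norm (u - p))\<^sup>2" for d
    proof -
      have "\<bar>f u $ d - f p $ d - (\<Sum>i\<in>UNIV. partial i (\<lambda>u. f u $ d) p * (u $ i - p $ i))\<bar>
         \<le> (c * (1 + (norm p + norm (u - p)) ^ s)) * ?D\<^sup>2 * (norm (u - p))\<^sup>2"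
      proof (rule taylor_bound_of_second_partials[OF ck1 ck2])
        fix i j x assume "norm (x - p) \<le> norm (u - p)"
        then have "norm x \<le> norm p + norm (u - p)" by norm
        then have "norm x ^ s \<le> (norm p + norm (u - p)) ^ s" by (intro power_mono) auto
        then have "c * (1 + norm x ^ s) \<le> c * (1 + (norm p + norm (u - p)) ^ s)" using c by auto
        then show "\<bar>partial i (partial j (\<lambda>u. f u $ d)) x\<bar> \<le> c * (1 + (norm p + norm (u - p)) ^ s)"
          using bnd order_trans by blast
      qed
      then show ?thesis by (simp add: J_def matrix_vector_mult_def)
    qed
    from norm_le_card_component[OF this] show ?thesis
      by (simp add: C_def power3_eq_cube power2_eq_square mult_ac)
  qed
  have der: "(f has_derivative (\<lambda>h. J p *v h)) (at p)" for p
    unfolding has_derivative_at_alt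
  proof (intro conjI allI impI)
    show "bounded_linear ((*v) (J p))" by (rule matrix_vector_mul_bounded_linear)
    fix e :: real assume e: "e > 0"
    \<comment> \<open>Bounds the Taylor constant for all \<open>y\<close> with
      \<open>norm (y - p) \<le> 1\<close>; the radius \<open>e / E\<close> then turns the quadratic
      error into a small linear one.\<close>
    define E where "E = C * (1 + (norm p + 1) ^ s)"
    have E: "E > 0" using C unfolding E_def by (intro mult_pos_pos) (auto intro!: add_pos_nonneg)
    show "\<exists>d>0. \<forall>y. norm (y - p) < d \<longrightarrow> norm (f y - f p - J p *v (y - p)) \<le> e * norm (y - p)"
    proof (intro exI[of _ "min 1 (e / E)"] conjI allI impI)
      fix y assume y: "norm (y - p) < min 1 (e / E)"
      have "(norm p + norm (y - p)) ^ s \<le> (norm p + 1) ^ s" using y by (intro power_mono) auto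
      then have "C * (1 + (norm p + norm (y - p)) ^ s) \<le> E" using C by (auto simp: E_def)
      then have "C * (1 + (norm p + norm (y - p)) ^ s) * (norm (y - p))\<^sup>2 \<le> E * (norm (y - p))\<^sup>2"
        by (intro mult_right_mono) auto
      then have "norm (f y - f p - J p *v (y - p)) \<le> (E * norm (y - p)) * norm (y - p)"
        using tay[of y p] by (simp add: power2_eq_square mult_ac)
      also have "\<dots> \<le> e * norm (y - p)"
        using y E by (intro mult_right_mono) (auto simp: field_simps)
      finally show "norm (f y - f p - J p *v (y - p)) \<le> e * norm (y - p)" .
    qed (use e E in auto)
  qed
  \<comment> \<open>The quadratic bound already gives a Frechet derivative, and its uniqueness
    identifies the library's \<open>jacobian\<close> with the matrix of partials.\<close>
  have jac: "jacobian f (at p) = J p" for p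
    using frechet_derivative_at[OF der[of p]] by (metis jacobian_def matrix_of_matrix_vector_mul)
  have diff: "f differentiable (at p)" for p using der differentiable_def by blast
  have lip: "\<exists>L\<ge>0. (\<forall>u u'. norm u \<le> r \<longrightarrow> norm u' \<le> r \<longrightarrow> norm (f u - f u') \<le> L * norm (u - u')) \<and>
        (\<forall>p x. norm p \<le> r \<longrightarrow> norm (jacobian f (at p) *v x) \<le> L * norm x)" for r
  proof (cases "r < 0")
    case True
    then have "\<not> norm u \<le> r" for u :: "real^'n" using norm_ge_zero[of u] by linarith
    then show ?thesis by (intro exI[of _ 0]) auto
  next
    case False
    \<comment> \<open>Radius \<open>3 * r\<close>, because the increment bound between
      \<open>u'\<close> and \<open>u\<close> visits points at distance up to
      \<open>norm (u - u') \<le> 2 * r\<close> from \<open>u'\<close>.\<close>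
    have "\<exists>B. \<forall>x\<in>cball 0 (3 * r). \<bar>partial i (\<lambda>u. f u $ d) x\<bar> \<le> B" for i d
    proof -
      have "compact (partial i (\<lambda>u. f u $ d) ` cball 0 (3 * r))"
        by (intro compact_continuous_image continuous_on_subset[OF ck0]) auto
      then have "bounded (partial i (\<lambda>u. f u $ d) ` cball 0 (3 * r))" by (rule compact_imp_bounded)
      then show ?thesis unfolding bounded_iff by auto
    qed
    then obtain Bd where Bd: "\<And>i d x. x \<in> cball 0 (3 * r) \<Longrightarrow> \<bar>partial i (\<lambda>u. f u $ d) x\<bar> \<le> Bd i d" by metis
    define B where "B = (\<Sum>i\<in>UNIV. \<Sum>d\<in>UNIV. \<bar>Bd i d\<bar>)"
    have B0: "0 \<le> B" unfolding B_def by (intro sum_nonneg) auto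
    have B: "\<bar>partial i (\<lambda>u. f u $ d) x\<bar> \<le> B" if "norm x \<le> 3 * r" for i d x
    proof -
      have "\<bar>partial i (\<lambda>u. f u $ d) x\<bar> \<le> \<bar>Bd i d\<bar>" using Bd[of x i d] that by auto
      also have "\<dots> \<le> (\<Sum>d\<in>UNIV. \<bar>Bd i d\<bar>)" by (rule member_le_sum) auto
      also have "\<dots> \<le> B" unfolding B_def by (rule member_le_sum[of i UNIV "\<lambda>i. \<Sum>d\<in>UNIV. \<bar>Bd i d\<bar>"]) (auto intro: sum_nonneg)
      finally show ?thesis .
    qed
    show ?thesis
    proof (intro exI[of _ "?D * (B * ?D)"] conjI allI impI)
      fix u u' :: "real^'n" assume u: "norm u \<le> r" "norm u' \<le> r"
      have "\<bar>(f u - f u') $ d\<bar> \<le> B * ?D * norm (u - u')" for d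
      proof -
        have "\<bar>f u $ d - f u' $ d\<bar> \<le> B * (\<Sum>i\<in>UNIV. \<bar>u $ i - u' $ i\<bar>)"
        proof (rule increment_bound_of_partials[OF ck1 B])
          fix c assume "norm (c - u') \<le> norm (u - u')"
          then show "norm c \<le> 3 * r" using u by norm
        qed
        also have "\<dots> \<le> B * (?D * norm (u - u'))"
          using sum_component_le_card_norm[of "u - u'"] B0 by (intro mult_left_mono) auto
        finally show ?thesis by (simp add: mult_ac)
      qed
      from norm_le_card_component[OF this] show "norm (f u - f u') \<le> ?D * (B * ?D) * norm (u - u')"
        by (simp add: mult_ac)
    next
      fix p x :: "real^'n" assume p: "norm p \<le> r"
      have "\<bar>(J p *v x) $ d\<bar> \<le> B * ?D * norm x" for d
      proof -
        have "\<bar>(J p *v x) $ d\<bar> \<le> (\<Sum>i\<in>UNIV. \<bar>partial i (\<lambda>u. f u $ d) p * x $ i\<bar>)"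
          unfolding J_def matrix_vector_mult_def by (simp add: sum_abs)
        also have "\<dots> \<le> (\<Sum>i\<in>UNIV. B * \<bar>x $ i\<bar>)"
        proof (rule sum_mono)
          fix i
          have "norm p \<le> 3 * r" using p False by simp
          then show "\<bar>partial i (\<lambda>u. f u $ d) p * x $ i\<bar> \<le> B * \<bar>x $ i\<bar>"
            unfolding abs_mult by (intro mult_right_mono B) auto
        qed
        also have "\<dots> \<le> B * (?D * norm x)"
          unfolding sum_distrib_left[symmetric] using sum_component_le_card_norm[of x] B0 by (intro mult_left_mono)
        finally show ?thesis by (simp add: mult_ac)
      qed
      from norm_le_card_component[OF this] show "norm (jacobian f (at p) *v x) \<le> ?D * (B * ?D) * norm x"
        unfolding jac by (simp add: mult_ac)
    qed (use B0 in simp)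
  qed
  show ?thesis
    by (rule that[OF C, of s]) (use tay jac diff lip in auto)
qed

section \<open>Pathwise convergence of the Euler scheme with additive noise\<close>

text \<open>The value \<open>w j\<close> is the increment of the driving path over the step \<open>j\<close>, not the path itself.\<close>
primrec euler_chain :: "real \<Rightarrow> (nat \<Rightarrow> 'v::real_vector \<Rightarrow> 'v) \<Rightarrow> 'v \<Rightarrow> (nat \<Rightarrow> 'v) \<Rightarrow> nat \<Rightarrow> 'v" where
  "euler_chain h b x w 0 = x"
| "euler_chain h b x w (Suc j) = euler_chain h b x w j + h *\<^sub>R b j (euler_chain h b x w j) + w j"

text \<open>Discrete Gronwall argument: chain and path carry the same increment \<open>w j\<close>,
  which cancels in the error. The comparison \<open>lip\<close> is available only within distance 1
  of the path, so the induction also has to keep the chain there, which is what \<open>small\<close>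
  is for.\<close>

lemma euler_chain_error_bound:
  fixes x :: "real \<Rightarrow> 'v::euclidean_space"
  assumes h: "0 < h" "real n * h = T" and L: "0 \<le> L" and eta: "0 \<le> \<eta>"
    and incr: "\<And>j. j < n \<Longrightarrow>
      ((\<lambda>s. b s (x s)) has_integral (x (real (Suc j) * h) - x (real j * h) - w j)) {real j * h..real (Suc j) * h}"
    and lip: "\<And>j s u. j < n \<Longrightarrow> real j * h \<le> s \<Longrightarrow> s < real (Suc j) * h \<Longrightarrow>
       norm (u - x (real j * h)) \<le> 1 \<Longrightarrow>
       norm (b s (x s) - c j u) \<le> L * norm (u - x (real j * h)) + \<eta>"
    and small: "T * \<eta> * exp (L * T) \<le> 1"
    and j: "j \<le> n"
  shows "norm (euler_chain h c (x 0) w j - x (real j * h)) \<le> T * \<eta> * exp (L * T)"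
proof -
  define X where "X = euler_chain h c (x 0) w"
  have bound: "real j * h * \<eta> * (1 + L * h) ^ j \<le> T * \<eta> * exp (L * T)" if "j \<le> n" for j
  proof -
    have jT: "real j * h \<le> T" using that h by (metis mult_right_mono of_nat_le_iff less_imp_le)
    have "(1 + L * h) ^ j \<le> exp (L * h) ^ j" using L h by (intro power_mono) auto
    also have "\<dots> = exp (L * (real j * h))" by (simp add: exp_of_nat_mult[symmetric] mult_ac)
    also have "\<dots> \<le> exp (L * T)" using jT L by (simp add: mult_left_mono)
    finally have "(1 + L * h) ^ j \<le> exp (L * T)" .
    then show ?thesis using jT eta L h by (intro mult_mono) auto
  qed
  have "norm (X j - x (real j * h)) \<le> real j * h * \<eta> * (1 + L * h) ^ j" if "j \<le> n" for j
    using that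
  proof (induction j)
    case 0
    then show ?case by (simp add: X_def)
  next
    case (Suc j)
    define t where "t = real j * h"
    define e where "e = norm (X j - x t)"
    have IH: "e \<le> real j * h * \<eta> * (1 + L * h) ^ j" using Suc by (simp add: e_def t_def)
    then have e1: "e \<le> 1" using bound[of j] small Suc.prems by linarith
    have e0: "0 \<le> e" by (simp add: e_def)
    have tS: "real (Suc j) * h = t + h" by (simp add: t_def algebra_simps)
    have "((\<lambda>s. b s (x s) - c j (X j)) has_integral ((x (t + h) - x t - w j) - h *\<^sub>R c j (X j))) {t..t + h}"
    proof -
      have "j < n" using Suc.prems by simp
      from incr[OF this] have "((\<lambda>s. b s (x s)) has_integral (x (t + h) - x t - w j)) {t..t + h}"
        unfolding tS by (simp add: t_def)
      from has_integral_diff[OF this has_integral_const_real[of "c j (X j)" t "t + h"]] h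
      show ?thesis by simp
    qed
    then have "norm ((x (t + h) - x t - w j) - h *\<^sub>R c j (X j)) \<le> (L * e + \<eta>) * measure lborel {t..t + h}"
    \<comment> \<open>The right endpoint is removed as a negligible set: \<open>lip\<close> speaks
      of half-open cells, since the drift may jump at a grid point.\<close>
    proof (rule has_integral_bound_real[rotated 2, where S = "{t + h}"])
      show "0 \<le> L * e + \<eta>" using L e0 eta by simp
      show "norm (b s (x s) - c j (X j)) \<le> L * e + \<eta>" if "s \<in> {t..t + h} - {t + h}" for s
        using lip[of j s "X j"] that Suc.prems e1 unfolding tS t_def[symmetric] e_def by auto
    qed simp
    then have "norm ((x (t + h) - x t - w j) - h *\<^sub>R c j (X j)) \<le> (L * e + \<eta>) * h" using h by simp
    moreover have "norm (X (Suc j) - x (t + h)) \<le> e + norm ((x (t + h) - x t - w j) - h *\<^sub>R c j (X j))"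
    proof -
      have "X (Suc j) - x (t + h) = (X j - x t) - ((x (t + h) - x t - w j) - h *\<^sub>R c j (X j))"
        by (simp add: X_def algebra_simps)
      then show ?thesis unfolding e_def by (metis norm_triangle_ineq4)
    qed
    ultimately have "norm (X (Suc j) - x (t + h)) \<le> e + (L * e + \<eta>) * h" by (meson add_left_mono order_trans)
    also have "\<dots> = e * (1 + L * h) + h * \<eta>" by (simp add: algebra_simps)
    also have "\<dots> \<le> (real j * h * \<eta> * (1 + L * h) ^ j) * (1 + L * h) + h * \<eta> * (1 + L * h) ^ Suc j"
    proof (intro add_mono mult_right_mono IH)
      have "1 \<le> (1 + L * h) ^ Suc j" using L h by (intro one_le_power) auto
      then show "h * \<eta> \<le> h * \<eta> * (1 + L * h) ^ Suc j" using h eta mult_left_mono[of 1 _ "h * \<eta>"] by simp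
    qed (use L h in auto)
    also have "\<dots> = real (Suc j) * h * \<eta> * (1 + L * h) ^ Suc j" by (simp add: algebra_simps)
    finally show ?case by (simp only: tS)
  qed
  then show ?thesis using bound[OF j] j unfolding X_def by (meson order_trans)
qed

text \<open>Step numbers are restricted to a set \<open>A\<close> because the linearised drift jumps at the coarse grid
  points, which therefore have to belong to the fine grid.\<close>
lemma euler_chain_converges:
  fixes x :: "real \<Rightarrow> 'v::euclidean_space"
  assumes T: "0 < T" and cont: "continuous_on {0..T} x"
    and sol: "\<And>t. t \<in> {0..T} \<Longrightarrow> ((\<lambda>s. b s (x s)) has_integral (x t - x 0 - w t)) {0..t}"
    and lip: "\<And>R. \<exists>L\<ge>0. \<forall>n\<in>A. \<forall>j<n. \<forall>s u u'. real j * (T / real n) \<le> s \<longrightarrow> s < real (Suc j) * (T / real n) \<longrightarrow>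
       norm u \<le> R \<longrightarrow> norm u' \<le> R \<longrightarrow> norm (b s u - c n j u') \<le> L * (norm (u - u') + T / real n)"
    and e: "0 < e"
  shows "\<exists>N. \<forall>n\<in>A. N \<le> n \<longrightarrow> 0 < n \<longrightarrow> (\<forall>j\<le>n.
    norm (euler_chain (T / real n) (c n) (x 0)
       (\<lambda>j. w (real (Suc j) * (T / real n)) - w (real j * (T / real n))) j - x (real j * (T / real n))) \<le> e)"
proof -
  have "bounded (x ` {0..T})" using cont by (intro compact_imp_bounded compact_continuous_image) auto
  then obtain R0 where R0: "\<And>t. t \<in> {0..T} \<Longrightarrow> norm (x t) \<le> R0"
    unfolding bounded_iff by (meson imageI)
  \<comment> \<open>Room for the chain, which stays within distance 1 of the path.\<close>
  define R where "R = R0 + 1"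
  obtain L where L: "L \<ge> 0" and lipR: "\<forall>n\<in>A. \<forall>j<n. \<forall>s u u'. real j * (T / real n) \<le> s \<longrightarrow>
      s < real (Suc j) * (T / real n) \<longrightarrow> norm u \<le> R \<longrightarrow> norm u' \<le> R \<longrightarrow>
      norm (b s u - c n j u') \<le> L * (norm (u - u') + T / real n)"
    using lip[of R] by (elim exE conjE)
  define e' where "e' = min e 1"
  \<comment> \<open>One \<open>\<rho>\<close> bounds the oscillation of \<open>x\<close> over a cell
    and another the step size, so the consistency error is \<open>L * (2 * \<rho>)\<close>; this
    choice brings the Gronwall bound below \<open>e'\<close>. Using \<open>L + 1\<close> avoids
    division by zero.\<close>
  define \<rho> where "\<rho> = e' / ((L + 1) * T * exp (L * T) * 2)"
  have den: "0 < (L + 1) * T * exp (L * T) * 2" using L T by simp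
  have e': "0 < e'" "e' \<le> e" "e' \<le> 1" using e by (auto simp: e'_def)
  have \<rho>: "0 < \<rho>" using den e' by (simp add: \<rho>_def)
  have "uniformly_continuous_on {0..T} x" using cont by (intro compact_uniformly_continuous) auto
  then obtain d where d: "d > 0" and unif: "\<And>s t. s \<in> {0..T} \<Longrightarrow> t \<in> {0..T} \<Longrightarrow> dist s t < d \<Longrightarrow> dist (x s) (x t) < \<rho>"
    unfolding uniformly_continuous_on_def using \<rho> by metis
  obtain N :: nat where N: "T / min d \<rho> < real N" using reals_Archimedean2 by blast
  show ?thesis
  proof (intro exI[of _ N] ballI allI impI)
    fix n j :: nat assume n: "n \<in> A" "N \<le> n" "0 < n" and j: "j \<le> n"
    define h where "h = T / real n"
    have h: "0 < h" "real n * h = T" using T n by (auto simp: h_def)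
    have "T / min d \<rho> < real n" using N n by (meson less_le_trans of_nat_le_iff)
    then have "T < min d \<rho> * real n" using d \<rho> by (simp add: pos_divide_less_eq mult.commute)
    then have "h < min d \<rho>" using n pos_divide_less_eq[of "real n" T "min d \<rho>"] by (simp only: h_def of_nat_0_less_iff)
    then have hd: "h < d" "h < \<rho>" by auto
    have grid: "real j * h \<in> {0..T}" if "j \<le> n" for j
      using that h by (auto simp: h(2)[symmetric])
    have \<eta>: "T * (L * (2 * \<rho>)) * exp (L * T) \<le> e'"
    proof -
      have "T * (L * (2 * \<rho>)) * exp (L * T) \<le> T * ((L + 1) * (2 * \<rho>)) * exp (L * T)"
        using T \<rho> by (intro mult_right_mono mult_left_mono) auto
      also have "\<dots> = e'" using den by (simp add: \<rho>_def field_simps)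
      finally show ?thesis .
    qed
    have "norm (euler_chain h (c n) (x 0) (\<lambda>j. w (real (Suc j) * h) - w (real j * h)) j - x (real j * h))
        \<le> T * (L * (2 * \<rho>)) * exp (L * T)"
    proof (rule euler_chain_error_bound[where n = n and b = b])
      fix j assume j: "j < n"
      have t: "real j * h \<in> {0..T}" "real (Suc j) * h \<in> {0..T}" using grid[of j] grid[of "Suc j"] j by auto
      have le: "real j * h \<le> real (Suc j) * h" using h by simp
      have i1: "((\<lambda>s. b s (x s)) has_integral (x (real j * h) - x 0 - w (real j * h))) {0..real j * h}"
        and i2: "((\<lambda>s. b s (x s)) has_integral (x (real (Suc j) * h) - x 0 - w (real (Suc j) * h))) {0..real (Suc j) * h}"
        by (rule sol[OF t(1)], rule sol[OF t(2)])
      have "(\<lambda>s. b s (x s)) integrable_on {real j * h..real (Suc j) * h}"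
        using t(1) by (intro integrable_subinterval_real[OF has_integral_integrable[OF i2]])
          (simp add: atLeastatMost_subset_iff)
      then obtain I where I: "((\<lambda>s. b s (x s)) has_integral I) {real j * h..real (Suc j) * h}"
        unfolding integrable_on_def by (elim exE)
      have "((\<lambda>s. b s (x s)) has_integral (x (real j * h) - x 0 - w (real j * h)) + I) {0..real (Suc j) * h}"
        by (rule has_integral_combine[OF _ le i1 I]) (use t(1) in simp)
      then have "I = x (real (Suc j) * h) - x (real j * h) - (w (real (Suc j) * h) - w (real j * h))"
        using has_integral_unique[OF i2] by (simp add: algebra_simps)
      then show "((\<lambda>s. b s (x s)) has_integral x (real (Suc j) * h) - x (real j * h) - (w (real (Suc j) * h) - w (real j * h)))
          {real j * h..real (Suc j) * h}" using I by simp
    next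
      fix j s u assume a: "j < n" "real j * h \<le> s" "s < real (Suc j) * h" "norm (u - x (real j * h)) \<le> 1"
      have t: "real j * h \<in> {0..T}" "real (Suc j) * h \<in> {0..T}" using grid[of j] grid[of "Suc j"] a by auto
      then have s: "s \<in> {0..T}" using a by auto
      have "dist s (real j * h) < d" using a hd by (auto simp: dist_real_def algebra_simps)
      then have xs: "norm (x s - x (real j * h)) < \<rho>" using unif s t by (auto simp: dist_norm)
      have "norm u \<le> norm (x (real j * h)) + norm (u - x (real j * h))" by norm
      then have u: "norm u \<le> R" using a(4) R0[OF t(1)] by (simp add: R_def)
      have "norm (b s (x s) - c n j u) \<le> L * (norm (x s - u) + h)"
        unfolding h_def
      proof (rule lipR[rule_format])
        show "norm (x s) \<le> R" using R0[OF s] by (simp add: R_def)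
      qed (use a u n in \<open>auto simp: h_def\<close>)
      also have "\<dots> \<le> L * (norm (u - x (real j * h)) + 2 * \<rho>)"
      proof (intro mult_left_mono L)
        have "norm (x s - u) \<le> norm (u - x (real j * h)) + norm (x s - x (real j * h))" by norm
        then show "norm (x s - u) + h \<le> norm (u - x (real j * h)) + 2 * \<rho>" using xs hd by linarith
      qed
      finally show "norm (b s (x s) - c n j u) \<le> L * norm (u - x (real j * h)) + L * (2 * \<rho>)"
        by (simp add: algebra_simps)
    qed (use h L \<rho> \<eta> e' j in auto)
    with \<eta> e'(2) show "norm (euler_chain (T / real n) (c n) (x 0)
       (\<lambda>j. w (real (Suc j) * (T / real n)) - w (real j * (T / real n))) j - x (real j * (T / real n))) \<le> e"
      unfolding h_def by linarith
  qed
qed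

section \<open>Dual form of the divergence\<close>

text \<open>The Donsker--Varadhan dual form of \<open>KL \<nu> \<mu> \<le> C\<close>. Being an inequality between integrals of
  bounded functions, it survives push-forwards and weak limits.\<close>
definition entropic_bound :: "'a measure \<Rightarrow> 'a measure \<Rightarrow> real \<Rightarrow> bool" where
  "entropic_bound \<nu> \<mu> C \<longleftrightarrow>
     (\<forall>\<phi> :: 'a \<Rightarrow> real. \<phi> \<in> borel_measurable \<mu> \<longrightarrow> (\<exists>B. \<forall>x\<in>space \<mu>. \<bar>\<phi> x\<bar> \<le> B) \<longrightarrow>
        (\<integral>x. \<phi> x \<partial>\<nu>) \<le> ln (\<integral>x. exp (\<phi> x) \<partial>\<mu>) + C)"

lemma entropic_boundD:
  fixes \<phi> :: "'a \<Rightarrow> real"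
  shows "entropic_bound \<nu> \<mu> C \<Longrightarrow> \<phi> \<in> borel_measurable \<mu> \<Longrightarrow> (\<And>x. x \<in> space \<mu> \<Longrightarrow> \<bar>\<phi> x\<bar> \<le> B) \<Longrightarrow>
    (\<integral>x. \<phi> x \<partial>\<nu>) \<le> ln (\<integral>x. exp (\<phi> x) \<partial>\<mu>) + C"
  unfolding entropic_bound_def by blast

lemma entropic_boundI:
  "(\<And>(\<phi> :: 'a \<Rightarrow> real) B. \<phi> \<in> borel_measurable \<mu> \<Longrightarrow> (\<And>x. x \<in> space \<mu> \<Longrightarrow> \<bar>\<phi> x\<bar> \<le> B) \<Longrightarrow>
    (\<integral>x. \<phi> x \<partial>\<nu>) \<le> ln (\<integral>x. exp (\<phi> x) \<partial>\<mu>) + C) \<Longrightarrow> entropic_bound \<nu> \<mu> C"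
  unfolding entropic_bound_def by blast

lemma entropic_bound_mono: "entropic_bound \<nu> \<mu> C \<Longrightarrow> C \<le> C' \<Longrightarrow> entropic_bound \<nu> \<mu> C'"
  unfolding entropic_bound_def by fastforce

lemma (in prob_space) integrable_of_bounded:
  fixes \<phi> :: "'a \<Rightarrow> real"
  assumes "\<phi> \<in> borel_measurable M" "\<And>x. x \<in> space M \<Longrightarrow> \<bar>\<phi> x\<bar> \<le> B"
  shows "integrable M \<phi>"
  using assms by (intro integrable_const_bound[where B = B]) auto

lemma (in prob_space) exp_integral_bounds:
  fixes \<phi> :: "'a \<Rightarrow> real"
  assumes [measurable]: "\<phi> \<in> borel_measurable M" and B: "\<And>x. x \<in> space M \<Longrightarrow> \<bar>\<phi> x\<bar> \<le> B"
  shows "integrable M (\<lambda>x. exp (\<phi> x))" "exp (- B) \<le> (\<integral>x. exp (\<phi> x) \<partial>M)"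
    "(\<integral>x. exp (\<phi> x) \<partial>M) \<le> exp B" "0 < (\<integral>x. exp (\<phi> x) \<partial>M)" "\<bar>ln (\<integral>x. exp (\<phi> x) \<partial>M)\<bar> \<le> B"
proof -
  have b: "\<phi> x \<le> B" "- B \<le> \<phi> x" if "x \<in> space M" for x
    using B[OF that] by linarith+
  show int: "integrable M (\<lambda>x. exp (\<phi> x))"
    by (intro integrable_of_bounded[where B = "exp B"]) (auto simp: b)
  show lo: "exp (- B) \<le> (\<integral>x. exp (\<phi> x) \<partial>M)"
    by (intro integral_ge_const int) (auto simp: b)
  show up: "(\<integral>x. exp (\<phi> x) \<partial>M) \<le> exp B"
    by (intro integral_le_const int) (auto simp: b)
  show pos: "0 < (\<integral>x. exp (\<phi> x) \<partial>M)"
    using lo exp_gt_zero[of "-B"] by linarith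
  have "ln (\<integral>x. exp (\<phi> x) \<partial>M) \<le> B" using up pos by (metis exp_gt_zero ln_exp ln_le_cancel_iff)
  moreover have "- B \<le> ln (\<integral>x. exp (\<phi> x) \<partial>M)" using lo pos by (metis exp_gt_zero ln_exp ln_le_cancel_iff)
  ultimately show "\<bar>ln (\<integral>x. exp (\<phi> x) \<partial>M)\<bar> \<le> B" by linarith
qed

text \<open>Gibbs variational inequality: with \<open>Z\<close> the \<open>\<mu>\<close>-integral of
  \<open>exp \<phi>\<close>, apply \<open>ln g \<le> g - 1\<close> to the ratio \<open>g\<close> of
  the tilted density \<open>exp \<phi> / Z\<close> to \<open>D\<close>, and integrate under
  \<open>\<nu>\<close>.\<close>

lemma entropic_bound_of_density:
  fixes \<mu> \<nu> :: "'a measure"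
  assumes "prob_space \<mu>" "prob_space \<nu>" and \<nu>: "\<nu> = density \<mu> (\<lambda>x. ennreal (D x))"
    and D[measurable]: "D \<in> borel_measurable \<mu>" and D0: "\<And>x. 0 \<le> D x"
    and int: "integrable \<nu> (\<lambda>x. ln (D x))"
  shows "entropic_bound \<nu> \<mu> (\<integral>x. ln (D x) \<partial>\<nu>)"
proof (rule entropic_boundI)
  interpret \<mu>: prob_space \<mu> by fact
  interpret \<nu>: prob_space \<nu> by fact
  fix \<phi> :: "'a \<Rightarrow> real" and B assume [measurable]: "\<phi> \<in> borel_measurable \<mu>" and B: "\<And>x. x \<in> space \<mu> \<Longrightarrow> \<bar>\<phi> x\<bar> \<le> B"
  define Z where "Z = (\<integral>x. exp (\<phi> x) \<partial>\<mu>)"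
  note b = \<mu>.exp_integral_bounds[of \<phi>, OF _ B, folded Z_def]
  have Z: "0 < Z" using b by simp
  have sp: "space \<nu> = space \<mu>" "sets \<nu> = sets \<mu>" by (simp_all add: \<nu>)
  have pos: "AE x in \<nu>. 0 < D x"
    unfolding \<nu> by (subst AE_density) (auto simp: ennreal_lt_0)
  have \<phi>i: "integrable \<nu> \<phi>"
    using B by (intro \<nu>.integrable_of_bounded[where B = B]) (auto simp: sp \<nu>)
  \<comment> \<open>Where \<open>D x = 0\<close> the quotient is 0 by convention; hence the
    indicator in \<open>gD\<close>, and an integral of \<open>g\<close> that is only at most
    1.\<close>
  define g where "g x = exp (\<phi> x) / (Z * D x)" for x
  have gD: "D x * g x = indicator {x. 0 < D x} x * (exp (\<phi> x) / Z)" for x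
    using D0[of x] by (auto simp: g_def indicator_def)
  have [measurable]: "g \<in> borel_measurable \<mu>" unfolding g_def by measurable
  have iD: "integrable \<mu> (\<lambda>x. D x * g x)"
  proof (rule Bochner_Integration.integrable_bound[of \<mu> "\<lambda>x. exp (\<phi> x) / Z"])
    show "integrable \<mu> (\<lambda>x. exp (\<phi> x) / Z)" using b(1) by simp
    show "AE x in \<mu>. norm (D x * g x) \<le> norm (exp (\<phi> x) / Z)"
      unfolding gD using Z by (auto simp: indicator_def)
  qed simp
  have gi: "integrable \<nu> g"
    unfolding \<nu> using iD D0 by (subst integrable_density) auto
  have "(\<integral>x. g x \<partial>\<nu>) = (\<integral>x. D x * g x \<partial>\<mu>)"
    unfolding \<nu> using D0 by (subst integral_density) auto
  also have "\<dots> \<le> (\<integral>x. exp (\<phi> x) / Z \<partial>\<mu>)"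
    using b(1) Z by (intro integral_mono iD) (auto simp: gD indicator_def)
  also have "\<dots> = 1" using Z by (simp add: Z_def)
  finally have g1: "(\<integral>x. g x \<partial>\<nu>) \<le> 1" .
  have "(\<integral>x. \<phi> x - ln Z - ln (D x) \<partial>\<nu>) \<le> (\<integral>x. g x - 1 \<partial>\<nu>)"
  proof (rule integral_mono_AE)
    show "AE x in \<nu>. \<phi> x - ln Z - ln (D x) \<le> g x - 1"
      using pos
    proof eventually_elim
      case (elim x)
      have "ln (g x) \<le> g x - 1" using elim Z by (intro ln_le_minus_one) (simp add: g_def)
      moreover have "ln (g x) = \<phi> x - (ln Z + ln (D x))"
        using elim Z by (simp add: g_def ln_div ln_mult)
      ultimately show ?case by simp
    qed
  qed (use \<phi>i gi int in auto)
  then have "(\<integral>x. \<phi> x \<partial>\<nu>) - ln Z - (\<integral>x. ln (D x) \<partial>\<nu>) \<le> (\<integral>x. g x \<partial>\<nu>) - 1"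
    using \<phi>i gi int by (simp add: \<nu>.prob_space)
  then show "(\<integral>x. \<phi> x \<partial>\<nu>) \<le> ln (\<integral>x. exp (\<phi> x) \<partial>\<mu>) + (\<integral>x. ln (D x) \<partial>\<nu>)"
    using g1 by (simp add: Z_def)
qed

section \<open>Equivalence of the dual form with the divergence\<close>

lemma density_real_RN_deriv:
  assumes "prob_space \<mu>" "prob_space \<nu>" "sets \<nu> = sets \<mu>" "absolutely_continuous \<mu> \<nu>"
  shows "\<nu> = density \<mu> (\<lambda>x. ennreal (enn2real (RN_deriv \<mu> \<nu> x)))"
proof -
  interpret \<mu>: prob_space \<mu> by fact
  interpret \<nu>: prob_space \<nu> by fact
  obtain D where "AE x in \<mu>. RN_deriv \<mu> \<nu> x = ennreal (D x)"
    by (rule \<mu>.real_RN_deriv[OF \<nu>.finite_measure_axioms assms(4,3)])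
  then have "AE x in \<mu>. RN_deriv \<mu> \<nu> x = ennreal (enn2real (RN_deriv \<mu> \<nu> x))"
    by eventually_elim simp
  then have "density \<mu> (RN_deriv \<mu> \<nu>) = density \<mu> (\<lambda>x. ennreal (enn2real (RN_deriv \<mu> \<nu> x)))"
    by (intro density_cong) auto
  then show ?thesis using \<mu>.density_RN_deriv[OF assms(4,3)] by simp
qed

lemma entropic_bound_of_KL:
  assumes "prob_space \<mu>" "prob_space \<nu>" "sets \<nu> = sets \<mu>" and "KL \<nu> \<mu> \<noteq> \<infinity>"
  obtains C where "KL \<nu> \<mu> = ereal C" "entropic_bound \<nu> \<mu> C"
proof -
  interpret \<mu>: prob_space \<mu> by fact
  interpret \<nu>: prob_space \<nu> by fact
  have ac: "absolutely_continuous \<mu> \<nu>" and int: "integrable \<nu> (entropy_density (exp 1) \<mu> \<nu>)"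
    and KL: "KL \<nu> \<mu> = ereal (KL_divergence (exp 1) \<mu> \<nu>)"
    using assms(4) by (auto simp: KL_def split: if_splits)
  define D where "D x = enn2real (RN_deriv \<mu> \<nu> x)" for x
  have ed: "entropy_density (exp 1) \<mu> \<nu> = (\<lambda>x. ln (D x))"
    by (simp add: entropy_density_def D_def fun_eq_iff log_def)
  have "\<nu> = density \<mu> (\<lambda>x. ennreal (D x))"
    unfolding D_def using density_real_RN_deriv assms(1,2,3) ac by blast
  then have "entropic_bound \<nu> \<mu> (\<integral>x. ln (D x) \<partial>\<nu>)"
    using int[unfolded ed] by (intro entropic_bound_of_density assms) (auto simp: D_def)
  then show ?thesis using that KL by (simp add: KL_divergence_def ed)
qed

text \<open>On a \<open>\<mu>\<close>-null set \<open>N\<close> the test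
  \<open>t * indicator N\<close> has vanishing logarithmic term, so
  \<open>t * measure \<nu> N \<le> C\<close> for every real \<open>t\<close>.\<close>

lemma absolutely_continuous_of_entropic_bound:
  assumes "prob_space \<mu>" "prob_space \<nu>" and sets: "sets \<nu> = sets \<mu>" and bound: "entropic_bound \<nu> \<mu> C"
  shows "absolutely_continuous \<mu> \<nu>"
  unfolding absolutely_continuous_def
proof
  interpret \<mu>: prob_space \<mu> by fact
  interpret \<nu>: prob_space \<nu> by fact
  fix N assume N: "N \<in> null_sets \<mu>"
  then have [measurable]: "N \<in> sets \<mu>" "N \<in> sets \<nu>" using sets by auto
  have le: "t * measure \<nu> N \<le> C" for t :: real
  proof -
    have "(\<integral>x. t * indicator N x \<partial>\<nu>) \<le> ln (\<integral>x. exp (t * indicator N x) \<partial>\<mu>) + C"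
      by (rule entropic_boundD[OF bound, where B = "\<bar>t\<bar>"]) (auto simp: indicator_def)
    moreover have "(\<integral>x. exp (t * indicator N x) \<partial>\<mu>) = (\<integral>x. 1 \<partial>\<mu>)"
    proof (rule integral_cong_AE)
      show "AE x in \<mu>. exp (t * indicator N x) = 1"
        using AE_not_in[OF N] by eventually_elim simp
    qed auto
    ultimately show ?thesis by (simp add: \<mu>.prob_space)
  qed
  have "measure \<nu> N = 0"
  proof (rule ccontr)
    assume "measure \<nu> N \<noteq> 0"
    then have "(C + 1) / measure \<nu> N * measure \<nu> N = C + 1" by simp
    then show False using le[of "(C + 1) / measure \<nu> N"] by simp
  qed
  then show "N \<in> null_sets \<nu>" by (simp add: \<nu>.emeasure_eq_measure null_sets_def)
qed

text \<open>The optimal test \<open>ln D\<close> is unbounded, so it is replaced by its truncations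
  \<open>\<phi> n\<close>. Fatou's lemma yields integrability of \<open>ln D\<close>, without which
  \<open>KL\<close> would be infinite by definition; dominated convergence then yields the
  bound.\<close>

lemma KL_le_of_entropic_bound:
  assumes "prob_space \<mu>" "prob_space \<nu>" and sets: "sets \<nu> = sets \<mu>" and bound: "entropic_bound \<nu> \<mu> C"
  shows "KL \<nu> \<mu> \<le> ereal C"
proof -
  interpret \<mu>: prob_space \<mu> by fact
  interpret \<nu>: prob_space \<nu> by fact
  have ac: "absolutely_continuous \<mu> \<nu>"
    using absolutely_continuous_of_entropic_bound assms by blast
  define D where "D x = enn2real (RN_deriv \<mu> \<nu> x)" for x
  have [measurable]: "D \<in> borel_measurable \<mu>" unfolding D_def by measurable
  then have D\<nu>[measurable]: "D \<in> borel_measurable \<nu>" using sets measurable_cong_sets by blast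
  have D0: "0 \<le> D x" for x by (simp add: D_def)
  have ed: "entropy_density (exp 1) \<mu> \<nu> = (\<lambda>x. ln (D x))"
    by (simp add: entropy_density_def D_def fun_eq_iff log_def)
  have \<nu>: "\<nu> = density \<mu> (\<lambda>x. ennreal (D x))"
    unfolding D_def using density_real_RN_deriv assms(1,2,3) ac by blast
  have pos: "AE x in \<nu>. 0 < D x"
    by (subst \<nu>, subst AE_density) (auto simp: ennreal_lt_0)
  have Dnn: "(\<integral>\<^sup>+x. ennreal (D x) \<partial>\<mu>) = 1"
  proof -
    have "emeasure (density \<mu> (\<lambda>x. ennreal (D x))) (space \<mu>) = 1"
      using \<nu>.emeasure_space_1 sets_eq_imp_space_eq[OF sets] \<nu> by metis
    then show ?thesis by (simp add: emeasure_density)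
  qed
  have Di: "integrable \<mu> D" by (rule integrableI_nonneg) (auto simp: D0 Dnn)
  have D1: "(\<integral>x. D x \<partial>\<mu>) = 1"
    using Dnn by (subst integral_eq_nn_integral) (auto simp: D0)
  define \<phi> where "\<phi> n x = ln (max (1 / real (Suc n)) (min (real (Suc n)) (D x)))" for n x
  have [measurable]: "\<phi> n \<in> borel_measurable \<mu>" "\<phi> n \<in> borel_measurable \<nu>" for n
    unfolding \<phi>_def by measurable
  have clamp: "0 < max (1 / real (Suc n)) (min (real (Suc n)) (D x))" for n x
    by (simp add: less_max_iff_disj)
  have \<phi>B: "\<bar>\<phi> n x\<bar> \<le> ln (real (Suc n))" for n x
  proof -
    have 1: "1 / real (Suc n) \<le> real (Suc n)" by (rule order_trans[of _ 1]) auto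
    have "\<phi> n x \<le> ln (real (Suc n))"
      unfolding \<phi>_def using clamp[of n x] 1 by (subst ln_le_cancel_iff) (auto simp del: of_nat_Suc)
    moreover have "ln (1 / real (Suc n)) \<le> \<phi> n x"
      unfolding \<phi>_def using clamp[of n x] by (subst ln_le_cancel_iff) auto
    ultimately show ?thesis by (simp add: ln_div abs_le_iff)
  qed
  have \<phi>i: "integrable \<nu> (\<phi> n)" for n
    using \<phi>B by (intro \<nu>.integrable_of_bounded) auto
  \<comment> \<open>Clamping from above only decreases \<open>exp (\<phi> n x)\<close>, and clamping
    from below adds at most \<open>1 / real (Suc n)\<close> to \<open>D x\<close>, whose integral is
    1.\<close>
  have step: "(\<integral>x. \<phi> n x \<partial>\<nu>) \<le> ln (1 + 1 / real (Suc n)) + C" for n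
  proof -
    have "(\<integral>x. \<phi> n x \<partial>\<nu>) \<le> ln (\<integral>x. exp (\<phi> n x) \<partial>\<mu>) + C"
      by (rule entropic_boundD[OF bound _ \<phi>B]) simp
    also have "ln (\<integral>x. exp (\<phi> n x) \<partial>\<mu>) \<le> ln (1 + 1 / real (Suc n))"
    proof (subst ln_le_cancel_iff)
      show "0 < (\<integral>x. exp (\<phi> n x) \<partial>\<mu>)" by (rule \<mu>.exp_integral_bounds(4)[OF _ \<phi>B]) simp
      have "(\<integral>x. exp (\<phi> n x) \<partial>\<mu>) \<le> (\<integral>x. 1 / real (Suc n) + D x \<partial>\<mu>)"
      proof (rule integral_mono)
        show "integrable \<mu> (\<lambda>x. exp (\<phi> n x))" by (rule \<mu>.exp_integral_bounds(1)[OF _ \<phi>B]) simp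
        show "exp (\<phi> n x) \<le> 1 / real (Suc n) + D x" for x
        proof -
          have "min (real (Suc n)) (D x) \<le> 1 / real (Suc n) + D x"
            using min.cobounded2[of "real (Suc n)" "D x"] by (rule order_trans) simp
          then show ?thesis unfolding \<phi>_def exp_ln[OF clamp] using D0[of x] by (intro max.boundedI) auto
        qed
      qed (use Di in auto)
      also have "\<dots> = 1 + 1 / real (Suc n)" using Di by (simp add: D1 \<mu>.prob_space)
      finally show "(\<integral>x. exp (\<phi> n x) \<partial>\<mu>) \<le> 1 + 1 / real (Suc n)" .
    qed (simp add: add_pos_nonneg)
    finally show ?thesis by simp
  qed
  \<comment> \<open>A common integrable bound for the negative parts of all \<open>\<phi> n\<close>:
    under \<open>\<nu>\<close> the weight \<open>D\<close> cancels the inverse.\<close>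
  define g where "g x = inverse (D x)" for x
  have [measurable]: "g \<in> borel_measurable \<mu>" unfolding g_def by measurable
  have gi: "integrable \<nu> g" and g0: "0 \<le> g x" for x
  proof -
    have "integrable \<mu> (\<lambda>x. D x * g x)"
    proof (rule \<mu>.integrable_of_bounded[where B = 1])
      show "\<bar>D x * g x\<bar> \<le> 1" for x by (cases "D x = 0") (auto simp: g_def)
    qed simp
    then show "integrable \<nu> g"
      by (subst \<nu>, subst integrable_density) (auto simp: g_def D0)
  qed (simp add: g_def D0)
  have neg: "- \<phi> n x \<le> g x" if "0 < D x" for n x
  proof -
    let ?y = "max (1 / real (Suc n)) (min (real (Suc n)) (D x))"
    have "- \<phi> n x = ln (inverse ?y)" using clamp[of n x] by (simp add: \<phi>_def ln_inverse)
    show ?thesis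
    proof (cases "D x \<le> real (Suc n)")
      case True
      then have "inverse ?y \<le> inverse (D x)" using that by (intro le_imp_inverse_le) auto
      moreover have "ln (inverse ?y) \<le> inverse ?y - 1" using clamp[of n x] by (intro ln_le_minus_one) simp
      ultimately show ?thesis using \<open>- \<phi> n x = _\<close> by (simp add: g_def)
    next
      case False
      then have "?y = real (Suc n)" by (simp add: field_simps max_def)
      then have "0 \<le> \<phi> n x" by (simp add: \<phi>_def)
      then show ?thesis using g0[of x] by linarith
    qed
  qed
  have lim: "(\<lambda>n. \<phi> n x) \<longlonglongrightarrow> ln (D x)" if "0 < D x" for x
  proof -
    have "(\<lambda>n. max (1 / real (Suc n)) (min (real (Suc n)) (D x))) \<longlonglongrightarrow> D x"
    proof (rule tendsto_eventually)
      obtain N1 :: nat where N1: "D x < real N1" using reals_Archimedean2 by blast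
      obtain N2 :: nat where N2: "inverse (D x) < real N2" using reals_Archimedean2 by blast
      show "\<forall>\<^sub>F n in sequentially. max (1 / real (Suc n)) (min (real (Suc n)) (D x)) = D x"
        using eventually_ge_at_top[of "max N1 N2"]
      proof eventually_elim
        case (elim n)
        have "D x \<le> real (Suc n)" using elim N1 by simp
        moreover have "inverse (D x) \<le> real (Suc n)" using elim N2 by simp
        then have "1 / real (Suc n) \<le> D x" using that by (simp add: field_simps)
        ultimately show ?case by simp
      qed
    qed
    then show ?thesis unfolding \<phi>_def using that by (intro tendsto_ln) auto
  qed
  \<comment> \<open>Absolute value equals value plus twice the negative part, so the one-sided bound
    \<open>step\<close> controls the norms uniformly in \<open>n\<close>.\<close>
  have absn: "(\<integral>x. \<bar>\<phi> n x\<bar> \<partial>\<nu>) \<le> ln 2 + C + 2 * (\<integral>x. g x \<partial>\<nu>)" for n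
  proof -
    have "(\<integral>x. \<bar>\<phi> n x\<bar> \<partial>\<nu>) \<le> (\<integral>x. \<phi> n x + 2 * g x \<partial>\<nu>)"
    proof (rule integral_mono_AE)
      show "AE x in \<nu>. \<bar>\<phi> n x\<bar> \<le> \<phi> n x + 2 * g x"
        using pos by eventually_elim (use neg[of _ n] g0 in \<open>smt (verit)\<close>)
    qed (use \<phi>i gi in auto)
    also have "\<dots> = (\<integral>x. \<phi> n x \<partial>\<nu>) + 2 * (\<integral>x. g x \<partial>\<nu>)" using \<phi>i gi by simp
    also have "(\<integral>x. \<phi> n x \<partial>\<nu>) \<le> ln 2 + C"
    proof -
      have "ln (1 + 1 / real (Suc n)) \<le> ln 2" by (subst ln_le_cancel_iff) (auto simp: add_pos_nonneg)
      then show ?thesis using step[of n] by linarith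
    qed
    finally show ?thesis by simp
  qed
  have "(\<integral>\<^sup>+x. ennreal \<bar>ln (D x)\<bar> \<partial>\<nu>) = (\<integral>\<^sup>+x. liminf (\<lambda>n. ennreal \<bar>\<phi> n x\<bar>) \<partial>\<nu>)"
  proof (rule nn_integral_cong_AE)
    show "AE x in \<nu>. ennreal \<bar>ln (D x)\<bar> = liminf (\<lambda>n. ennreal \<bar>\<phi> n x\<bar>)"
      using pos
    proof eventually_elim
      case (elim x)
      have "(\<lambda>n. ennreal \<bar>\<phi> n x\<bar>) \<longlonglongrightarrow> ennreal \<bar>ln (D x)\<bar>"
        using lim[OF elim] by (intro tendsto_ennrealI tendsto_rabs)
      then show ?case using lim_imp_Liminf[OF sequentially_bot] by metis
    qed
  qed
  also have "\<dots> \<le> liminf (\<lambda>n. \<integral>\<^sup>+x. ennreal \<bar>\<phi> n x\<bar> \<partial>\<nu>)" by (intro nn_integral_liminf) simp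
  also have "\<dots> \<le> liminf (\<lambda>n. ennreal (ln 2 + C + 2 * (\<integral>x. g x \<partial>\<nu>)))"
    using \<phi>i absn by (intro Liminf_mono always_eventually allI)
      (auto simp: nn_integral_eq_integral intro!: ennreal_leI)
  also have "\<dots> < \<infinity>" by (simp add: Liminf_const)
  finally have int: "integrable \<nu> (\<lambda>x. ln (D x))"
    by (intro integrableI_bounded) auto
  \<comment> \<open>The clamping interval contains 1, so clamping moves \<open>D x\<close> towards 1
    and shrinks the absolute value of its logarithm; \<open>\<bar>ln (D x)\<bar>\<close> is a
    dominating function.\<close>
  have "(\<lambda>n. \<integral>x. \<phi> n x \<partial>\<nu>) \<longlonglongrightarrow> (\<integral>x. ln (D x) \<partial>\<nu>)"
  proof (rule integral_dominated_convergence[where w = "\<lambda>x. \<bar>ln (D x)\<bar>"])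
    show "AE x in \<nu>. (\<lambda>n. \<phi> n x) \<longlonglongrightarrow> ln (D x)" using pos by eventually_elim (rule lim)
    show "AE x in \<nu>. norm (\<phi> n x) \<le> \<bar>ln (D x)\<bar>" for n
      using pos
    proof eventually_elim
      case (elim x)
      let ?y = "max (1 / real (Suc n)) (min (real (Suc n)) (D x))"
      have 1: "1 / real (Suc n) \<le> 1" "1 \<le> real (Suc n)" by auto
      show ?case
      proof (cases "1 \<le> D x")
        case True
        then have "1 \<le> ?y" "?y \<le> D x" using order_trans[OF 1(1) True] 1(2) by (auto simp del: of_nat_Suc simp: le_max_iff_disj)
        then have "0 \<le> \<phi> n x" "\<phi> n x \<le> ln (D x)" using True by (auto simp: \<phi>_def ln_le_cancel_iff)
        then show ?thesis by simp
      next
        case False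
        then have "?y \<le> 1" "D x \<le> ?y" using 1 by (auto simp del: of_nat_Suc simp: le_max_iff_disj)
        then have "\<phi> n x \<le> 0" "ln (D x) \<le> \<phi> n x" using clamp[of n x] elim
          by (auto simp: \<phi>_def ln_le_cancel_iff)
        then show ?thesis by simp
      qed
    qed
  qed (use int in auto)
  moreover have "(\<lambda>n. ln (1 + 1 / real (Suc n)) + C) \<longlonglongrightarrow> ln (1 + 0) + C"
    by (intro tendsto_intros LIMSEQ_Suc[OF lim_1_over_n]) auto
  ultimately have "(\<integral>x. ln (D x) \<partial>\<nu>) \<le> ln (1 + 0) + C"
    by (rule LIMSEQ_le) (use step in blast)
  then show ?thesis
    using ac int by (simp add: KL_def ed KL_divergence_def)
qed

text \<open>Data processing: a bounded test on the image pulls back along \<open>F\<close>. This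
  gives the time marginals and the embeddings of chains into paths.\<close>

lemma entropic_bound_distr:
  assumes eb: "entropic_bound \<nu> \<mu> C" and F[measurable]: "F \<in> \<mu> \<rightarrow>\<^sub>M N" and sets: "sets \<nu> = sets \<mu>"
  shows "entropic_bound (distr \<nu> N F) (distr \<mu> N F) C"
proof (rule entropic_boundI)
  fix \<phi> :: "'b \<Rightarrow> real" and B
  assume "\<phi> \<in> borel_measurable (distr \<mu> N F)" and B: "\<And>x. x \<in> space (distr \<mu> N F) \<Longrightarrow> \<bar>\<phi> x\<bar> \<le> B"
  then have [measurable]: "\<phi> \<in> borel_measurable N" by simp
  have F': "F \<in> \<nu> \<rightarrow>\<^sub>M N" using F sets measurable_cong_sets by blast
  have "(\<integral>x. \<phi> (F x) \<partial>\<nu>) \<le> ln (\<integral>x. exp (\<phi> (F x)) \<partial>\<mu>) + C"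
  proof (rule entropic_boundD[OF eb])
    show "\<bar>\<phi> (F x)\<bar> \<le> B" if "x \<in> space \<mu>" for x using B measurable_space[OF F that] by simp
  qed measurable
  then show "(\<integral>x. \<phi> x \<partial>distr \<nu> N F) \<le> ln (\<integral>x. exp (\<phi> x) \<partial>distr \<mu> N F) + C"
    by (simp add: integral_distr[OF F'] integral_distr[OF F])
qed

text \<open>The inequality half of the chain rule for relative entropy.\<close>
lemma entropic_bound_kernel:
  assumes "prob_space \<mu>" "prob_space \<nu>" "prob_space \<gamma>1" "prob_space \<gamma>2" and sets: "sets \<nu> = sets \<mu>"
    and F1[measurable]: "F1 \<in> \<mu> \<Otimes>\<^sub>M \<gamma>1 \<rightarrow>\<^sub>M P" and F2[measurable]: "F2 \<in> \<mu> \<Otimes>\<^sub>M \<gamma>2 \<rightarrow>\<^sub>M P"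
    and eb: "entropic_bound \<nu> \<mu> C"
    and kern: "\<And>x. x \<in> space \<mu> \<Longrightarrow>
      entropic_bound (distr \<gamma>1 P (\<lambda>y. F1 (x, y))) (distr \<gamma>2 P (\<lambda>y. F2 (x, y))) (q x)"
    and q: "integrable \<nu> q"
  shows "entropic_bound (distr (\<nu> \<Otimes>\<^sub>M \<gamma>1) (\<mu> \<Otimes>\<^sub>M P) (\<lambda>z. (fst z, F1 z)))
    (distr (\<mu> \<Otimes>\<^sub>M \<gamma>2) (\<mu> \<Otimes>\<^sub>M P) (\<lambda>z. (fst z, F2 z))) (C + (\<integral>x. q x \<partial>\<nu>))"
proof (rule entropic_boundI)
  interpret \<mu>: prob_space \<mu> by fact
  interpret \<nu>: prob_space \<nu> by fact
  interpret g1: prob_space \<gamma>1 by fact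
  interpret g2: prob_space \<gamma>2 by fact
  interpret p1: pair_prob_space \<nu> \<gamma>1 ..
  interpret p2: pair_prob_space \<mu> \<gamma>2 ..
  have sp: "space \<nu> = space \<mu>" using sets by (rule sets_eq_imp_space_eq)
  have sets1: "sets (\<nu> \<Otimes>\<^sub>M \<gamma>1) = sets (\<mu> \<Otimes>\<^sub>M \<gamma>1)" by (intro sets_pair_measure_cong sets) simp
  fix \<phi> :: "'a \<times> 'd \<Rightarrow> real" and B
  assume "\<phi> \<in> borel_measurable (distr (\<mu> \<Otimes>\<^sub>M \<gamma>2) (\<mu> \<Otimes>\<^sub>M P) (\<lambda>z. (fst z, F2 z)))"
    and "\<And>x. x \<in> space (distr (\<mu> \<Otimes>\<^sub>M \<gamma>2) (\<mu> \<Otimes>\<^sub>M P) (\<lambda>z. (fst z, F2 z))) \<Longrightarrow> \<bar>\<phi> x\<bar> \<le> B"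
  then have \<phi>[measurable]: "\<phi> \<in> borel_measurable (\<mu> \<Otimes>\<^sub>M P)"
    and B: "\<And>x y. x \<in> space \<mu> \<Longrightarrow> y \<in> space P \<Longrightarrow> \<bar>\<phi> (x, y)\<bar> \<le> B"
    by (auto simp: space_pair_measure)
  have F1sp: "F1 (x, y) \<in> space P" if "x \<in> space \<mu>" "y \<in> space \<gamma>1" for x y
    using measurable_space[OF F1, of "(x, y)"] that by (simp add: space_pair_measure)
  have F2sp: "F2 (x, y) \<in> space P" if "x \<in> space \<mu>" "y \<in> space \<gamma>2" for x y
    using measurable_space[OF F2, of "(x, y)"] that by (simp add: space_pair_measure)
  \<comment> \<open>The conditional log-integral given \<open>x\<close>. The kernel bound at fixed
    \<open>x\<close> replaces the inner \<open>\<gamma>1\<close>-integral by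
    \<open>V x + q x\<close>; then \<open>V\<close> is itself an admissible test for
    \<open>eb\<close>, and \<open>exp (V x)\<close> restores the inner
    \<open>\<gamma>2\<close>-integral.\<close>
  define V where "V x = ln (\<integral>y. exp (\<phi> (x, F2 (x, y))) \<partial>\<gamma>2)" for x
  have [measurable]: "V \<in> borel_measurable \<mu>"
    unfolding V_def by measurable
  have b: "integrable \<gamma>2 (\<lambda>y. exp (\<phi> (x, F2 (x, y))))" "0 < (\<integral>y. exp (\<phi> (x, F2 (x, y))) \<partial>\<gamma>2)" "\<bar>V x\<bar> \<le> B"
    if "x \<in> space \<mu>" for x
    unfolding V_def using that
    by (intro g2.exp_integral_bounds[where B = B]; simp add: B F2sp)+
  have Vi: "integrable \<nu> V"
  proof (rule \<nu>.integrable_of_bounded[where B = B])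
    show "V \<in> borel_measurable \<nu>" unfolding measurable_cong_sets[OF sets refl] by measurable
  qed (simp add: b(3) sp)
  have m1: "(\<lambda>z. \<phi> (fst z, F1 z)) \<in> borel_measurable (\<nu> \<Otimes>\<^sub>M \<gamma>1)"
    unfolding measurable_cong_sets[OF sets1 refl] by measurable
  have m1': "(\<lambda>z. (fst z, F1 z)) \<in> (\<nu> \<Otimes>\<^sub>M \<gamma>1) \<rightarrow>\<^sub>M (\<mu> \<Otimes>\<^sub>M P)"
    unfolding measurable_cong_sets[OF sets1 refl] by measurable
  have i1: "integrable (\<nu> \<Otimes>\<^sub>M \<gamma>1) (\<lambda>z. \<phi> (fst z, F1 z))"
    using B F1sp m1 by (intro p1.integrable_of_bounded[where B = B]) (auto simp: space_pair_measure sp)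
  have i2: "integrable (\<mu> \<Otimes>\<^sub>M \<gamma>2) (\<lambda>z. exp (\<phi> (fst z, F2 z)))"
    using B F2sp by (intro p2.exp_integral_bounds(1)[where B = B]) (auto simp: space_pair_measure)
  have "(\<integral>x. \<phi> x \<partial>distr (\<nu> \<Otimes>\<^sub>M \<gamma>1) (\<mu> \<Otimes>\<^sub>M P) (\<lambda>z. (fst z, F1 z))) = (\<integral>z. \<phi> (fst z, F1 z) \<partial>(\<nu> \<Otimes>\<^sub>M \<gamma>1))"
    by (rule integral_distr[OF m1' \<phi>])
  also have "\<dots> = (\<integral>x. (\<integral>y. \<phi> (x, F1 (x, y)) \<partial>\<gamma>1) \<partial>\<nu>)"
    using p1.integral_fst'[OF i1] by simp
  also have "\<dots> \<le> (\<integral>x. V x + q x \<partial>\<nu>)"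
  proof (rule integral_mono)
    show "integrable \<nu> (\<lambda>x. \<integral>y. \<phi> (x, F1 (x, y)) \<partial>\<gamma>1)" using p1.integrable_fst'[OF i1] by simp
    show "integrable \<nu> (\<lambda>x. V x + q x)" using Vi q by simp
    fix x assume x: "x \<in> space \<nu>"
    then have x': "x \<in> space \<mu>" by (simp add: sp)
    have [measurable]: "(\<lambda>y. F1 (x, y)) \<in> \<gamma>1 \<rightarrow>\<^sub>M P" "(\<lambda>y. F2 (x, y)) \<in> \<gamma>2 \<rightarrow>\<^sub>M P"
      "(\<lambda>y. \<phi> (x, y)) \<in> borel_measurable P"
      using x' by measurable
    have "(\<integral>y. \<phi> (x, y) \<partial>distr \<gamma>1 P (\<lambda>y. F1 (x, y))) \<le>
        ln (\<integral>y. exp (\<phi> (x, y)) \<partial>distr \<gamma>2 P (\<lambda>y. F2 (x, y))) + q x"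
      by (rule entropic_boundD[OF kern[OF x'], where B = B]) (auto simp: B x')
    then show "(\<integral>y. \<phi> (x, F1 (x, y)) \<partial>\<gamma>1) \<le> V x + q x"
      by (simp add: integral_distr V_def)
  qed
  also have "\<dots> = (\<integral>x. V x \<partial>\<nu>) + (\<integral>x. q x \<partial>\<nu>)" using Vi q by simp
  also have "(\<integral>x. V x \<partial>\<nu>) \<le> ln (\<integral>x. exp (V x) \<partial>\<mu>) + C"
    by (rule entropic_boundD[OF eb _ b(3)]) auto
  also have "(\<integral>x. exp (V x) \<partial>\<mu>) = (\<integral>x. (\<integral>y. exp (\<phi> (x, F2 (x, y))) \<partial>\<gamma>2) \<partial>\<mu>)"
    using b(2) by (intro Bochner_Integration.integral_cong) (auto simp: V_def)
  also have "\<dots> = (\<integral>z. exp (\<phi> (fst z, F2 z)) \<partial>(\<mu> \<Otimes>\<^sub>M \<gamma>2))"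
    using p2.integral_fst'[OF i2] by simp
  also have "\<dots> = (\<integral>x. exp (\<phi> x) \<partial>distr (\<mu> \<Otimes>\<^sub>M \<gamma>2) (\<mu> \<Otimes>\<^sub>M P) (\<lambda>z. (fst z, F2 z)))"
    by (subst integral_distr) auto
  finally show "(\<integral>x. \<phi> x \<partial>distr (\<nu> \<Otimes>\<^sub>M \<gamma>1) (\<mu> \<Otimes>\<^sub>M P) (\<lambda>z. (fst z, F1 z))) \<le>
      ln (\<integral>x. exp (\<phi> x) \<partial>distr (\<mu> \<Otimes>\<^sub>M \<gamma>2) (\<mu> \<Otimes>\<^sub>M P) (\<lambda>z. (fst z, F2 z))) + (C + (\<integral>x. q x \<partial>\<nu>))"
    by simp
qed

text \<open>The chain rule with a kernel that ignores the first component, so that its cost is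
  constant.\<close>

lemma entropic_bound_pair:
  assumes "prob_space \<mu>" "prob_space \<nu>" "prob_space \<mu>'" "prob_space \<nu>'" "sets \<nu> = sets \<mu>" "sets \<nu>' = sets \<mu>'"
    and "entropic_bound \<nu> \<mu> C" "entropic_bound \<nu>' \<mu>' C'"
  shows "entropic_bound (\<nu> \<Otimes>\<^sub>M \<nu>') (\<mu> \<Otimes>\<^sub>M \<mu>') (C + C')"
proof -
  interpret \<nu>: prob_space \<nu> by fact
  have s: "sets (\<mu> \<Otimes>\<^sub>M \<mu>') = sets (\<nu> \<Otimes>\<^sub>M \<nu>')" by (intro sets_pair_measure_cong assms(5,6)[symmetric])
  have sp: "space \<nu>' = space \<mu>'" using assms by (metis sets_eq_imp_space_eq)
  have d: "distr \<nu>' \<mu>' (\<lambda>y. y) = \<nu>'" using assms by (intro distr_id2) simp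
  have "entropic_bound (distr (\<nu> \<Otimes>\<^sub>M \<nu>') (\<mu> \<Otimes>\<^sub>M \<mu>') (\<lambda>z. (fst z, snd z)))
      (distr (\<mu> \<Otimes>\<^sub>M \<mu>') (\<mu> \<Otimes>\<^sub>M \<mu>') (\<lambda>z. (fst z, snd z))) (C + (\<integral>x. C' \<partial>\<nu>))"
  proof (rule entropic_bound_kernel[where q = "\<lambda>_. C'"])
    have "sets (\<mu> \<Otimes>\<^sub>M \<nu>') = sets (\<mu> \<Otimes>\<^sub>M \<mu>')" by (intro sets_pair_measure_cong assms refl)
    then show "snd \<in> \<mu> \<Otimes>\<^sub>M \<nu>' \<rightarrow>\<^sub>M \<mu>'" using measurable_cong_sets by blast
    show "entropic_bound (distr \<nu>' \<mu>' (\<lambda>y. snd (x, y))) (distr \<mu>' \<mu>' (\<lambda>y. snd (x, y))) C'" for x :: 'a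
      using assms(8) by (simp add: d distr_id)
  qed (use assms in auto)
  then show ?thesis
    using distr_id2[OF s] by (simp add: \<nu>.prob_space distr_id)
qed

lemma entropic_bound_PiM:
  assumes "finite I" "\<And>i. i \<in> I \<Longrightarrow> prob_space (\<mu> i)" "\<And>i. i \<in> I \<Longrightarrow> prob_space (\<nu> i)"
    "\<And>i. i \<in> I \<Longrightarrow> sets (\<nu> i) = sets (\<mu> i)" "\<And>i. i \<in> I \<Longrightarrow> entropic_bound (\<nu> i) (\<mu> i) (C i)"
  shows "entropic_bound (Pi\<^sub>M I \<nu>) (Pi\<^sub>M I \<mu>) (sum C I)"
  using assms
proof (induction I)
  case empty
  show ?case unfolding PiM_empty
    by (auto simp: entropic_bound_def lebesgue_integral_count_space_finite)
next
  case (insert i I)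
  have s: "sets (Pi\<^sub>M I \<nu>) = sets (Pi\<^sub>M I \<mu>)" using insert.prems by (intro sets_PiM_cong) auto
  have s': "sets (\<nu> i) = sets (\<mu> i)" using insert.prems by auto
  have "entropic_bound (\<nu> i \<Otimes>\<^sub>M Pi\<^sub>M I \<nu>) (\<mu> i \<Otimes>\<^sub>M Pi\<^sub>M I \<mu>) (C i + sum C I)"
    using insert s by (intro entropic_bound_pair prob_space_PiM) auto
  then have "entropic_bound
      (distr (\<nu> i \<Otimes>\<^sub>M Pi\<^sub>M I \<nu>) (\<Pi>\<^sub>M i\<in>insert i I. \<mu> i) (\<lambda>(x, X). X(i := x)))
      (distr (\<mu> i \<Otimes>\<^sub>M Pi\<^sub>M I \<mu>) (\<Pi>\<^sub>M i\<in>insert i I. \<mu> i) (\<lambda>(x, X). X(i := x))) (C i + sum C I)"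
    by (rule entropic_bound_distr) (auto intro!: sets_pair_measure_cong s s')
  moreover have "distr (\<nu> i \<Otimes>\<^sub>M Pi\<^sub>M I \<nu>) (\<Pi>\<^sub>M i\<in>insert i I. \<mu> i) (\<lambda>(x, X). X(i := x))
      = distr (\<nu> i \<Otimes>\<^sub>M Pi\<^sub>M I \<nu>) (\<Pi>\<^sub>M i\<in>insert i I. \<nu> i) (\<lambda>(x, X). X(i := x))"
    using insert.prems by (intro distr_cong sets_PiM_cong) auto
  ultimately show ?case
    using insert by (simp add: distr_pair_PiM_eq_PiM)
qed

section \<open>Gaussian measures\<close>

abbreviation std_gaussian :: "real measure" where
  "std_gaussian \<equiv> density lborel std_normal_density"

abbreviation std_gaussian_prod :: "('n::finite \<Rightarrow> real) measure" where
  "std_gaussian_prod \<equiv> Pi\<^sub>M UNIV (\<lambda>_. std_gaussian)"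

lemma prob_space_std_gaussian: "prob_space std_gaussian"
  by (rule prob_space_normal_density) simp

lemma prob_space_std_gaussian_prod: "prob_space std_gaussian_prod"
  by (intro prob_space_PiM prob_space_std_gaussian)

lemma sets_std_gaussian_prod: "sets (std_gaussian_prod :: ('n::finite \<Rightarrow> real) measure) = sets (Pi\<^sub>M UNIV (\<lambda>_. borel))"
  by (intro sets_PiM_cong) auto

lemma std_gaussian_shift: "distr std_gaussian borel (\<lambda>x. x + a) = density lborel (normal_density a 1)"
proof -
  interpret prob_space std_gaussian by (rule prob_space_std_gaussian)
  have "distributed std_gaussian lborel (\<lambda>x. x) (normal_density 0 1)"
    by (auto simp: distributed_def distr_id2)
  from normal_density_affine[OF this, of 1 a] show ?thesis
    by (auto simp: distributed_def add.commute[of a] cong: distr_cong)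
qed

lemma normal_density_shift: "normal_density a 1 x = std_normal_density x * exp (a * x - a\<^sup>2 / 2)"
  by (simp add: normal_density_def exp_add[symmetric] power2_eq_square field_simps)

text \<open>The Cameron--Martin density is \<open>exp (a * x - a\<^sup>2 / 2)\<close>; under the
  shifted law \<open>x\<close> has mean \<open>a\<close>, so its logarithm has mean
  \<open>a\<^sup>2 - a\<^sup>2 / 2\<close>.\<close>

lemma entropic_bound_std_gaussian_shift:
  "entropic_bound (distr std_gaussian borel (\<lambda>x. x + a)) std_gaussian (a\<^sup>2 / 2)"
proof -
  define D where "D x = exp (a * x - a\<^sup>2 / 2)" for x :: real
  have \<nu>: "distr std_gaussian borel (\<lambda>x. x + a) = density std_gaussian (\<lambda>x. ennreal (D x))"
  proof -
    have "density std_gaussian (\<lambda>x. ennreal (D x)) = density lborel (\<lambda>x. ennreal (std_normal_density x) * ennreal (D x))"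
      by (rule density_density_eq) (simp_all add: D_def)
    then show ?thesis
      by (simp add: std_gaussian_shift normal_density_shift[of a] ennreal_mult D_def)
  qed
  have hb: "has_bochner_integral lborel (\<lambda>x. normal_density a 1 x * (a * x - a\<^sup>2 / 2)) (a\<^sup>2 / 2)"
  proof -
    have "has_bochner_integral lborel (\<lambda>x. (normal_density a 1 x * x) * a - normal_density a 1 x * (a\<^sup>2 / 2)) (a * a - 1 * (a\<^sup>2 / 2))"
      using has_bochner_integral_integrable[OF integrable_normal_density[of 1 a]]
      by (intro has_bochner_integral_diff has_bochner_integral_mult_left normal_moment_nz_1) auto
    then show ?thesis by (simp add: algebra_simps power2_eq_square)
  qed
  have "integrable (density lborel (normal_density a 1)) (\<lambda>x. ln (D x))"
    using hb by (subst integrable_density) (auto simp: D_def has_bochner_integral_iff)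
  moreover have mean: "(\<integral>x. ln (D x) \<partial>density lborel (normal_density a 1)) = a\<^sup>2 / 2"
    using hb by (subst integral_density) (auto simp: D_def has_bochner_integral_iff)
  moreover have "prob_space (distr std_gaussian borel (\<lambda>x. x + a))"
    using prob_space_std_gaussian by (rule prob_space.prob_space_distr) simp
  ultimately have "entropic_bound (distr std_gaussian borel (\<lambda>x. x + a)) std_gaussian
      (\<integral>x. ln (D x) \<partial>distr std_gaussian borel (\<lambda>x. x + a))"
    by (intro entropic_bound_of_density[OF prob_space_std_gaussian _ \<nu>]) (simp_all add: D_def std_gaussian_shift)
  then show ?thesis unfolding std_gaussian_shift mean .
qed

lemma std_gaussian_prod_shift:
  fixes a :: "'n::finite \<Rightarrow> real"
  shows "distr std_gaussian_prod (Pi\<^sub>M UNIV (\<lambda>_. borel)) (\<lambda>\<xi> i. \<xi> i + a i)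
    = Pi\<^sub>M UNIV (\<lambda>i. distr std_gaussian borel (\<lambda>x. x + a i))"
proof -
  have pN: "prob_space (distr std_gaussian borel (\<lambda>x. x + a i))" for i
    using prob_space_std_gaussian by (rule prob_space.prob_space_distr) simp
  interpret N: product_prob_space "\<lambda>i. distr std_gaussian borel (\<lambda>x. x + a i)" UNIV
    by (rule product_prob_spaceI) (rule pN)
  interpret G: product_prob_space "\<lambda>_::'n. std_gaussian" UNIV
    by (rule product_prob_spaceI) (rule prob_space_std_gaussian)
  have F: "(\<lambda>\<xi> i. \<xi> i + a i) \<in> std_gaussian_prod \<rightarrow>\<^sub>M Pi\<^sub>M UNIV (\<lambda>_. borel)"
    unfolding measurable_cong_sets[OF sets_std_gaussian_prod refl]
    by (rule measurable_PiM_single') (auto simp: PiE_def)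
  show ?thesis
  proof (rule N.PiM_eqI)
    show "sets (distr std_gaussian_prod (Pi\<^sub>M UNIV (\<lambda>_. borel)) (\<lambda>\<xi> i. \<xi> i + a i)) =
        sets (Pi\<^sub>M UNIV (\<lambda>i. distr std_gaussian borel (\<lambda>x. x + a i)))"
      by (simp cong: sets_PiM_cong)
    fix A assume "\<And>i. i \<in> UNIV \<Longrightarrow> A i \<in> sets (distr std_gaussian borel (\<lambda>x. x + a i))"
    then have A[measurable]: "A i \<in> sets borel" for i by simp
    have "emeasure (distr std_gaussian_prod (Pi\<^sub>M UNIV (\<lambda>_. borel)) (\<lambda>\<xi> i. \<xi> i + a i)) (Pi\<^sub>E UNIV A)
        = emeasure std_gaussian_prod ((\<lambda>\<xi> i. \<xi> i + a i) -` (Pi\<^sub>E UNIV A) \<inter> space std_gaussian_prod)"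
      by (rule emeasure_distr[OF F]) (auto intro!: sets_PiM_I_finite)
    also have "(\<lambda>\<xi> i. \<xi> i + a i) -` (Pi\<^sub>E UNIV A) \<inter> space std_gaussian_prod = Pi\<^sub>E UNIV (\<lambda>i. (\<lambda>x. x + a i) -` A i)"
      by (auto simp: space_PiM PiE_def)
    also have "emeasure std_gaussian_prod \<dots> = (\<Prod>i\<in>UNIV. emeasure std_gaussian ((\<lambda>x. x + a i) -` A i))"
    proof (rule G.emeasure_PiM)
      show "(\<lambda>x. x + a i) -` A i \<in> sets std_gaussian" for i
        using measurable_sets[of "\<lambda>x. x + a i" borel borel "A i"] by simp
    qed simp
    also have "\<dots> = (\<Prod>i\<in>UNIV. emeasure (distr std_gaussian borel (\<lambda>x. x + a i)) (A i))"
      by (intro prod.cong refl) (simp add: emeasure_distr)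
    finally show "emeasure (distr std_gaussian_prod (Pi\<^sub>M UNIV (\<lambda>_. borel)) (\<lambda>\<xi> i. \<xi> i + a i)) (Pi\<^sub>E UNIV A)
        = (\<Prod>i\<in>UNIV. emeasure (distr std_gaussian borel (\<lambda>x. x + a i)) (A i))" .
  qed simp
qed

lemma borel_measurable_vec_lambda[measurable]:
  "(\<lambda>\<xi>. \<chi> i. \<xi> i) \<in> Pi\<^sub>M UNIV (\<lambda>_. borel :: real measure) \<rightarrow>\<^sub>M (borel :: (real^'n) measure)"
  by (subst borel_measurable_euclidean_space) (auto simp: Basis_vec_def inner_axis)

lemma borel_measurable_matrix_vector_mult[measurable]:
  fixes A :: "real^'n^'m"
  assumes "g \<in> borel_measurable M"
  shows "(\<lambda>x. A *v g x) \<in> borel_measurable M"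
  using borel_measurable_continuous_onI[OF matrix_vector_mult_linear_continuous_on] assms
  by (rule measurable_compose[rotated])

lemma measurable_gaussian_map:
  fixes A :: "real^'n^'m"
  shows "(\<lambda>\<xi>. m + A *v (\<chi> i. \<xi> i)) \<in> std_gaussian_prod \<rightarrow>\<^sub>M borel"
  unfolding measurable_cong_sets[OF sets_std_gaussian_prod refl] by measurable

lemma prob_space_multivariate_normal: "prob_space (multivariate_normal m C)"
  unfolding multivariate_normal_def
  by (intro prob_space.prob_space_distr prob_space_std_gaussian_prod measurable_gaussian_map)

lemma sets_multivariate_normal [simp, measurable_cong]: "sets (multivariate_normal m C) = sets borel"
  by (simp add: multivariate_normal_def)

lemma multivariate_normal_scaled_identity:
  assumes "0 \<le> c"
  shows "multivariate_normal 0 (c *\<^sub>R mat 1 :: real^'n^'n) = distr std_gaussian_prod borel (\<lambda>\<xi>. sqrt c *\<^sub>R (\<chi> i. \<xi> i))"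
  unfolding multivariate_normal_def matrix_sqrt_scaleR_mat[OF assms]
  by (simp add: scaleR_matrix_vector_assoc[symmetric])

text \<open>Here \<open>c\<close> will be the step size \<open>h\<close> and \<open>u\<close> will
  be \<open>h\<close> times the transformed drift difference, so that the cost of one step is of
  order \<open>h\<close> and the costs sum like a Riemann sum.\<close>

lemma entropic_bound_gaussian_shift:
  fixes u :: "real^'n"
  assumes c: "0 < c"
  defines "G \<equiv> multivariate_normal 0 (c *\<^sub>R mat 1 :: real^'n^'n)"
  shows "entropic_bound (distr G borel (\<lambda>z. z + u)) G ((norm u)\<^sup>2 / (2 * c))"
proof -
  define a where "a i = u $ i / sqrt c" for i
  define F :: "('n \<Rightarrow> real) \<Rightarrow> real^'n" where "F \<xi> = sqrt c *\<^sub>R (\<chi> i. \<xi> i)" for \<xi>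
  have Fm[measurable]: "F \<in> Pi\<^sub>M UNIV (\<lambda>_. borel) \<rightarrow>\<^sub>M borel" unfolding F_def by measurable
  have G: "G = distr std_gaussian_prod borel F"
    using c by (simp add: G_def F_def[abs_def] multivariate_normal_scaled_identity)
  have Fm': "F \<in> std_gaussian_prod \<rightarrow>\<^sub>M borel"
    unfolding measurable_cong_sets[OF sets_std_gaussian_prod refl] by measurable
  have sm: "(\<lambda>\<xi> i. \<xi> i + a i) \<in> std_gaussian_prod \<rightarrow>\<^sub>M Pi\<^sub>M UNIV (\<lambda>_. borel)"
    unfolding measurable_cong_sets[OF sets_std_gaussian_prod refl]
    by (rule measurable_PiM_single') (auto simp: PiE_def)
  have "entropic_bound (Pi\<^sub>M UNIV (\<lambda>i. distr std_gaussian borel (\<lambda>x. x + a i))) std_gaussian_prod (\<Sum>i\<in>UNIV. (a i)\<^sup>2 / 2)"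
    by (intro entropic_bound_PiM entropic_bound_std_gaussian_shift prob_space_std_gaussian
        prob_space.prob_space_distr[OF prob_space_std_gaussian]) auto
  then have "entropic_bound (distr std_gaussian_prod (Pi\<^sub>M UNIV (\<lambda>_. borel)) (\<lambda>\<xi> i. \<xi> i + a i)) std_gaussian_prod (\<Sum>i\<in>UNIV. (a i)\<^sup>2 / 2)"
    by (simp add: std_gaussian_prod_shift)
  then have "entropic_bound (distr (distr std_gaussian_prod (Pi\<^sub>M UNIV (\<lambda>_. borel)) (\<lambda>\<xi> i. \<xi> i + a i)) borel F)
      (distr std_gaussian_prod borel F) (\<Sum>i\<in>UNIV. (a i)\<^sup>2 / 2)"
    by (rule entropic_bound_distr[OF _ Fm']) (simp add: sets_std_gaussian_prod)
  moreover have "distr (distr std_gaussian_prod (Pi\<^sub>M UNIV (\<lambda>_. borel)) (\<lambda>\<xi> i. \<xi> i + a i)) borel F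
      = distr G borel (\<lambda>z. z + u)"
  proof -
    have "F (\<lambda>i. \<xi> i + a i) = F \<xi> + u" for \<xi>
      using c by (simp add: F_def a_def vec_eq_iff algebra_simps)
    then show ?thesis
      unfolding G by (subst (1 2) distr_distr) (auto simp: o_def Fm' sm)
  qed
  moreover have "(\<Sum>i\<in>UNIV. (a i)\<^sup>2 / 2) = (norm u)\<^sup>2 / (2 * c)"
    using c by (simp add: a_def norm_vec_def L2_set_def sum_nonneg power_divide sum_divide_distrib[symmetric] real_sqrt_pow2 mult.commute)
  ultimately show ?thesis by (simp add: G)
qed

section \<open>Moment generating functions, as nonnegative integrals so that integrability need not
  be settled beforehand\<close>

lemma std_gaussian_mgf: "(\<integral>\<^sup>+x. ennreal (exp (a * x)) \<partial>std_gaussian) = ennreal (exp (a\<^sup>2 / 2))"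
proof -
  have "(\<integral>\<^sup>+x. ennreal (exp (a * x)) \<partial>std_gaussian)
      = (\<integral>\<^sup>+x. ennreal (exp (a\<^sup>2 / 2)) * ennreal (normal_density a 1 x) \<partial>lborel)"
  proof (subst nn_integral_density, simp, simp, rule nn_integral_cong)
    fix x
    have "exp (a * x) = exp (a\<^sup>2 / 2) * exp (a * x - a\<^sup>2 / 2)" by (simp add: exp_add[symmetric])
    then show "ennreal (std_normal_density x) * ennreal (exp (a * x)) = ennreal (exp (a\<^sup>2 / 2)) * ennreal (normal_density a 1 x)"
      by (simp add: ennreal_mult[symmetric] normal_density_shift[of a] mult_ac)
  qed
  also have "\<dots> = ennreal (exp (a\<^sup>2 / 2)) * (\<integral>\<^sup>+x. ennreal (normal_density a 1 x) \<partial>lborel)"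
    by (rule nn_integral_cmult) simp
  also have "(\<integral>\<^sup>+x. ennreal (normal_density a 1 x) \<partial>lborel) = 1"
    by (subst nn_integral_eq_integral) auto
  finally show ?thesis by simp
qed

lemma gaussian_linear_mgf:
  fixes A :: "real^'n^'m"
  shows "(\<integral>\<^sup>+\<xi>. ennreal (exp (w \<bullet> (A *v (\<chi> i. \<xi> i)))) \<partial>std_gaussian_prod)
    = ennreal (exp ((norm (transpose A *v w))\<^sup>2 / 2))"
proof -
  interpret G: product_prob_space "\<lambda>_::'n. std_gaussian" UNIV
    by (rule product_prob_spaceI) (rule prob_space_std_gaussian)
  define a where "a = transpose A *v w"
  have "w \<bullet> (A *v (\<chi> i. \<xi> i)) = (\<Sum>i\<in>UNIV. a $ i * \<xi> i)" for \<xi>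
  proof -
    have "w \<bullet> (A *v (\<chi> i. \<xi> i)) = a \<bullet> (\<chi> i. \<xi> i)"
      by (simp only: a_def transpose_matrix_vector dot_lmul_matrix)
    then show ?thesis by (simp add: inner_vec_def)
  qed
  then have "(\<integral>\<^sup>+\<xi>. ennreal (exp (w \<bullet> (A *v (\<chi> i. \<xi> i)))) \<partial>std_gaussian_prod)
      = (\<integral>\<^sup>+\<xi>. (\<Prod>i\<in>UNIV. ennreal (exp (a $ i * \<xi> i))) \<partial>std_gaussian_prod)"
    by (simp add: exp_sum prod_ennreal)
  also have "\<dots> = (\<Prod>i\<in>UNIV. \<integral>\<^sup>+x. ennreal (exp (a $ i * x)) \<partial>std_gaussian)"
    by (rule G.product_nn_integral_prod) auto
  also have "\<dots> = ennreal (exp ((norm a)\<^sup>2 / 2))"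
    by (simp add: std_gaussian_mgf prod_ennreal exp_sum[symmetric] norm_vec_def L2_set_def sum_nonneg sum_divide_distrib)
  finally show ?thesis by (simp add: a_def)
qed

lemma multivariate_normal_mgf:
  fixes C :: "real^'n^'n"
  assumes "sym_pos_semidef C"
  shows "(\<integral>\<^sup>+z. ennreal (exp (w \<bullet> (z - m))) \<partial>multivariate_normal m C)
    = ennreal (exp ((norm (matrix_sqrt C *v w))\<^sup>2 / 2))"
proof -
  have "transpose (matrix_sqrt C) = matrix_sqrt C"
    using matrix_sqrt(1)[OF assms] by (simp add: sym_pos_semidef_def)
  then show ?thesis
    unfolding multivariate_normal_def
    by (subst nn_integral_distr[OF measurable_gaussian_map]) (simp_all add: gaussian_linear_mgf)
qed

section \<open>Euler--Maruyama chains\<close>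

text \<open>The initial state takes slot 0 and the increment over step \<open>j\<close> takes slot
  \<open>Suc j\<close>. Independence of the initial state from the whole process is combined with
  mutual independence of the increments by checking the product formula on events.\<close>

lemma wiener_increments_indep:
  fixes W :: "real \<Rightarrow> 'a \<Rightarrow> real^'n" and X0 :: "'a \<Rightarrow> real^'n"
  assumes W: "wiener_process M W" and X0: "X0 \<in> borel_measurable M"
    and ind: "prob_space.indep_set M (sets (vimage_algebra (space M) X0 borel))
       (sets (vimage_algebra (space M) (\<lambda>\<omega>. \<lambda>t\<in>{0..}. W t \<omega>) (Pi\<^sub>M {0..} (\<lambda>_. borel))))"
    and h: "0 < h"
  shows "prob_space.indep_vars M (\<lambda>_. borel)
    (\<lambda>i. case i of 0 \<Rightarrow> X0 | Suc j \<Rightarrow> (\<lambda>\<omega>. W (real (Suc j) * h) \<omega> - W (real j * h) \<omega>)) {..n}"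
proof -
  interpret prob_space M using W by (simp add: wiener_process_def)
  define D where "D j \<omega> = W (real (Suc j) * h) \<omega> - W (real j * h) \<omega>" for j \<omega>
  define Z where "Z = (\<lambda>i. case i of 0 \<Rightarrow> X0 | Suc j \<Rightarrow> D j)"
  have Z_simps: "Z 0 = X0" "Z (Suc j) = D j" for j by (auto simp: Z_def fun_eq_iff)
  have Wm: "W t \<in> borel_measurable M" if "0 \<le> t" for t using W that by (auto simp: wiener_process_def)
  have Dm: "D j \<in> borel_measurable M" for j
    unfolding D_def using h by (intro borel_measurable_diff Wm) auto
  have Zm: "Z i \<in> borel_measurable M" for i
    unfolding Z_def using X0 Dm by (cases i) auto
  have Dind: "indep_vars (\<lambda>_. borel) D {..<n}"
  proof -
    have "mono (\<lambda>i. real i * h)" using h by (intro monoI mult_right_mono) auto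
    then show ?thesis using W unfolding wiener_process_def D_def
      by (auto dest!: spec[of _ n] spec[of _ "\<lambda>i. real i * h"])
  qed
  define VW where "VW = vimage_algebra (space M) (\<lambda>\<omega>. \<lambda>t\<in>{0..}. W t \<omega>) (Pi\<^sub>M {0..} (\<lambda>_. borel :: (real^'n) measure))"
  have Wv: "(\<lambda>\<omega>. W t \<omega>) \<in> VW \<rightarrow>\<^sub>M borel" if t: "0 \<le> t" for t
  proof -
    have "(\<lambda>\<omega>. \<lambda>t\<in>{0..}. W t \<omega>) \<in> VW \<rightarrow>\<^sub>M Pi\<^sub>M {0..} (\<lambda>_. borel)"
      unfolding VW_def by (rule measurable_vimage_algebra1) (auto simp: space_PiM)
    from measurable_compose[OF this measurable_component_singleton[of t]] t show ?thesis by simp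
  qed
  have Dv: "D j \<in> VW \<rightarrow>\<^sub>M borel" for j
    unfolding D_def using h by (intro borel_measurable_diff Wv) auto
  have "indep_vars (\<lambda>_. borel) Z {..n}"
  proof (subst indep_vars_finite[where E = "\<lambda>_. sets borel"])
    show "\<forall>A\<in>{..n} \<rightarrow> sets borel. prob (\<Inter>j\<in>{..n}. Z j -` A j \<inter> space M) = (\<Prod>j\<in>{..n}. prob (Z j -` A j \<inter> space M))"
    proof
      fix A :: "nat \<Rightarrow> (real^'n) set" assume A: "A \<in> {..n} \<rightarrow> sets borel"
      define B where "B = (\<Inter>j\<in>{..<n}. D j -` A (Suc j) \<inter> space M)"
      have shift: "(\<Prod>j\<in>{..n}. prob (Z j -` A j \<inter> space M)) = prob (X0 -` A 0 \<inter> space M) * (\<Prod>j<n. prob (D j -` A (Suc j) \<inter> space M))"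
        by (subst prod.atMost_shift) (simp add: Z_simps)
      show "prob (\<Inter>j\<in>{..n}. Z j -` A j \<inter> space M) = (\<Prod>j\<in>{..n}. prob (Z j -` A j \<inter> space M))"
      \<comment> \<open>Without increments \<open>B\<close> is an empty intersection, hence
        \<open>UNIV\<close>, and need not be an event.\<close>
      proof (cases "n = 0")
        case True
        then show ?thesis by simp
      next
        case False
        have "{..n} = insert 0 (Suc ` {..<n})" using False by (auto simp: image_iff) (metis Suc_pred less_Suc_eq_le not_gr_zero lessThan_iff Suc_less_eq)
        then have "(\<Inter>j\<in>{..n}. Z j -` A j \<inter> space M) = (X0 -` A 0 \<inter> space M) \<inter> B"
          by (simp add: B_def Z_simps)
        moreover have "X0 -` A 0 \<inter> space M \<in> sets (vimage_algebra (space M) X0 borel)"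
          using A by (intro in_vimage_algebra) auto
        moreover have "B \<in> sets VW"
          unfolding B_def
        proof (rule sets.finite_INT)
          fix j assume "j \<in> {..<n}"
          then have "A (Suc j) \<in> sets borel" using A by (auto simp: Pi_iff)
          from measurable_sets[OF Dv this] show "D j -` A (Suc j) \<inter> space M \<in> sets VW" by (simp add: VW_def)
        qed (use False in auto)
        ultimately have "prob (\<Inter>j\<in>{..n}. Z j -` A j \<inter> space M) = prob (X0 -` A 0 \<inter> space M) * prob B"
          using ind unfolding VW_def by (simp add: indep_sets2_eq)
        also have "prob B = (\<Prod>j<n. prob (D j -` A (Suc j) \<inter> space M))"
          unfolding B_def using False A by (intro indep_varsD_finite[OF Dind]) auto
        finally show ?thesis by (simp only: shift)
      qed
    qed
  qed (use sets.sigma_sets_eq[of "borel :: (real^'n) measure"] in \<open>auto simp: Zm sets.Int_stable\<close>)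
  then show ?thesis unfolding Z_def D_def[abs_def] .
qed

lemma wiener_increment_law:
  assumes "wiener_process M W" "0 \<le> s" "s < t"
  shows "distr M borel (\<lambda>\<omega>. W t \<omega> - W s \<omega>) = multivariate_normal 0 ((t - s) *\<^sub>R mat 1)"
  using assms by (simp add: wiener_process_def)

lemma (in prob_space) nn_integral_mult_of_product_law:
  fixes f :: "'b \<Rightarrow> ennreal" and g :: "'c \<Rightarrow> ennreal"
  assumes law: "distr M N X \<Otimes>\<^sub>M distr M N' Y = distr M (N \<Otimes>\<^sub>M N') (\<lambda>\<omega>. (X \<omega>, Y \<omega>))"
    and [measurable]: "X \<in> M \<rightarrow>\<^sub>M N" "Y \<in> M \<rightarrow>\<^sub>M N'" "f \<in> borel_measurable N" "g \<in> borel_measurable N'"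
  shows "(\<integral>\<^sup>+\<omega>. f (X \<omega>) * g (Y \<omega>) \<partial>M) = (\<integral>\<^sup>+\<omega>. f (X \<omega>) \<partial>M) * (\<integral>\<^sup>+\<omega>. g (Y \<omega>) \<partial>M)"
proof -
  interpret Y: prob_space "distr M N' Y" by (rule prob_space_distr) simp
  have "(\<integral>\<^sup>+\<omega>. f (X \<omega>) * g (Y \<omega>) \<partial>M) = (\<integral>\<^sup>+z. f (fst z) * g (snd z) \<partial>distr M (N \<Otimes>\<^sub>M N') (\<lambda>\<omega>. (X \<omega>, Y \<omega>)))"
    by (subst nn_integral_distr) auto
  also have "\<dots> = (\<integral>\<^sup>+x. \<integral>\<^sup>+y. f x * g y \<partial>distr M N' Y \<partial>distr M N X)"
    unfolding law[symmetric] by (subst Y.nn_integral_fst[symmetric]) auto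
  also have "\<dots> = (\<integral>\<^sup>+\<omega>. f (X \<omega>) \<partial>M) * (\<integral>\<^sup>+\<omega>. g (Y \<omega>) \<partial>M)"
    by (simp add: nn_integral_cmult nn_integral_multc nn_integral_distr)
  finally show ?thesis .
qed

text \<open>Adaptedness in canonical coordinates: the states up to time \<open>j\<close> are
  functions of the noise slots \<open>0..j\<close>, and the next increment sits in slot
  \<open>Suc j\<close>.\<close>

lemma measurable_euler_chain_canonical:
  fixes b :: "nat \<Rightarrow> real^'n \<Rightarrow> real^'n" and S :: "real^'n^'n"
  assumes b: "\<And>j. b j \<in> borel_measurable borel" and "i \<le> j"
  shows "(\<lambda>z. euler_chain h b (z 0) (\<lambda>k. S *v z (Suc k)) i) \<in> borel_measurable (Pi\<^sub>M {..j} (\<lambda>_. borel))"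
  using \<open>i \<le> j\<close>
proof (induction i)
  case (Suc i)
  then have "(\<lambda>z. euler_chain h b (z 0) (\<lambda>k. S *v z (Suc k)) i) \<in> borel_measurable (Pi\<^sub>M {..j} (\<lambda>_. borel))" by simp
  note [measurable] = this measurable_compose[OF this b[of i]]
  have "Suc i \<in> {..j}" using Suc.prems by simp
  then have [measurable]: "(\<lambda>z. z (Suc i)) \<in> Pi\<^sub>M {..j} (\<lambda>_. borel) \<rightarrow>\<^sub>M (borel :: (real^'n) measure)"
    by (rule measurable_component_singleton)
  show ?case by simp
qed (auto intro: measurable_component_singleton)

text \<open>Abstracts from the Wiener process what one fixed grid needs: independent Gaussian
  increments of variance \<open>h\<close>, jointly independent with the initial state, in the slot
  numbering of \<open>wiener_increments_indep\<close>.\<close>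

locale gaussian_chain = prob_space M for M :: "'a measure" +
  fixes h :: real and S :: "real^'n^'n" and X0 :: "'a \<Rightarrow> real^'n" and \<Delta> :: "nat \<Rightarrow> 'a \<Rightarrow> real^'n"
    and b :: "nat \<Rightarrow> real^'n \<Rightarrow> real^'n"
  assumes h: "0 < h"
    and indep: "\<And>n. indep_vars (\<lambda>_. borel) (\<lambda>i. case i of 0 \<Rightarrow> X0 | Suc j \<Rightarrow> \<Delta> j) {..n}"
    and law: "\<And>j. distr M borel (\<Delta> j) = multivariate_normal 0 (h *\<^sub>R mat 1)"
    and drift[measurable]: "\<And>j. b j \<in> borel_measurable borel"
begin

definition X :: "nat \<Rightarrow> 'a \<Rightarrow> real^'n" where
  "X j \<omega> = euler_chain h b (X0 \<omega>) (\<lambda>k. S *v \<Delta> k \<omega>) j"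

lemma X_simps [simp]: "X 0 = X0" "X (Suc j) \<omega> = X j \<omega> + h *\<^sub>R b j (X j \<omega>) + S *v \<Delta> j \<omega>"
  by (auto simp: X_def)

lemma measurable_noise [measurable]: "X0 \<in> borel_measurable M" "\<Delta> j \<in> borel_measurable M"
  using indep[of "Suc j"] unfolding indep_vars_def by (force dest: bspec[of _ _ 0], force dest: bspec[of _ _ "Suc j"])

lemma measurable_X [measurable]: "X j \<in> borel_measurable M"
  by (induction j) (auto simp: fun_eq_iff cong: measurable_cong)

lemma measurable_path [measurable]: "(\<lambda>\<omega>. \<lambda>i\<in>{..j}. X i \<omega>) \<in> M \<rightarrow>\<^sub>M Pi\<^sub>M {..j} (\<lambda>_. borel)"
  by (intro measurable_restrict) simp

text \<open>\<open>F\<close> rebuilds the states from slots \<open>0..j\<close>, whereas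
  \<open>\<Delta> j\<close> occupies slot \<open>Suc j\<close>; disjoint blocks of an independent
  family have a product law.\<close>

lemma law_past_increment:
  "distr M (Pi\<^sub>M {..j} (\<lambda>_. borel)) (\<lambda>\<omega>. \<lambda>i\<in>{..j}. X i \<omega>) \<Otimes>\<^sub>M distr M borel (\<Delta> j)
    = distr M (Pi\<^sub>M {..j} (\<lambda>_. borel) \<Otimes>\<^sub>M borel) (\<lambda>\<omega>. (\<lambda>i\<in>{..j}. X i \<omega>, \<Delta> j \<omega>))"
proof -
  define Z where "Z = (\<lambda>i. case i of 0 \<Rightarrow> X0 | Suc j \<Rightarrow> \<Delta> j)"
  define F where "F z = (\<lambda>i\<in>{..j}. euler_chain h b (z 0) (\<lambda>k. S *v z (Suc k)) i)" for z
  let ?P = "Pi\<^sub>M {..j} (\<lambda>_. borel :: (real^'n) measure)" and ?Q = "Pi\<^sub>M {Suc j} (\<lambda>_. borel :: (real^'n) measure)"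
  let ?U = "\<lambda>\<omega>. \<lambda>i\<in>{..j}. Z i \<omega>" and ?V = "\<lambda>\<omega>. \<lambda>i\<in>{Suc j}. Z i \<omega>"
  have "indep_var ?P ?U ?Q ?V"
    using indep[of "Suc j", folded Z_def] by (rule indep_var_restrict) auto
  then have U[measurable]: "?U \<in> M \<rightarrow>\<^sub>M ?P" and V[measurable]: "?V \<in> M \<rightarrow>\<^sub>M ?Q"
    and law: "distr M ?P ?U \<Otimes>\<^sub>M distr M ?Q ?V = distr M (?P \<Otimes>\<^sub>M ?Q) (\<lambda>\<omega>. (?U \<omega>, ?V \<omega>))"
    unfolding indep_var_distribution_eq by blast+
  have Fm[measurable]: "F \<in> ?P \<rightarrow>\<^sub>M ?P"
    unfolding F_def by (intro measurable_restrict measurable_euler_chain_canonical) auto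
  have ev[measurable]: "(\<lambda>z. z (Suc j)) \<in> ?Q \<rightarrow>\<^sub>M borel" by (intro measurable_component_singleton) simp
  have FU: "F (?U \<omega>) = (\<lambda>i\<in>{..j}. X i \<omega>)" for \<omega>
  proof
    fix i
    have "euler_chain h b (X0 \<omega>) (\<lambda>k. S *v ?U \<omega> (Suc k)) i = X i \<omega>" if "i \<le> j"
      using that by (induction i) (auto simp: Z_def)
    then show "F (?U \<omega>) i = (\<lambda>i\<in>{..j}. X i \<omega>) i" by (auto simp: F_def Z_def)
  qed
  have V: "?V \<omega> (Suc j) = \<Delta> j \<omega>" for \<omega> by (simp add: Z_def)
  have "distr M ?P (\<lambda>\<omega>. F (?U \<omega>)) \<Otimes>\<^sub>M distr M borel (\<lambda>\<omega>. ?V \<omega> (Suc j))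
      = distr (distr M ?P ?U) ?P F \<Otimes>\<^sub>M distr (distr M ?Q ?V) borel (\<lambda>z. z (Suc j))"
    by (simp add: distr_distr o_def)
  also have "\<dots> = distr (distr M ?P ?U \<Otimes>\<^sub>M distr M ?Q ?V) (?P \<Otimes>\<^sub>M borel) (\<lambda>(x, y). (F x, y (Suc j)))"
    by (intro pair_measure_distr prob_space_imp_sigma_finite prob_space.prob_space_distr[OF prob_space_distr]) auto
  also have "\<dots> = distr M (?P \<Otimes>\<^sub>M borel) (\<lambda>\<omega>. (F (?U \<omega>), ?V \<omega> (Suc j)))"
    unfolding law by (subst distr_distr) (auto simp: o_def)
  finally show ?thesis unfolding FU V by simp
qed

text \<open>Brings the chain into the shape required by \<open>entropic_bound_kernel\<close>: the
  law of the past times a fixed Gaussian, pushed forward by one Euler step.\<close>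

lemma law_past_next:
  "distr M (Pi\<^sub>M {..j} (\<lambda>_. borel) \<Otimes>\<^sub>M borel) (\<lambda>\<omega>. (\<lambda>i\<in>{..j}. X i \<omega>, X (Suc j) \<omega>)) =
   distr (distr M (Pi\<^sub>M {..j} (\<lambda>_. borel)) (\<lambda>\<omega>. \<lambda>i\<in>{..j}. X i \<omega>) \<Otimes>\<^sub>M multivariate_normal 0 (h *\<^sub>R mat 1))
     (Pi\<^sub>M {..j} (\<lambda>_. borel) \<Otimes>\<^sub>M borel) (\<lambda>z. (fst z, fst z j + h *\<^sub>R b j (fst z j) + S *v snd z))"
proof -
  have [measurable]: "(\<lambda>x. x j) \<in> Pi\<^sub>M {..j} (\<lambda>_. borel :: (real^'n) measure) \<rightarrow>\<^sub>M borel"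
    by (intro measurable_component_singleton) simp
  have "distr M (Pi\<^sub>M {..j} (\<lambda>_. borel)) (\<lambda>\<omega>. \<lambda>i\<in>{..j}. X i \<omega>) \<Otimes>\<^sub>M multivariate_normal 0 (h *\<^sub>R mat 1)
      = distr M (Pi\<^sub>M {..j} (\<lambda>_. borel) \<Otimes>\<^sub>M borel) (\<lambda>\<omega>. (\<lambda>i\<in>{..j}. X i \<omega>, \<Delta> j \<omega>))"
    using law_past_increment[of j] unfolding law .
  then show ?thesis by (simp add: distr_distr o_def)
qed

lemma law_path_Suc:
  "distr M (Pi\<^sub>M {..Suc j} (\<lambda>_. borel)) (\<lambda>\<omega>. \<lambda>i\<in>{..Suc j}. X i \<omega>) =
   distr (distr M (Pi\<^sub>M {..j} (\<lambda>_. borel) \<Otimes>\<^sub>M borel) (\<lambda>\<omega>. (\<lambda>i\<in>{..j}. X i \<omega>, X (Suc j) \<omega>)))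
     (Pi\<^sub>M {..Suc j} (\<lambda>_. borel)) (\<lambda>(x, y). x(Suc j := y))"
proof -
  have [measurable]: "(\<lambda>(x, y). x(Suc j := y)) \<in> Pi\<^sub>M {..j} (\<lambda>_. borel :: (real^'n) measure) \<Otimes>\<^sub>M borel \<rightarrow>\<^sub>M Pi\<^sub>M {..Suc j} (\<lambda>_. borel)"
    unfolding atMost_Suc by (rule measurable_add_dim)
  have "(\<lambda>i\<in>{..j}. X i \<omega>)(Suc j := X (Suc j) \<omega>) = (\<lambda>i\<in>{..Suc j}. X i \<omega>)" for \<omega>
    by (auto simp: fun_eq_iff restrict_def)
  then show ?thesis by (subst distr_distr) (auto simp: o_def simp del: X_simps)
qed

end

text \<open>A discrete Girsanov estimate, by induction on the number of steps. Given the past, the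
  two candidate next states are images under one map \<open>T\<close> of a Gaussian and of the same
  Gaussian shifted by \<open>u\<close>. All cost integrals are taken along the first chain.\<close>

lemma entropic_bound_gaussian_chain:
  fixes S R :: "real^'n^'n"
  assumes "gaussian_chain M h X0 \<Delta> a" "gaussian_chain M h Y0 \<Delta>' b"
    and SR: "S ** R = mat 1"
    and init: "entropic_bound (distr M borel X0) (distr M borel Y0) C"
    and int: "\<And>j. j < n \<Longrightarrow> integrable M (\<lambda>\<omega>. (norm (R *v (a j (gaussian_chain.X h S X0 \<Delta> a j \<omega>) - b j (gaussian_chain.X h S X0 \<Delta> a j \<omega>))))\<^sup>2)"
  shows "entropic_bound
    (distr M (Pi\<^sub>M {..n} (\<lambda>_. borel)) (\<lambda>\<omega>. \<lambda>i\<in>{..n}. gaussian_chain.X h S X0 \<Delta> a i \<omega>))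
    (distr M (Pi\<^sub>M {..n} (\<lambda>_. borel)) (\<lambda>\<omega>. \<lambda>i\<in>{..n}. gaussian_chain.X h S Y0 \<Delta>' b i \<omega>))
    (C + (\<Sum>j<n. h / 2 * (\<integral>\<omega>. (norm (R *v (a j (gaussian_chain.X h S X0 \<Delta> a j \<omega>) - b j (gaussian_chain.X h S X0 \<Delta> a j \<omega>))))\<^sup>2 \<partial>M)))"
proof -
  interpret X: gaussian_chain M h S X0 \<Delta> a by fact
  interpret Y: gaussian_chain M h S Y0 \<Delta>' b by fact
  define G where "G = multivariate_normal 0 (h *\<^sub>R mat 1 :: real^'n^'n)"
  have pG: "prob_space G" unfolding G_def by (rule prob_space_multivariate_normal)
  have sG[measurable_cong, simp]: "sets G = sets borel" unfolding G_def by simp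
  let ?P = "\<lambda>j. Pi\<^sub>M {..j} (\<lambda>_::nat. borel :: (real^'n) measure)"
  let ?L = "\<lambda>j. distr M (?P j) (\<lambda>\<omega>. \<lambda>i\<in>{..j}. X.X i \<omega>)"
  let ?N = "\<lambda>j. distr M (?P j) (\<lambda>\<omega>. \<lambda>i\<in>{..j}. Y.X i \<omega>)"
  let ?q = "\<lambda>j u. h / 2 * (norm (R *v (a j u - b j u)))\<^sup>2"
  have "entropic_bound (?L n) (?N n) (C + (\<Sum>j<n. \<integral>\<omega>. ?q j (X.X j \<omega>) \<partial>M))"
    using int
  proof (induction n)
    case 0
    define F where "F x = (\<lambda>i\<in>{..0::nat}. x)" for x :: "real^'n"
    have Fm[measurable]: "F \<in> borel \<rightarrow>\<^sub>M ?P 0" unfolding F_def by (intro measurable_restrict) simp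
    have "(\<lambda>\<omega>. \<lambda>i\<in>{..0}. X.X i \<omega>) = (\<lambda>\<omega>. F (X0 \<omega>))" "(\<lambda>\<omega>. \<lambda>i\<in>{..0}. Y.X i \<omega>) = (\<lambda>\<omega>. F (Y0 \<omega>))"
      by (auto simp: F_def fun_eq_iff)
    moreover have "distr (distr M borel X0) (?P 0) F = distr M (?P 0) (\<lambda>\<omega>. F (X0 \<omega>))"
      "distr (distr M borel Y0) (?P 0) F = distr M (?P 0) (\<lambda>\<omega>. F (Y0 \<omega>))"
      using distr_distr[OF Fm X.measurable_noise(1)] distr_distr[OF Fm Y.measurable_noise(1)] by (simp_all only: o_def)
    ultimately have "?L 0 = distr (distr M borel X0) (?P 0) F" "?N 0 = distr (distr M borel Y0) (?P 0) F"
      by (simp_all only:)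
    moreover have "entropic_bound (distr (distr M borel X0) (?P 0) F) (distr (distr M borel Y0) (?P 0) F) C"
      by (rule entropic_bound_distr[OF init]) (use Fm in simp_all)
    ultimately show ?case by (simp only: lessThan_0 sum.empty add_0_right)
  next
    case (Suc j)
    then have IH: "entropic_bound (?L j) (?N j) (C + (\<Sum>j<j. \<integral>\<omega>. ?q j (X.X j \<omega>) \<partial>M))"
      by (intro Suc.IH) simp
    have cm[measurable]: "(\<lambda>x. x j) \<in> ?P j \<rightarrow>\<^sub>M borel" by (intro measurable_component_singleton) simp
    have qi: "integrable M (\<lambda>\<omega>. ?q j (X.X j \<omega>))" using Suc.prems[of j] by simp
    have "entropic_bound
       (distr (?L j \<Otimes>\<^sub>M G) (?N j \<Otimes>\<^sub>M borel) (\<lambda>z. (fst z, fst z j + h *\<^sub>R a j (fst z j) + S *v snd z)))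
       (distr (?N j \<Otimes>\<^sub>M G) (?N j \<Otimes>\<^sub>M borel) (\<lambda>z. (fst z, fst z j + h *\<^sub>R b j (fst z j) + S *v snd z)))
       (C + (\<Sum>j<j. \<integral>\<omega>. ?q j (X.X j \<omega>) \<partial>M) + (\<integral>x. ?q j (x j) \<partial>?L j))"
    proof (rule entropic_bound_kernel[OF _ _ pG pG _ _ _ IH])
      show "prob_space (?N j)" "prob_space (?L j)" by (auto intro: X.prob_space_distr)
      show "(\<lambda>z. fst z j + h *\<^sub>R a j (fst z j) + S *v snd z) \<in> ?N j \<Otimes>\<^sub>M G \<rightarrow>\<^sub>M borel"
        "(\<lambda>z. fst z j + h *\<^sub>R b j (fst z j) + S *v snd z) \<in> ?N j \<Otimes>\<^sub>M G \<rightarrow>\<^sub>M borel" by measurable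
      show "integrable (?L j) (\<lambda>x. ?q j (x j))"
        using qi by (subst integrable_distr_eq) auto
      fix x assume "x \<in> space (?N j)"
      \<comment> \<open>The shift with \<open>S *v u\<close> equal to the drift difference over one
        step; \<open>(norm u)\<^sup>2 / (2 * h)\<close> becomes \<open>h / 2\<close> times the
        squared transformed difference.\<close>
      define u where "u = R *v (h *\<^sub>R (a j (x j) - b j (x j)))"
      define T where "T y = x j + h *\<^sub>R b j (x j) + S *v y" for y
      have Tm[measurable]: "T \<in> borel \<rightarrow>\<^sub>M borel" unfolding T_def by measurable
      have "S *v u = h *\<^sub>R (a j (x j) - b j (x j))"
        unfolding u_def matrix_vector_mul_assoc SR by simp
      then have T: "x j + h *\<^sub>R a j (x j) + S *v y = T (y + u)" for y
        by (simp add: T_def matrix_vector_right_distrib algebra_simps)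
      have "entropic_bound (distr (distr G borel (\<lambda>y. y + u)) borel T) (distr G borel T) ((norm u)\<^sup>2 / (2 * h))"
        unfolding G_def
      proof (rule entropic_bound_distr[OF entropic_bound_gaussian_shift[OF X.h]])
        show "T \<in> multivariate_normal 0 (h *\<^sub>R mat 1) \<rightarrow>\<^sub>M borel"
          unfolding measurable_cong_sets[OF sets_multivariate_normal refl] by (rule Tm)
      qed simp
      moreover have "distr (distr G borel (\<lambda>y. y + u)) borel T = distr G borel (\<lambda>y. T (y + u))"
      proof (subst distr_distr[OF Tm])
        show "(\<lambda>y. y + u) \<in> G \<rightarrow>\<^sub>M borel" unfolding measurable_cong_sets[OF sG refl] by simp
      qed (simp add: o_def)
      moreover have "(norm u)\<^sup>2 / (2 * h) = ?q j (x j)"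
        using X.h by (simp add: u_def matrix_vector_mult_scaleR power_mult_distrib power2_eq_square)
      ultimately show "entropic_bound (distr G borel (\<lambda>y. fst (x, y) j + h *\<^sub>R a j (fst (x, y) j) + S *v snd (x, y)))
          (distr G borel (\<lambda>y. fst (x, y) j + h *\<^sub>R b j (fst (x, y) j) + S *v snd (x, y))) (?q j (x j))"
        by (simp add: T T_def[abs_def])
    qed simp
    moreover have "(\<integral>x. ?q j (x j) \<partial>?L j) = (\<integral>\<omega>. ?q j (X.X j \<omega>) \<partial>M)"
      by (subst integral_distr) auto
    moreover have "distr (?L j \<Otimes>\<^sub>M G) (?N j \<Otimes>\<^sub>M borel) (\<lambda>z. (fst z, fst z j + h *\<^sub>R a j (fst z j) + S *v snd z))
        = distr M (?P j \<Otimes>\<^sub>M borel) (\<lambda>\<omega>. (\<lambda>i\<in>{..j}. X.X i \<omega>, X.X (Suc j) \<omega>))"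
      unfolding X.law_past_next G_def by (intro distr_cong sets_pair_measure_cong) auto
    moreover have "distr (?N j \<Otimes>\<^sub>M G) (?N j \<Otimes>\<^sub>M borel) (\<lambda>z. (fst z, fst z j + h *\<^sub>R b j (fst z j) + S *v snd z))
        = distr M (?P j \<Otimes>\<^sub>M borel) (\<lambda>\<omega>. (\<lambda>i\<in>{..j}. Y.X i \<omega>, Y.X (Suc j) \<omega>))"
      unfolding Y.law_past_next G_def by (intro distr_cong sets_pair_measure_cong) auto
    ultimately have "entropic_bound
        (distr M (?P j \<Otimes>\<^sub>M borel) (\<lambda>\<omega>. (\<lambda>i\<in>{..j}. X.X i \<omega>, X.X (Suc j) \<omega>)))
        (distr M (?P j \<Otimes>\<^sub>M borel) (\<lambda>\<omega>. (\<lambda>i\<in>{..j}. Y.X i \<omega>, Y.X (Suc j) \<omega>)))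
        (C + (\<Sum>j<Suc j. \<integral>\<omega>. ?q j (X.X j \<omega>) \<partial>M))"
      by (simp only: sum.lessThan_Suc add.assoc)
    then show ?case unfolding X.law_path_Suc Y.law_path_Suc
    proof (rule entropic_bound_distr)
      have "(\<lambda>(x, y). x(Suc j := y)) \<in> ?P j \<Otimes>\<^sub>M borel \<rightarrow>\<^sub>M ?P (Suc j)"
        unfolding atMost_Suc by (rule measurable_add_dim)
      then show "(\<lambda>(x, y). x(Suc j := y)) \<in>
          distr M (?P j \<Otimes>\<^sub>M borel) (\<lambda>\<omega>. (\<lambda>i\<in>{..j}. Y.X i \<omega>, Y.X (Suc j) \<omega>)) \<rightarrow>\<^sub>M ?P (Suc j)"
        by (simp only: measurable_distr_eq1)
    qed (simp only: sets_distr)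
  qed
  then show ?thesis by (simp only: Bochner_Integration.integral_mult_right_zero)
qed

context gaussian_chain
begin

text \<open>The deviation from the centre obeys a linear recursion with matrix
  \<open>I + h A\<close> and independent noise. The transform at \<open>w\<close> is therefore the
  previous one at \<open>w' = (I + h A)^T w\<close> times a Gaussian factor, and a bound quadratic
  in \<open>norm w\<close> reproduces itself.\<close>

lemma linear_chain_mgf:
  fixes A :: "nat \<Rightarrow> real^'n^'n" and p c :: "nat \<Rightarrow> real^'n"
  assumes aff: "\<And>j u. j < n \<Longrightarrow> b j u = p j + A j *v (u - c j)"
    and c: "\<And>j. j < n \<Longrightarrow> c (Suc j) = c j + h *\<^sub>R p j"
    and A: "\<And>j w. j < n \<Longrightarrow> norm (transpose (A j) *v w) \<le> L * norm w" and L: "0 \<le> L"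
    and S: "\<And>w. norm (transpose S *v w) \<le> s * norm w"
    and init: "\<And>w. (\<integral>\<^sup>+\<omega>. ennreal (exp (w \<bullet> (X0 \<omega> - c 0))) \<partial>M) \<le> ennreal (exp (v * (norm w)\<^sup>2))" and v: "0 \<le> v"
    and j: "j \<le> n"
  shows "(\<integral>\<^sup>+\<omega>. ennreal (exp (w \<bullet> (X j \<omega> - c j))) \<partial>M)
    \<le> ennreal (exp ((1 + h * L) ^ (2 * j) * (v + real j * h * s\<^sup>2 / 2) * (norm w)\<^sup>2))"
  using j
proof (induction j arbitrary: w)
  case 0
  then show ?case using init by simp
next
  case (Suc j)
  then have jn: "j < n" by simp
  define w' where "w' = w + h *\<^sub>R (transpose (A j) *v w)"
  define z where "z = transpose S *v w"
  define V where "V = (1 + h * L) ^ (2 * j) * (v + real j * h * s\<^sup>2 / 2)"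
  have V0: "0 \<le> V" using h L v by (auto simp: V_def)
  have step: "w \<bullet> (X (Suc j) \<omega> - c (Suc j)) = w' \<bullet> (X j \<omega> - c j) + z \<bullet> \<Delta> j \<omega>" for \<omega>
  proof -
    have eq: "X (Suc j) \<omega> - c (Suc j) = (X j \<omega> - c j) + h *\<^sub>R (A j *v (X j \<omega> - c j)) + S *v \<Delta> j \<omega>"
      by (simp add: aff[OF jn] c[OF jn] algebra_simps)
    show ?thesis unfolding eq
      by (simp add: w'_def z_def inner_add_left inner_add_right transpose_matrix_vector dot_lmul_matrix)
  qed
  have G: "(\<integral>\<^sup>+\<omega>. ennreal (exp (z \<bullet> \<Delta> j \<omega>)) \<partial>M) = ennreal (exp (h * (norm z)\<^sup>2 / 2))"
  proof -
    have psd: "sym_pos_semidef (h *\<^sub>R mat 1 :: real^'n^'n)"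
      using h by (intro sym_pos_semidef_scaleR) (auto simp: sym_pos_semidef_def transpose_mat)
    have "(\<integral>\<^sup>+\<omega>. ennreal (exp (z \<bullet> \<Delta> j \<omega>)) \<partial>M) = (\<integral>\<^sup>+x. ennreal (exp (z \<bullet> (x - 0))) \<partial>distr M borel (\<Delta> j))"
      by (subst nn_integral_distr) auto
    also have "\<dots> = ennreal (exp ((norm (matrix_sqrt (h *\<^sub>R mat 1) *v z))\<^sup>2 / 2))"
      unfolding law by (rule multivariate_normal_mgf[OF psd])
    also have "(norm (matrix_sqrt (h *\<^sub>R mat 1) *v z))\<^sup>2 = h * (norm z)\<^sup>2"
      using h by (simp add: matrix_sqrt_scaleR_mat scaleR_matrix_vector_assoc[symmetric] power_mult_distrib)
    finally show ?thesis .
  qed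
  have [measurable]: "(\<lambda>x. x j) \<in> Pi\<^sub>M {..j} (\<lambda>_. borel :: (real^'n) measure) \<rightarrow>\<^sub>M borel"
    by (intro measurable_component_singleton) simp
  have "(\<integral>\<^sup>+\<omega>. ennreal (exp (w \<bullet> (X (Suc j) \<omega> - c (Suc j)))) \<partial>M)
      = (\<integral>\<^sup>+\<omega>. ennreal (exp (w' \<bullet> ((\<lambda>i\<in>{..j}. X i \<omega>) j - c j))) * ennreal (exp (z \<bullet> \<Delta> j \<omega>)) \<partial>M)"
    unfolding step by (simp add: exp_add ennreal_mult)
  also have "\<dots> = (\<integral>\<^sup>+\<omega>. ennreal (exp (w' \<bullet> ((\<lambda>i\<in>{..j}. X i \<omega>) j - c j))) \<partial>M) * (\<integral>\<^sup>+\<omega>. ennreal (exp (z \<bullet> \<Delta> j \<omega>)) \<partial>M)"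
    by (rule nn_integral_mult_of_product_law[OF law_past_increment,
          where f = "\<lambda>x. ennreal (exp (w' \<bullet> (x j - c j)))" and g = "\<lambda>y. ennreal (exp (z \<bullet> y))"]) measurable
  also have "\<dots> \<le> ennreal (exp (V * (norm w')\<^sup>2)) * ennreal (exp (h * (norm z)\<^sup>2 / 2))"
    unfolding G using Suc.IH[of w'] Suc.prems by (intro mult_right_mono) (auto simp: V_def)
  also have "\<dots> = ennreal (exp (V * (norm w')\<^sup>2 + h * (norm z)\<^sup>2 / 2))"
    by (simp add: exp_add ennreal_mult)
  also have "\<dots> \<le> ennreal (exp ((1 + h * L) ^ (2 * Suc j) * (v + real (Suc j) * h * s\<^sup>2 / 2) * (norm w)\<^sup>2))"
  proof (intro ennreal_leI, subst exp_le_cancel_iff)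
    have "norm w' \<le> norm w + h * (L * norm w)"
      unfolding w'_def using norm_triangle_ineq[of w "h *\<^sub>R (transpose (A j) *v w)"] A[OF jn, of w] h
      by (auto intro: order_trans mult_left_mono)
    then have "norm w' \<le> (1 + h * L) * norm w" by (simp add: algebra_simps)
    then have w': "(norm w')\<^sup>2 \<le> (1 + h * L)\<^sup>2 * (norm w)\<^sup>2"
      unfolding power_mult_distrib[symmetric] by (intro power_mono) auto
    have z: "(norm z)\<^sup>2 \<le> s\<^sup>2 * (norm w)\<^sup>2"
      unfolding power_mult_distrib[symmetric] z_def using S by (intro power_mono) auto
    have one: "1 \<le> (1 + h * L) ^ (2 * Suc j)" using h L by (intro one_le_power) auto
    have "V * (norm w')\<^sup>2 + h * (norm z)\<^sup>2 / 2 \<le> V * ((1 + h * L)\<^sup>2 * (norm w)\<^sup>2) + h * (s\<^sup>2 * (norm w)\<^sup>2) / 2"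
      using w' z V0 h by (intro add_mono mult_left_mono divide_right_mono) auto
    \<comment> \<open>The noise of the current step carries no growth factor yet; multiplying it by
      a factor at least 1 lets both terms share one closed form.\<close>
    also have "\<dots> \<le> V * ((1 + h * L)\<^sup>2 * (norm w)\<^sup>2) + (1 + h * L) ^ (2 * Suc j) * (h * (s\<^sup>2 * (norm w)\<^sup>2) / 2)"
      using mult_right_mono[OF one, of "h * (s\<^sup>2 * (norm w)\<^sup>2) / 2"] h by simp
    also have "\<dots> = (1 + h * L) ^ (2 * Suc j) * (v + real (Suc j) * h * s\<^sup>2 / 2) * (norm w)\<^sup>2"
      by (simp add: V_def power2_eq_square algebra_simps add_divide_distrib)
    finally show "V * (norm w')\<^sup>2 + h * (norm z)\<^sup>2 / 2 \<le> \<dots>" .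
  qed
  finally show ?case .
qed

end

section \<open>Polynomial moments from exponential moments\<close>

lemma power_le_fact_exp:
  fixes x :: real
  assumes "0 \<le> x"
  shows "x ^ p \<le> fact p * exp x"
proof -
  have "(\<Sum>n\<in>{p}. x ^ n /\<^sub>R fact n) \<le> (\<Sum>n. x ^ n /\<^sub>R fact n)"
    using assms by (intro sum_le_suminf summable_exp_generic) auto
  then have "x ^ p /\<^sub>R fact p \<le> exp x" unfolding exp_def by simp
  then show ?thesis by (simp add: field_simps)
qed

text \<open>The largest coordinate controls the norm up to \<open>CARD('n)\<close>, and one of the
  two signed exponentials in that coordinate controls its power. The free parameter \<open>r\<close>
  is the length scale at which the exponentials are taken.\<close>

lemma norm_power_le_sum_exp:
  fixes y :: "real^'n"
  assumes r: "0 < r"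
  shows "norm y ^ p \<le> real CARD('n) ^ p * fact p * r ^ p *
    (\<Sum>i\<in>UNIV. exp (axis i (1 / r) \<bullet> y) + exp (axis i (- 1 / r) \<bullet> y))"
proof -
  let ?e = "\<lambda>i. exp (axis i (1 / r) \<bullet> y) + exp (axis i (- 1 / r) \<bullet> y)"
  define m where "m = Max (range (\<lambda>i. \<bar>y $ i\<bar>))"
  have "m \<in> range (\<lambda>i. \<bar>y $ i\<bar>)" unfolding m_def by (intro Max_in) auto
  then obtain k where k: "m = \<bar>y $ k\<bar>" by auto
  have "\<bar>y $ i\<bar> \<le> \<bar>y $ k\<bar>" for i unfolding k[symmetric] m_def by (intro Max_ge) auto
  then have "norm y \<le> (\<Sum>i\<in>(UNIV::'n set). \<bar>y $ k\<bar>)"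
    using norm_le_l1_cart[of y] by (meson order_trans sum_mono)
  then have "norm y ^ p \<le> (real CARD('n) * \<bar>y $ k\<bar>) ^ p" by (intro power_mono) auto
  also have "\<dots> = real CARD('n) ^ p * r ^ p * (\<bar>y $ k\<bar> / r) ^ p"
    using r by (simp add: power_mult_distrib power_divide)
  also have "\<dots> \<le> real CARD('n) ^ p * r ^ p * (fact p * exp (\<bar>y $ k\<bar> / r))"
    using r by (intro mult_left_mono power_le_fact_exp) auto
  also have "exp (\<bar>y $ k\<bar> / r) \<le> ?e k"
    by (cases "0 \<le> y $ k") (auto simp: inner_axis' abs_if add_increasing add_increasing2)
  also have "?e k \<le> sum ?e UNIV" by (rule member_le_sum) (auto intro: add_nonneg_nonneg)
  finally show ?thesis using r by (simp add: mult_ac)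
qed

text \<open>At the vectors \<open>axis i (1 / r)\<close> and \<open>axis i (- 1 / r)\<close> the
  exponent in \<open>mgf\<close> is exactly \<open>\<kappa>\<close>, so the moments scale like
  \<open>r ^ p\<close> with a constant free of \<open>r\<close>. Later
  \<open>r = sqrt \<epsilon>\<close>.\<close>

lemma (in prob_space) moment_bound_of_mgf:
  fixes Y :: "'a \<Rightarrow> real^'n"
  assumes [measurable]: "Y \<in> borel_measurable M" and r: "0 < r"
    and mgf: "\<And>w. (\<integral>\<^sup>+\<omega>. ennreal (exp (w \<bullet> Y \<omega>)) \<partial>M) \<le> ennreal (exp (\<kappa> * r\<^sup>2 * (norm w)\<^sup>2))"
  shows "integrable M (\<lambda>\<omega>. norm (Y \<omega>) ^ p)"
    "(\<integral>\<omega>. norm (Y \<omega>) ^ p \<partial>M) \<le> 2 * real CARD('n) ^ Suc p * fact p * exp \<kappa> * r ^ p"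
proof -
  let ?K = "real CARD('n) ^ p * fact p * r ^ p"
  have mgf': "(\<integral>\<^sup>+\<omega>. ennreal (exp (axis i a \<bullet> Y \<omega>)) \<partial>M) \<le> ennreal (exp \<kappa>)" if a: "\<bar>a\<bar> = 1 / r" for i a
  proof -
    have eq: "\<kappa> * r\<^sup>2 * (norm (axis i a :: real^'n))\<^sup>2 = \<kappa>"
    proof -
      have "(norm (axis i a :: real^'n))\<^sup>2 = \<bar>a\<bar>\<^sup>2"
        unfolding power2_norm_eq_inner inner_axis by (simp add: axis_def power2_eq_square)
      then show ?thesis using r by (simp add: a power_divide)
    qed
    show ?thesis using mgf[of "axis i a"] unfolding eq .
  qed
  have "(\<integral>\<^sup>+\<omega>. ennreal (norm (Y \<omega>) ^ p) \<partial>M)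
      \<le> (\<integral>\<^sup>+\<omega>. ennreal ?K * (\<Sum>i\<in>UNIV. ennreal (exp (axis i (1 / r) \<bullet> Y \<omega>)) + ennreal (exp (axis i (- 1 / r) \<bullet> Y \<omega>))) \<partial>M)"
  proof (rule nn_integral_mono)
    fix \<omega>
    have "ennreal (norm (Y \<omega>) ^ p) \<le> ennreal (?K * (\<Sum>i\<in>UNIV. exp (axis i (1 / r) \<bullet> Y \<omega>) + exp (axis i (- 1 / r) \<bullet> Y \<omega>)))"
      by (intro ennreal_leI norm_power_le_sum_exp r)
    also have "\<dots> = ennreal ?K * ennreal (\<Sum>i\<in>UNIV. exp (axis i (1 / r) \<bullet> Y \<omega>) + exp (axis i (- 1 / r) \<bullet> Y \<omega>))"
      using r by (intro ennreal_mult sum_nonneg add_nonneg_nonneg) auto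
    also have "ennreal (\<Sum>i\<in>UNIV. exp (axis i (1 / r) \<bullet> Y \<omega>) + exp (axis i (- 1 / r) \<bullet> Y \<omega>))
        = (\<Sum>i\<in>UNIV. ennreal (exp (axis i (1 / r) \<bullet> Y \<omega>)) + ennreal (exp (axis i (- 1 / r) \<bullet> Y \<omega>)))"
      by (subst sum_ennreal[symmetric]) (auto intro: add_nonneg_nonneg simp: ennreal_plus)
    finally show "ennreal (norm (Y \<omega>) ^ p) \<le> ennreal ?K * (\<Sum>i\<in>UNIV. ennreal (exp (axis i (1 / r) \<bullet> Y \<omega>)) + ennreal (exp (axis i (- 1 / r) \<bullet> Y \<omega>)))" .
  qed
  also have "\<dots> = ennreal ?K * (\<Sum>i\<in>UNIV. (\<integral>\<^sup>+\<omega>. ennreal (exp (axis i (1 / r) \<bullet> Y \<omega>)) \<partial>M) + (\<integral>\<^sup>+\<omega>. ennreal (exp (axis i (- 1 / r) \<bullet> Y \<omega>)) \<partial>M))"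
    by (simp add: nn_integral_cmult nn_integral_sum nn_integral_add)
  also have "\<dots> \<le> ennreal ?K * (\<Sum>i\<in>(UNIV::'n set). ennreal (exp \<kappa>) + ennreal (exp \<kappa>))"
    using r by (intro mult_left_mono sum_mono add_mono mgf') auto
  also have "\<dots> = ennreal ?K * ennreal (\<Sum>i\<in>(UNIV::'n set). exp \<kappa> + exp \<kappa>)"
    by (simp only: ennreal_plus[symmetric] exp_ge_zero sum_ennreal add_nonneg_nonneg)
  also have "\<dots> = ennreal (?K * (\<Sum>i\<in>(UNIV::'n set). exp \<kappa> + exp \<kappa>))"
    using r by (subst ennreal_mult) (auto intro!: sum_nonneg)
  also have "?K * (\<Sum>i\<in>(UNIV::'n set). exp \<kappa> + exp \<kappa>) = 2 * real CARD('n) ^ Suc p * fact p * exp \<kappa> * r ^ p"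
    by (simp add: algebra_simps)
  finally have le: "(\<integral>\<^sup>+\<omega>. ennreal (norm (Y \<omega>) ^ p) \<partial>M) \<le> ennreal (2 * real CARD('n) ^ Suc p * fact p * exp \<kappa> * r ^ p)" .
  show int: "integrable M (\<lambda>\<omega>. norm (Y \<omega>) ^ p)"
    using le by (intro integrableI_bounded) (auto simp: le_less_trans[OF _ ennreal_less_top])
  have "ennreal (\<integral>\<omega>. norm (Y \<omega>) ^ p \<partial>M) \<le> ennreal (2 * real CARD('n) ^ Suc p * fact p * exp \<kappa> * r ^ p)"
    using le by (subst nn_integral_eq_integral[OF int, symmetric]) auto
  then show "(\<integral>\<omega>. norm (Y \<omega>) ^ p \<partial>M) \<le> 2 * real CARD('n) ^ Suc p * fact p * exp \<kappa> * r ^ p"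
    using r by (subst (asm) ennreal_le_iff) auto
qed

section \<open>Testing the dual inequality on continuous functions\<close>

text \<open>Discrete layer-cake formula: the number of levels \<open>real (Suc k) / real n\<close>
  below \<open>y\<close> is the floor of \<open>n * y\<close>. It reduces approximation of functions
  to approximation of superlevel sets.\<close>

lemma floor_level_sum:
  fixes y :: real
  assumes y: "0 \<le> y" "y \<le> 1" and n: "0 < n"
  shows "\<bar>y - (\<Sum>k<n. indicator {r. real (Suc k) / real n \<le> r} y) / real n\<bar> \<le> 1 / real n"
proof -
  define m where "m = nat \<lfloor>real n * y\<rfloor>"
  have m: "real m \<le> real n * y" "real n * y < real m + 1"
    using y n by (auto simp: m_def)
  have "real m \<le> real n" using m(1) y n by (meson mult_left_le of_nat_0_le_iff order_trans)
  then have mn: "m \<le> n" by simp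
  have "real (Suc k) / real n \<le> y \<longleftrightarrow> k < m" for k
  proof -
    have "real (Suc k) / real n \<le> y \<longleftrightarrow> real (Suc k) \<le> real n * y"
      using n by (simp add: field_simps)
    also have "\<dots> \<longleftrightarrow> int (Suc k) \<le> \<lfloor>real n * y\<rfloor>" by (simp add: le_floor_iff)
    also have "\<dots> \<longleftrightarrow> k < m" unfolding m_def by linarith
    finally show ?thesis .
  qed
  then have "(\<Sum>k<n. indicator {r. real (Suc k) / real n \<le> r} y :: real) = (\<Sum>k<n. if k < m then 1 else 0)"
    by (intro sum.cong) (auto simp: indicator_def)
  also have "\<dots> = real (card ({..<n} \<inter> {k. k < m}))" by (simp add: sum.If_cases)
  also have "{..<n} \<inter> {k. k < m} = {..<m}" using mn by auto
  finally have "(\<Sum>k<n. indicator {r. real (Suc k) / real n \<le> r} y :: real) = real m" by simp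
  moreover have "\<bar>y - real m / real n\<bar> \<le> 1 / real n"
  proof -
    have "y - real m / real n = (real n * y - real m) / real n" using n by (simp add: field_simps)
    then show ?thesis using m n by (simp add: divide_right_mono)
  qed
  ultimately show ?thesis by simp
qed

text \<open>The closure rules mirror set operations on indicators: \<open>compl\<close> for
  complements, \<open>max\<close> for unions, \<open>average\<close> for the layer-cake sums. Tests
  with values in the unit interval suffice, since \<open>2 * B * g - B\<close> ranges over
  \<open>[-B, B]\<close>.\<close>

locale entropic_test_functions =
  fixes \<mu> \<nu> :: "'a measure" and G :: "('a \<Rightarrow> real) set" and C :: real
  assumes prob: "prob_space \<mu>" "prob_space \<nu>" and sets_eq: "sets \<nu> = sets \<mu>"
    and meas: "g \<in> G \<Longrightarrow> g \<in> borel_measurable \<mu>"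
    and unit_interval: "g \<in> G \<Longrightarrow> 0 \<le> g x \<and> g x \<le> 1"
    and zero: "(\<lambda>_. 0) \<in> G"
    and compl: "g \<in> G \<Longrightarrow> (\<lambda>x. 1 - g x) \<in> G"
    and max: "g \<in> G \<Longrightarrow> g' \<in> G \<Longrightarrow> (\<lambda>x. max (g x) (g' x)) \<in> G"
    and average: "(\<And>k. k < n \<Longrightarrow> h k \<in> G) \<Longrightarrow> (\<lambda>x. (\<Sum>k<n. h k x) / real n) \<in> G"
    and bound: "g \<in> G \<Longrightarrow> 0 \<le> B \<Longrightarrow>
      (\<integral>x. 2 * B * g x - B \<partial>\<nu>) \<le> ln (\<integral>x. exp (2 * B * g x - B) \<partial>\<mu>) + C"
begin

text \<open>One \<open>g\<close> must serve both measures, because both occur in the inequality that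
  is to be transferred.\<close>

definition approximable :: "'a set \<Rightarrow> bool" where
  "approximable A \<longleftrightarrow> A \<in> sets \<mu> \<and>
     (\<forall>e>0. \<exists>g\<in>G. \<forall>m\<in>{\<mu>, \<nu>}. (\<integral>x. \<bar>indicator A x - g x\<bar> \<partial>m) < e)"

lemma m_props:
  assumes "m \<in> {\<mu>, \<nu>}"
  shows "prob_space m" "sets m = sets \<mu>" "space m = space \<mu>"
    "g \<in> G \<Longrightarrow> g \<in> borel_measurable m" "g \<in> G \<Longrightarrow> integrable m g"
proof -
  show p: "prob_space m" and s: "sets m = sets \<mu>" using assms prob sets_eq by auto
  show "space m = space \<mu>" using s by (rule sets_eq_imp_space_eq)
  show g: "g \<in> borel_measurable m" if "g \<in> G" for g using meas[OF that] s measurable_cong_sets by blast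
  show "integrable m g" if "g \<in> G"
    using unit_interval[OF that] g[OF that] by (intro prob_space.integrable_of_bounded[OF p, where B = 1]) auto
qed

lemma integrable_err:
  assumes "m \<in> {\<mu>, \<nu>}" "A \<in> sets \<mu>" "g \<in> G"
  shows "integrable m (\<lambda>x. \<bar>indicator A x - g x\<bar>)"
proof -
  interpret prob_space m using m_props(1)[OF assms(1)] .
  have "A \<in> sets m" using assms m_props(2) by blast
  then show ?thesis using m_props(5)[OF assms(1,3)]
    by (intro integrable_abs Bochner_Integration.integrable_diff integrable_real_indicator) (auto simp: emeasure_eq_measure)
qed

lemma approximable_Un:
  assumes "approximable A" "approximable A'"
  shows "approximable (A \<union> A')"
  unfolding approximable_def
proof (intro conjI allI impI)
  show "A \<union> A' \<in> sets \<mu>" using assms by (auto simp: approximable_def)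
  fix e :: real assume "e > 0"
  then obtain g g' where g: "g \<in> G" "g' \<in> G"
    and e: "\<And>m. m \<in> {\<mu>, \<nu>} \<Longrightarrow> (\<integral>x. \<bar>indicator A x - g x\<bar> \<partial>m) < e / 2"
      "\<And>m. m \<in> {\<mu>, \<nu>} \<Longrightarrow> (\<integral>x. \<bar>indicator A' x - g' x\<bar> \<partial>m) < e / 2"
    using assms unfolding approximable_def by (meson half_gt_zero)
  show "\<exists>g\<in>G. \<forall>m\<in>{\<mu>, \<nu>}. (\<integral>x. \<bar>indicator (A \<union> A') x - g x\<bar> \<partial>m) < e"
  proof (intro bexI ballI)
    show G: "(\<lambda>x. max (g x) (g' x)) \<in> G" using g max by blast
    fix m assume m: "m \<in> {\<mu>, \<nu>}"
    have A: "A \<in> sets \<mu>" "A' \<in> sets \<mu>" using assms by (auto simp: approximable_def)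
    have "(\<integral>x. \<bar>indicator (A \<union> A') x - max (g x) (g' x)\<bar> \<partial>m)
        \<le> (\<integral>x. \<bar>indicator A x - g x\<bar> + \<bar>indicator A' x - g' x\<bar> \<partial>m)"
    proof (rule integral_mono)
      fix x
      show "\<bar>indicator (A \<union> A') x - max (g x) (g' x)\<bar> \<le> \<bar>indicator A x - g x\<bar> + \<bar>indicator A' x - g' x\<bar>"
        using unit_interval[OF g(1), of x] unit_interval[OF g(2), of x]
        by (auto simp: indicator_def max_def)
    qed (use integrable_err m G g A in auto)
    also have "\<dots> < e"
      using e(1)[OF m] e(2)[OF m] integrable_err[OF m A(1) g(1)] integrable_err[OF m A(2) g(2)] by simp
    finally show "(\<integral>x. \<bar>indicator (A \<union> A') x - max (g x) (g' x)\<bar> \<partial>m) < e" .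
  qed
qed

text \<open>Serves for countable unions, whose finite partial unions exhaust them up to small
  measure.\<close>

lemma approximable_close:
  assumes A: "A \<in> sets \<mu>"
    and close: "\<And>e. e > 0 \<Longrightarrow> \<exists>A'. approximable A' \<and> A' \<subseteq> A \<and> (\<forall>m\<in>{\<mu>, \<nu>}. measure m (A - A') < e)"
  shows "approximable A"
  unfolding approximable_def
proof (intro conjI A allI impI)
  fix e :: real assume "e > 0"
  then obtain A' where A': "approximable A'" "A' \<subseteq> A" and m1: "\<And>m. m \<in> {\<mu>, \<nu>} \<Longrightarrow> measure m (A - A') < e / 2"
    using close[of "e / 2"] by auto
  then obtain g where g: "g \<in> G" and m2: "\<And>m. m \<in> {\<mu>, \<nu>} \<Longrightarrow> (\<integral>x. \<bar>indicator A' x - g x\<bar> \<partial>m) < e / 2"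
    using \<open>e > 0\<close> unfolding approximable_def by (meson half_gt_zero)
  show "\<exists>g\<in>G. \<forall>m\<in>{\<mu>, \<nu>}. (\<integral>x. \<bar>indicator A x - g x\<bar> \<partial>m) < e"
  proof (intro bexI[OF _ g] ballI)
    fix m assume m: "m \<in> {\<mu>, \<nu>}"
    interpret prob_space m using m_props(1)[OF m] .
    have As: "A' \<in> sets \<mu>" "A - A' \<in> sets m" using A A' m_props(2)[OF m] by (auto simp: approximable_def)
    have i: "integrable m (indicator (A - A') :: _ \<Rightarrow> real)"
      using As by (intro integrable_real_indicator) (auto simp: emeasure_eq_measure)
    have "(\<integral>x. \<bar>indicator A x - g x\<bar> \<partial>m) \<le> (\<integral>x. indicator (A - A') x + \<bar>indicator A' x - g x\<bar> \<partial>m)"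
    proof (rule integral_mono)
      show "integrable m (\<lambda>x. indicator (A - A') x + \<bar>indicator A' x - g x\<bar>)"
        by (rule Bochner_Integration.integrable_add[OF i integrable_err[OF m As(1) g]])
      show "\<bar>indicator A x - g x\<bar> \<le> indicator (A - A') x + \<bar>indicator A' x - g x\<bar>" for x
        using A'(2) by (auto simp: indicator_def)
    qed (rule integrable_err[OF m A g])
    also have "\<dots> < e"
      using m1[OF m] m2[OF m] i integrable_err[OF m As(1) g] As(2) sets.sets_into_space[OF As(2)]
      by (simp add: Int_absorb2)
    finally show "(\<integral>x. \<bar>indicator A x - g x\<bar> \<partial>m) < e" .
  qed
qed

text \<open>After this it is enough to approximate generators. For countable unions, continuity from
  above of both finite measures makes the remainders small at a common index.\<close>

lemma sigma_algebra_approximable: "sigma_algebra (space \<mu>) {A. approximable A}"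
  unfolding sigma_algebra_iff2
proof (intro conjI allI ballI impI)
  show "{A. approximable A} \<subseteq> Pow (space \<mu>)"
    using sets.sets_into_space by (auto simp: approximable_def)
  have empty: "approximable {}"
    using zero by (auto simp: approximable_def intro!: bexI[of _ "\<lambda>_. 0"])
  then show "{} \<in> {A. approximable A}" by simp
  fix A assume "A \<in> {A. approximable A}"
  then have A: "approximable A" by simp
  show "space \<mu> - A \<in> {A. approximable A}"
    unfolding approximable_def mem_Collect_eq
  proof (intro conjI allI impI)
    show "space \<mu> - A \<in> sets \<mu>" using A by (auto simp: approximable_def)
    fix e :: real assume "e > 0"
    then obtain g where g: "g \<in> G" "\<And>m. m \<in> {\<mu>, \<nu>} \<Longrightarrow> (\<integral>x. \<bar>indicator A x - g x\<bar> \<partial>m) < e"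
      using A unfolding approximable_def by meson
    show "\<exists>g\<in>G. \<forall>m\<in>{\<mu>, \<nu>}. (\<integral>x. \<bar>indicator (space \<mu> - A) x - g x\<bar> \<partial>m) < e"
    proof (intro bexI ballI)
      show "(\<lambda>x. 1 - g x) \<in> G" using g compl by blast
      fix m assume m: "m \<in> {\<mu>, \<nu>}"
      have "(\<integral>x. \<bar>indicator (space \<mu> - A) x - (1 - g x)\<bar> \<partial>m) = (\<integral>x. \<bar>indicator A x - g x\<bar> \<partial>m)"
        using m_props(3)[OF m] by (intro Bochner_Integration.integral_cong) (auto simp: indicator_def)
      then show "(\<integral>x. \<bar>indicator (space \<mu> - A) x - (1 - g x)\<bar> \<partial>m) < e" using g(2)[OF m] by simp
    qed
  qed
next
  have empty: "approximable {}"
    using zero by (auto simp: approximable_def intro!: bexI[of _ "\<lambda>_. 0"])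
  fix A :: "nat \<Rightarrow> 'a set" assume "range A \<subseteq> {A. approximable A}"
  then have A: "approximable (A i)" for i by auto
  have U: "approximable (\<Union>i<n. A i)" for n
    by (induction n) (auto simp: lessThan_Suc A empty intro!: approximable_Un)
  have As: "A i \<in> sets \<mu>" for i using A by (auto simp: approximable_def)
  show "\<Union> (range A) \<in> {A. approximable A}"
  proof (simp only: mem_Collect_eq, rule approximable_close)
    show "\<Union> (range A) \<in> sets \<mu>" using As by auto
    fix e :: real assume e: "e > 0"
    have lim: "(\<lambda>n. measure m (\<Union> (range A) - (\<Union>i<n. A i))) \<longlonglongrightarrow> 0" if m: "m \<in> {\<mu>, \<nu>}" for m
    proof -
      interpret prob_space m using m_props(1)[OF m] .
      have As': "A i \<in> sets m" for i using As m_props(2)[OF m] by simp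
      have "(\<lambda>n. measure m (\<Union> (range A) - (\<Union>i<n. A i))) \<longlonglongrightarrow> measure m (\<Inter>n. \<Union> (range A) - (\<Union>i<n. A i))"
        using As' by (intro finite_Lim_measure_decseq) (auto simp: decseq_def)
      also have "(\<Inter>n. \<Union> (range A) - (\<Union>i<n. A i)) = {}" by blast
      finally show ?thesis by simp
    qed
    have "\<forall>\<^sub>F n in sequentially. measure \<mu> (\<Union> (range A) - (\<Union>i<n. A i)) < e \<and> measure \<nu> (\<Union> (range A) - (\<Union>i<n. A i)) < e"
      using order_tendstoD(2)[OF lim[of \<mu>] e] order_tendstoD(2)[OF lim[of \<nu>] e] by (simp add: eventually_conj)
    then obtain n where "measure \<mu> (\<Union> (range A) - (\<Union>i<n. A i)) < e" "measure \<nu> (\<Union> (range A) - (\<Union>i<n. A i)) < e"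
      using eventually_happens'[OF sequentially_bot] by blast
    then show "\<exists>A'. approximable A' \<and> A' \<subseteq> \<Union> (range A) \<and> (\<forall>m\<in>{\<mu>, \<nu>}. measure m (\<Union> (range A) - A') < e)"
      using U[of n] by (intro exI[of _ "\<Union>i<n. A i"]) auto
  qed
qed

lemma approximate_unit_function:
  assumes all: "\<And>A. A \<in> sets \<mu> \<Longrightarrow> approximable A"
    and [measurable]: "f \<in> borel_measurable \<mu>" and f: "\<And>x. x \<in> space \<mu> \<Longrightarrow> 0 \<le> f x \<and> f x \<le> 1"
    and e: "(e :: real) > 0"
  shows "\<exists>g\<in>G. \<forall>m\<in>{\<mu>, \<nu>}. (\<integral>x. \<bar>f x - g x\<bar> \<partial>m) < e"
proof -
  \<comment> \<open>The discretisation costs \<open>1 / real n < e / 2\<close>; the level-set errors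
    are averaged, so accuracy \<open>e / 2\<close> for each suffices whatever \<open>n\<close>
    is.\<close>
  obtain n :: nat where n: "0 < n" "1 / real n < e / 2"
    using real_arch_inverse[of "e / 2"] e by (auto simp: inverse_eq_divide)
  define A where "A k = {x \<in> space \<mu>. real (Suc k) / real n \<le> f x}" for k
  have A: "A k \<in> sets \<mu>" for k unfolding A_def by measurable
  have "\<exists>g\<in>G. \<forall>m\<in>{\<mu>, \<nu>}. (\<integral>x. \<bar>indicator (A k) x - g x\<bar> \<partial>m) < e / 2" for k
    using all[OF A[of k]] e unfolding approximable_def by (meson half_gt_zero)
  then obtain h where h: "\<And>k. h k \<in> G"
      and he: "\<And>k m. m \<in> {\<mu>, \<nu>} \<Longrightarrow> (\<integral>x. \<bar>indicator (A k) x - h k x\<bar> \<partial>m) < e / 2"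
    by metis
  show ?thesis
  proof (intro bexI ballI)
    show G: "(\<lambda>x. (\<Sum>k<n. h k x) / real n) \<in> G" using h average by blast
    fix m assume m: "m \<in> {\<mu>, \<nu>}"
    interpret prob_space m using m_props(1)[OF m] .
    note sp = m_props(3)[OF m]
    have [measurable]: "f \<in> borel_measurable m" "h k \<in> borel_measurable m" for k
      using m_props(2)[OF m] measurable_cong_sets h m_props(4)[OF m] by (blast intro: \<open>f \<in> borel_measurable \<mu>\<close>)+
    have fi: "integrable m f" using f by (intro integrable_of_bounded[where B = 1]) (auto simp: sp)
    have hi: "integrable m (\<lambda>x. \<bar>indicator (A k) x - h k x\<bar>)" for k using integrable_err m A h by blast
    have "(\<integral>x. \<bar>f x - (\<Sum>k<n. h k x) / real n\<bar> \<partial>m)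
        \<le> (\<integral>x. 1 / real n + (\<Sum>k<n. \<bar>indicator (A k) x - h k x\<bar>) / real n \<partial>m)"
    proof (rule integral_mono)
      show "integrable m (\<lambda>x. \<bar>f x - (\<Sum>k<n. h k x) / real n\<bar>)" using fi m_props(5)[OF m h] by simp
      show "integrable m (\<lambda>x. 1 / real n + (\<Sum>k<n. \<bar>indicator (A k) x - h k x\<bar>) / real n)" using hi by simp
      fix x assume x: "x \<in> space m"
      have ind: "indicator {r. real (Suc k) / real n \<le> r} (f x) = (indicator (A k) x :: real)" for k
        using x by (simp add: A_def sp indicator_def)
      have 1: "\<bar>f x - (\<Sum>k<n. indicator (A k) x) / real n\<bar> \<le> 1 / real n"
        using floor_level_sum[of "f x" n] f[of x] x n unfolding ind by (simp add: sp)
      have "\<bar>(\<Sum>k<n. indicator (A k) x) - (\<Sum>k<n. h k x)\<bar> \<le> (\<Sum>k<n. \<bar>indicator (A k) x - h k x\<bar>)"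
        unfolding sum_subtractf[symmetric] by (rule sum_abs)
      then have "\<bar>(\<Sum>k<n. indicator (A k) x) / real n - (\<Sum>k<n. h k x) / real n\<bar> \<le> (\<Sum>k<n. \<bar>indicator (A k) x - h k x\<bar>) / real n"
        using n by (simp add: diff_divide_distrib[symmetric] divide_right_mono)
      then show "\<bar>f x - (\<Sum>k<n. h k x) / real n\<bar> \<le> 1 / real n + (\<Sum>k<n. \<bar>indicator (A k) x - h k x\<bar>) / real n"
        using 1 by linarith
    qed
    also have "\<dots> = 1 / real n + (\<Sum>k<n. \<integral>x. \<bar>indicator (A k) x - h k x\<bar> \<partial>m) / real n"
      using hi by (simp add: prob_space)
    also have "\<dots> \<le> 1 / real n + (\<Sum>k<n. e / 2) / real n"
      using he[OF m] by (intro add_left_mono divide_right_mono sum_mono) (auto intro: less_imp_le)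
    also have "\<dots> < e" using n by simp
    finally show "(\<integral>x. \<bar>f x - (\<Sum>k<n. h k x) / real n\<bar> \<partial>m) < e" .
  qed
qed

text \<open>On functions bounded by \<open>B\<close> both sides depend continuously on the test in
  mean: the left side linearly, the right side because \<open>exp\<close> has Lipschitz constant
  \<open>exp B\<close> there.\<close>

lemma entropic_bound_of_test_functions:
  assumes all: "\<And>A. A \<in> sets \<mu> \<Longrightarrow> approximable A"
  shows "entropic_bound \<nu> \<mu> C"
proof (rule entropic_boundI)
  interpret \<mu>: prob_space \<mu> using prob by simp
  interpret \<nu>: prob_space \<nu> using prob by simp
  fix \<phi> :: "'a \<Rightarrow> real" and B0
  assume \<phi>[measurable]: "\<phi> \<in> borel_measurable \<mu>" and B0: "\<And>x. x \<in> space \<mu> \<Longrightarrow> \<bar>\<phi> x\<bar> \<le> B0"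
  \<comment> \<open>Made strictly positive, since the test is rescaled by
    \<open>2 * B\<close>.\<close>
  define B where "B = \<bar>B0\<bar> + 1"
  have B: "0 < B" "\<And>x. x \<in> space \<mu> \<Longrightarrow> \<bar>\<phi> x\<bar> \<le> B" using B0 by (force simp: B_def)+
  have [measurable]: "\<phi> \<in> borel_measurable \<nu>" using \<phi> sets_eq measurable_cong_sets by blast
  have sp: "space \<nu> = space \<mu>" using sets_eq by (rule sets_eq_imp_space_eq)
  define Z where "Z = (\<integral>x. exp (\<phi> x) \<partial>\<mu>)"
  note Z = \<mu>.exp_integral_bounds[OF \<phi> B(2), folded Z_def]
  have i\<nu>: "integrable \<nu> \<phi>" using B by (intro \<nu>.integrable_of_bounded[where B = B]) (auto simp: sp)
  have step: "(\<integral>x. \<phi> x \<partial>\<nu>) \<le> ln (Z + exp B * e) + C + e" if e: "e > 0" for e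
  proof -
    have "\<exists>g\<in>G. \<forall>m\<in>{\<mu>, \<nu>}. (\<integral>x. \<bar>(\<phi> x + B) / (2 * B) - g x\<bar> \<partial>m) < e / (2 * B)"
    proof (rule approximate_unit_function[OF all])
      show "0 \<le> (\<phi> x + B) / (2 * B) \<and> (\<phi> x + B) / (2 * B) \<le> 1" if "x \<in> space \<mu>" for x
        using B(2)[OF that] B(1) by (auto simp: field_simps abs_le_iff)
    qed (use B e in auto)
    then obtain g where g: "g \<in> G"
      and ge: "\<And>m. m \<in> {\<mu>, \<nu>} \<Longrightarrow> (\<integral>x. \<bar>(\<phi> x + B) / (2 * B) - g x\<bar> \<partial>m) < e / (2 * B)" by blast
    define h where "h x = 2 * B * g x - B" for x
    have [measurable]: "g \<in> borel_measurable \<mu>" "g \<in> borel_measurable \<nu>"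
      "h \<in> borel_measurable \<mu>" "h \<in> borel_measurable \<nu>"
      unfolding h_def using m_props(4)[OF _ g] by auto
    have hB: "\<bar>h x\<bar> \<le> B" for x
    proof -
      have "0 \<le> 2 * B * g x" "2 * B * g x \<le> 2 * B * 1" using unit_interval[OF g, of x] B(1) by (auto intro: mult_left_mono)
      then show ?thesis by (simp add: h_def abs_le_iff)
    qed
    have close: "(\<integral>x. \<bar>\<phi> x - h x\<bar> \<partial>m) < e" if m: "m \<in> {\<mu>, \<nu>}" for m
    proof -
      have "(\<integral>x. \<bar>\<phi> x - h x\<bar> \<partial>m) = (\<integral>x. 2 * B * \<bar>(\<phi> x + B) / (2 * B) - g x\<bar> \<partial>m)"
      proof (rule Bochner_Integration.integral_cong[OF refl])
        fix x
        have "\<phi> x - h x = 2 * B * ((\<phi> x + B) / (2 * B) - g x)" using B(1) by (simp add: h_def field_simps)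
        then show "\<bar>\<phi> x - h x\<bar> = 2 * B * \<bar>(\<phi> x + B) / (2 * B) - g x\<bar>" using B(1) by (simp add: abs_mult)
      qed
      then show ?thesis using ge[OF m] B(1) by (simp add: field_simps)
    qed
    have hi: "integrable \<nu> h" using hB by (intro \<nu>.integrable_of_bounded) auto
    have i1: "integrable \<mu> (\<lambda>x. \<bar>\<phi> x - h x\<bar>)"
      using B hB by (intro integrable_abs Bochner_Integration.integrable_diff \<mu>.integrable_of_bounded[where B = B]) auto
    have "(\<integral>x. \<phi> x \<partial>\<nu>) - (\<integral>x. h x \<partial>\<nu>) \<le> (\<integral>x. \<bar>\<phi> x - h x\<bar> \<partial>\<nu>)"
      using i\<nu> hi unfolding Bochner_Integration.integral_diff[OF i\<nu> hi, symmetric] by (intro integral_mono) auto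
    then have "(\<integral>x. \<phi> x \<partial>\<nu>) \<le> (\<integral>x. h x \<partial>\<nu>) + e" using close[of \<nu>] by simp
    also have "(\<integral>x. h x \<partial>\<nu>) \<le> ln (\<integral>x. exp (h x) \<partial>\<mu>) + C"
      unfolding h_def using g B by (intro bound) auto
    also have "ln (\<integral>x. exp (h x) \<partial>\<mu>) \<le> ln (Z + exp B * e)"
    proof (subst ln_le_cancel_iff)
      note hZ = \<mu>.exp_integral_bounds[of h, OF _ hB]
      show "0 < (\<integral>x. exp (h x) \<partial>\<mu>)" using hZ by simp
      show "0 < Z + exp B * e" using Z(4) e by (simp add: add_pos_pos)
      have "(\<integral>x. exp (h x) \<partial>\<mu>) \<le> (\<integral>x. exp (\<phi> x) + exp B * \<bar>\<phi> x - h x\<bar> \<partial>\<mu>)"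
      proof (rule integral_mono)
        fix x assume x: "x \<in> space \<mu>"
        \<comment> \<open>Convexity of \<open>exp\<close>: the tangent at \<open>h x\<close> lies
          below the graph at \<open>\<phi> x\<close>.\<close>
        have "exp (h x) * (1 - (h x - \<phi> x)) \<le> exp (h x) * exp (\<phi> x - h x)"
        proof (rule mult_left_mono)
          show "1 - (h x - \<phi> x) \<le> exp (\<phi> x - h x)"
            using exp_ge_add_one_self[of "\<phi> x - h x"] by linarith
        qed simp
        then have "exp (h x) - exp (\<phi> x) \<le> exp (h x) * (h x - \<phi> x)"
          by (simp add: exp_add[symmetric] algebra_simps)
        also have "\<dots> \<le> exp (h x) * \<bar>\<phi> x - h x\<bar>" by (intro mult_left_mono) auto
        also have "\<dots> \<le> exp B * \<bar>\<phi> x - h x\<bar>" using hB[of x] by (intro mult_right_mono) auto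
        finally show "exp (h x) \<le> exp (\<phi> x) + exp B * \<bar>\<phi> x - h x\<bar>" by simp
      qed (use hZ Z i1 in auto)
      also have "\<dots> = Z + exp B * (\<integral>x. \<bar>\<phi> x - h x\<bar> \<partial>\<mu>)" using Z i1 by (simp add: Z_def)
      also have "\<dots> \<le> Z + exp B * e" using close[of \<mu>] by simp
      finally show "(\<integral>x. exp (h x) \<partial>\<mu>) \<le> Z + exp B * e" .
    qed
    finally show ?thesis by simp
  qed
  have "(\<lambda>n. ln (Z + exp B * (1 / real (Suc n))) + C + 1 / real (Suc n)) \<longlonglongrightarrow> ln (Z + exp B * 0) + C + 0"
    using Z(4) by (intro tendsto_intros LIMSEQ_Suc[OF lim_1_over_n]) auto
  then have "(\<integral>x. \<phi> x \<partial>\<nu>) \<le> ln (Z + exp B * 0) + C + 0"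
  proof (rule LIMSEQ_le_const, intro exI allI impI)
    show "(\<integral>x. \<phi> x \<partial>\<nu>) \<le> ln (Z + exp B * (1 / real (Suc n))) + C + 1 / real (Suc n)" for n
      by (rule step) simp
  qed
  then show "(\<integral>x. \<phi> x \<partial>\<nu>) \<le> ln (\<integral>x. exp (\<phi> x) \<partial>\<mu>) + C" by (simp add: Z_def)
qed

end

text \<open>The tests live on all of \<open>(\<real>\<^sup>D)\<^bsup>[0,T]\<^esup>\<close>, not only on continuous paths, because they are also
  evaluated at piecewise constant interpolations.\<close>
definition path_tests :: "real \<Rightarrow> ((real \<Rightarrow> real^'n) \<Rightarrow> real) set" where
  "path_tests T = {g \<in> borel_measurable (Pi\<^sub>M {0..T} (\<lambda>_. borel)). (\<forall>h. 0 \<le> g h \<and> g h \<le> 1) \<and>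
     (\<forall>H h. (\<forall>t\<in>{0..T}. (\<lambda>k. H k t) \<longlonglongrightarrow> h t) \<longrightarrow> (\<lambda>k. g (H k)) \<longlonglongrightarrow> g h)}"

lemma measurable_path_space:
  assumes "\<And>t. t \<in> {0..T} \<Longrightarrow> X t \<in> borel_measurable M"
    and "\<And>\<omega>. \<omega> \<in> space M \<Longrightarrow> continuous_on {0..T} (\<lambda>t. X t \<omega>)"
  shows "(\<lambda>\<omega>. \<lambda>t\<in>{0..T}. X t \<omega>) \<in> M \<rightarrow>\<^sub>M path_space T"
  unfolding path_space_def
proof (rule measurable_restrict_space2)
  show "(\<lambda>\<omega>. \<lambda>t\<in>{0..T}. X t \<omega>) \<in> M \<rightarrow>\<^sub>M Pi\<^sub>M {0..T} (\<lambda>_. borel)"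
    using assms(1) by (intro measurable_restrict)
  show "(\<lambda>\<omega>. \<lambda>t\<in>{0..T}. X t \<omega>) \<in> space M \<rightarrow> {h. continuous_on {0..T} h}"
    using continuous_on_eq[OF assms(2)] by (intro Pi_I CollectI) fastforce
qed

lemma measurable_path_eval:
  "t \<in> {0..T} \<Longrightarrow> (\<lambda>h. h t) \<in> path_space T \<rightarrow>\<^sub>M borel"
  unfolding path_space_def
  by (rule measurable_restrict_space1[OF measurable_component_singleton])

lemma space_path_space: "space (path_space T) = {h \<in> extensional {0..T}. continuous_on {0..T} h}"
  by (auto simp: path_space_def space_restrict_space space_PiM PiE_def)

lemma path_tests_measurable: "g \<in> path_tests T \<Longrightarrow> g \<in> borel_measurable (path_space T)"
  unfolding path_space_def path_tests_def by (auto intro: measurable_restrict_space1)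

lemma entropic_test_functions_path_tests:
  fixes \<mu> \<nu> :: "(real \<Rightarrow> real^'n) measure"
  assumes "prob_space \<mu>" "prob_space \<nu>" "sets \<nu> = sets (path_space T)" "sets \<mu> = sets (path_space T)"
    and "\<And>g B. g \<in> path_tests T \<Longrightarrow> 0 \<le> B \<Longrightarrow>
      (\<integral>x. 2 * B * g x - B \<partial>\<nu>) \<le> ln (\<integral>x. exp (2 * B * g x - B) \<partial>\<mu>) + C"
  shows "entropic_test_functions \<mu> \<nu> (path_tests T) C"
proof (rule entropic_test_functions.intro)
  show "(\<lambda>x. (\<Sum>k<n. h k x) / real n) \<in> path_tests T" if "\<And>k. k < n \<Longrightarrow> h k \<in> path_tests T"
    for n and h :: "nat \<Rightarrow> (real \<Rightarrow> real^'n) \<Rightarrow> real"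
  proof -
    have *: "(\<Sum>k<n. h k x) \<le> real n" "0 \<le> (\<Sum>k<n. h k x)" for x
      using that sum_bounded_above[of "{..<n}" "\<lambda>k. h k x" 1] by (auto simp: path_tests_def intro!: sum_nonneg)
    show ?thesis
      unfolding path_tests_def mem_Collect_eq
    proof (intro conjI allI impI)
      show "(\<lambda>x. (\<Sum>k<n. h k x) / real n) \<in> borel_measurable (Pi\<^sub>M {0..T} (\<lambda>_. borel))"
        using that by (intro borel_measurable_divide borel_measurable_sum) (auto simp: path_tests_def)
      show "0 \<le> (\<Sum>k<n. h k x) / real n" "(\<Sum>k<n. h k x) / real n \<le> 1" for x
        using * by (auto simp: divide_le_eq_1)
      fix H :: "nat \<Rightarrow> real \<Rightarrow> real^'n" and x assume "\<forall>t\<in>{0..T}. (\<lambda>k. H k t) \<longlonglongrightarrow> x t"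
      then have "(\<lambda>j. \<Sum>k<n. h k (H j)) \<longlonglongrightarrow> (\<Sum>k<n. h k x)"
        using that by (intro tendsto_sum) (auto simp: path_tests_def)
      \<comment> \<open>For \<open>n = 0\<close> the average is the constant 0, by the convention
        for division by zero.\<close>
      then show "(\<lambda>j. (\<Sum>k<n. h k (H j)) / real n) \<longlonglongrightarrow> (\<Sum>k<n. h k x) / real n"
        by (cases "n = 0") (auto intro: tendsto_divide)
    qed
  qed
next
  show "(\<lambda>x. max (g x) (g' x)) \<in> path_tests T" if "g \<in> path_tests T" "g' \<in> path_tests T" for g g'
    using that unfolding path_tests_def by (auto intro!: tendsto_max borel_measurable_max simp: le_max_iff_disj)
  show "(\<lambda>x. 1 - g x) \<in> path_tests T" if "g \<in> path_tests T" for g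
    using that unfolding path_tests_def by (auto intro!: tendsto_intros)
  show "(\<lambda>_. 0) \<in> path_tests T" by (auto simp: path_tests_def)
  show "g \<in> borel_measurable \<mu>" if "g \<in> path_tests T" for g
    using path_tests_measurable[OF that] assms(4) measurable_cong_sets by blast
  show "0 \<le> g x \<and> g x \<le> 1" if "g \<in> path_tests T" for g and x :: "real \<Rightarrow> real^'n"
    using that by (simp add: path_tests_def)
  show "sets \<nu> = sets \<mu>" using assms(3,4) by simp
qed (fact assms)+

text \<open>The approximable sets form a \<sigma>-algebra that makes every evaluation map
  measurable; the \<sigma>-algebra of \<open>path_space T\<close> is generated by these maps, so all
  of its sets are approximable.\<close>

lemma entropic_bound_of_path_tests:
  fixes \<mu> \<nu> :: "(real \<Rightarrow> real^'n) measure"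
  assumes "prob_space \<mu>" "prob_space \<nu>" and s\<nu>: "sets \<nu> = sets (path_space T)" and s\<mu>: "sets \<mu> = sets (path_space T)"
    and "\<And>g B. g \<in> path_tests T \<Longrightarrow> 0 \<le> B \<Longrightarrow>
      (\<integral>x. 2 * B * g x - B \<partial>\<nu>) \<le> ln (\<integral>x. exp (2 * B * g x - B) \<partial>\<mu>) + C"
  shows "entropic_bound \<nu> \<mu> C"
proof -
  interpret entropic_test_functions \<mu> \<nu> "path_tests T" C
    by (rule entropic_test_functions_path_tests[OF assms])
  interpret S: sigma_algebra "space \<mu>" "{A. approximable A}" by (rule sigma_algebra_approximable)
  define N where "N = sigma (space \<mu>) {A. approximable A}"
  have spN: "space N = space \<mu>" and setsN: "sets N = {A. approximable A}"
    unfolding N_def using S.space_closed by (auto simp: S.sigma_sets_eq)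
  have sp: "space \<mu> = space (path_space T)" using s\<mu> by (rule sets_eq_imp_space_eq)
  have eval: "(\<lambda>h. h t) \<in> N \<rightarrow>\<^sub>M borel" if t: "t \<in> {0..T}" for t
  proof (rule borel_measurableI)
    fix U :: "(real^'n) set" assume U: "open U"
    have "approximable {h \<in> space \<mu>. h t \<in> U}"
    \<comment> \<open>The distance \<open>infdist\<close> to the empty complement is 0 by
      convention, so the functions \<open>g k\<close> below would fail for this
      \<open>U\<close>.\<close>
    proof (cases "U = UNIV")
      case True
      then show ?thesis using S.top by simp
    next
      case False
      then have ne: "- U \<noteq> {}" by auto
      \<comment> \<open>Continuous functions of \<open>h t\<close> that increase to the indicator of
        the open set \<open>U\<close> as \<open>k\<close> grows.\<close>
      define g where "g k h = min 1 (real k * infdist (h t) (- U))" for k and h :: "real \<Rightarrow> real^'n"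
      have gG: "g k \<in> path_tests T" for k
        unfolding path_tests_def mem_Collect_eq
      proof (intro conjI allI impI)
        have "(\<lambda>x. infdist x (- U)) \<in> borel_measurable borel"
          by (intro borel_measurable_continuous_onI continuous_intros)
        then have "(\<lambda>h. infdist (h t) (- U)) \<in> borel_measurable (Pi\<^sub>M {0..T} (\<lambda>_. borel))"
          by (rule measurable_compose[OF measurable_component_singleton[OF t]])
        then show "g k \<in> borel_measurable (Pi\<^sub>M {0..T} (\<lambda>_. borel))" unfolding g_def by measurable
        show "0 \<le> g k h" "g k h \<le> 1" for h by (auto simp: g_def infdist_nonneg)
        fix H :: "nat \<Rightarrow> real \<Rightarrow> real^'n" and h assume "\<forall>t\<in>{0..T}. (\<lambda>j. H j t) \<longlonglongrightarrow> h t"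
        with t have "(\<lambda>j. H j t) \<longlonglongrightarrow> h t" by blast
        then show "(\<lambda>j. g k (H j)) \<longlonglongrightarrow> g k h" unfolding g_def by (intro tendsto_intros)
      qed
      have lim: "(\<lambda>k. \<bar>indicator {h \<in> space \<mu>. h t \<in> U} h - g k h\<bar>) \<longlonglongrightarrow> 0" if h: "h \<in> space \<mu>" for h
      proof (cases "h t \<in> U")
        case False
        then show ?thesis by (simp add: g_def)
      next
        case True
        then have "infdist (h t) (- U) \<noteq> 0"
          using in_closed_iff_infdist_zero[of "- U" "h t"] U ne by auto
        then have pos: "0 < infdist (h t) (- U)" using infdist_nonneg[of "h t" "- U"] by linarith
        obtain k0 :: nat where k0: "1 / infdist (h t) (- U) < real k0" using reals_Archimedean2 by blast
        have "\<forall>\<^sub>F k in sequentially. \<bar>indicator {h \<in> space \<mu>. h t \<in> U} h - g k h\<bar> = 0"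
          using eventually_ge_at_top[of k0]
        proof eventually_elim
          case (elim k)
          then have "1 / infdist (h t) (- U) < real k" using k0 by simp
          then have "1 \<le> real k * infdist (h t) (- U)" using pos by (simp add: field_simps)
          then show ?case using True h by (simp add: g_def)
        qed
        then show ?thesis by (rule tendsto_eventually)
      qed
      have set: "{h \<in> space \<mu>. h t \<in> U} \<in> sets \<mu>"
      proof -
        have "(\<lambda>h. h t) \<in> \<mu> \<rightarrow>\<^sub>M borel"
          using measurable_path_eval[OF t] s\<mu> measurable_cong_sets by blast
        from measurable_sets[OF this borel_open[OF U]] show ?thesis by (simp add: vimage_def Int_def conj_commute)
      qed
      have conv: "(\<lambda>k. \<integral>h. \<bar>indicator {h \<in> space \<mu>. h t \<in> U} h - g k h\<bar> \<partial>m) \<longlonglongrightarrow> 0" if m: "m \<in> {\<mu>, \<nu>}" for m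
      proof -
        interpret prob_space m using m_props(1)[OF m] .
        have "(\<lambda>k. \<integral>h. \<bar>indicator {h \<in> space \<mu>. h t \<in> U} h - g k h\<bar> \<partial>m) \<longlonglongrightarrow> (\<integral>h. 0 \<partial>m)"
        proof (rule integral_dominated_convergence[where w = "\<lambda>_. 1"])
          show "AE h in m. (\<lambda>k. \<bar>indicator {h \<in> space \<mu>. h t \<in> U} h - g k h\<bar>) \<longlonglongrightarrow> 0"
            using lim m_props(3)[OF m] by (intro AE_I2) simp
          show "AE h in m. norm \<bar>indicator {h \<in> space \<mu>. h t \<in> U} h - g k h\<bar> \<le> 1" for k
          proof (rule AE_I2)
            fix h
            show "norm \<bar>indicator {h \<in> space \<mu>. h t \<in> U} h - g k h\<bar> \<le> 1"
              using unit_interval[OF gG, of k h] by (auto simp: indicator_def)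
          qed
          show "(\<lambda>h. \<bar>indicator {h \<in> space \<mu>. h t \<in> U} h - g k h\<bar>) \<in> borel_measurable m" for k
            using borel_measurable_integrable[OF integrable_err[OF m set gG]] .
        qed auto
        then show ?thesis by simp
      qed
      show ?thesis
        unfolding approximable_def
      proof (intro conjI set allI impI)
        fix e :: real assume e: "e > 0"
        have "\<forall>\<^sub>F k in sequentially. (\<integral>h. \<bar>indicator {h \<in> space \<mu>. h t \<in> U} h - g k h\<bar> \<partial>\<mu>) < e \<and>
            (\<integral>h. \<bar>indicator {h \<in> space \<mu>. h t \<in> U} h - g k h\<bar> \<partial>\<nu>) < e"
          using order_tendstoD(2)[OF conv[of \<mu>] e] order_tendstoD(2)[OF conv[of \<nu>] e] by (simp add: eventually_conj)
        then obtain k where "(\<integral>h. \<bar>indicator {h \<in> space \<mu>. h t \<in> U} h - g k h\<bar> \<partial>\<mu>) < e \<and>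
            (\<integral>h. \<bar>indicator {h \<in> space \<mu>. h t \<in> U} h - g k h\<bar> \<partial>\<nu>) < e"
          using eventually_happens'[OF sequentially_bot] by blast
        then show "\<exists>g\<in>path_tests T. \<forall>m\<in>{\<mu>, \<nu>}. (\<integral>x. \<bar>indicator {h \<in> space \<mu>. h t \<in> U} x - g x\<bar> \<partial>m) < e"
          using gG[of k] by (intro bexI[of _ "g k"]) auto
      qed
    qed
    then show "(\<lambda>h. h t) -` U \<inter> space N \<in> sets N"
      by (simp add: spN setsN vimage_def Int_def conj_commute)
  qed
  have "(\<lambda>h. h) \<in> N \<rightarrow>\<^sub>M path_space T"
    unfolding path_space_def
  proof (rule measurable_restrict_space2)
    show "(\<lambda>h. h) \<in> N \<rightarrow>\<^sub>M Pi\<^sub>M {0..T} (\<lambda>_. borel)"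
      by (rule measurable_PiM_single') (use eval in \<open>auto simp: spN sp space_path_space PiE_def\<close>)
  qed (auto simp: spN sp space_path_space)
  then have "A \<in> sets N" if "A \<in> sets (path_space T)" for A
    using measurable_sets[of "\<lambda>h. h" N "path_space T" A] that sets.sets_into_space[OF that] spN sp
    by (simp add: Int_absorb2)
  then have "approximable A" if "A \<in> sets \<mu>" for A using that s\<mu> setsN by auto
  then show ?thesis by (rule entropic_bound_of_test_functions)
qed

section \<open>Passage to the continuous-time limit\<close>

lemma nat_floor_grid:
  assumes "0 < h" "real n * h = T" "t \<in> {0..T}"
  shows "nat \<lfloor>t / h\<rfloor> \<le> n" "real (nat \<lfloor>t / h\<rfloor>) * h \<in> {0..T}" "\<bar>real (nat \<lfloor>t / h\<rfloor>) * h - t\<bar> \<le> h"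
proof -
  define k where "k = nat \<lfloor>t / h\<rfloor>"
  have th: "0 \<le> t / h" using assms by auto
  then have k: "real k \<le> t / h" "t / h < real k + 1" unfolding k_def by linarith+
  then have kh: "real k * h \<le> t" "t < real k * h + h" using assms(1) by (auto simp: field_simps)
  have "real k * h \<le> real n * h" using kh assms by auto
  then show "nat \<lfloor>t / h\<rfloor> \<le> n" using assms(1) by (simp add: k_def[symmetric])
  show "real (nat \<lfloor>t / h\<rfloor>) * h \<in> {0..T}" "\<bar>real (nat \<lfloor>t / h\<rfloor>) * h - t\<bar> \<le> h"
    using kh assms by (auto simp: k_def[symmetric])
qed

lemma step_path_tendsto:
  fixes x :: "real \<Rightarrow> 'v::real_normed_vector"
  assumes T: "0 < T" and cont: "continuous_on {0..T} x" and t: "t \<in> {0..T}"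
    and n: "\<And>r. 0 < n r" "filterlim n at_top sequentially"
    and conv: "\<And>e. e > 0 \<Longrightarrow> \<forall>\<^sub>F r in sequentially. \<forall>j\<le>n r. norm (y r j - x (real j * (T / real (n r)))) \<le> e"
  shows "(\<lambda>r. y r (nat \<lfloor>t / (T / real (n r))\<rfloor>)) \<longlonglongrightarrow> x t"
proof (rule tendstoI)
  fix e :: real assume e: "e > 0"
  let ?k = "\<lambda>r. nat \<lfloor>t / (T / real (n r))\<rfloor>"
  obtain d where d: "d > 0" "\<And>s. s \<in> {0..T} \<Longrightarrow> dist s t < d \<Longrightarrow> dist (x s) (x t) < e / 2"
    using cont t e unfolding continuous_on_iff by (meson half_gt_zero)
  have "filterlim (\<lambda>r. real (n r)) at_top sequentially"
    by (rule filterlim_compose[OF filterlim_real_sequentially n(2)])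
  then have "(\<lambda>r. T / real (n r)) \<longlonglongrightarrow> 0"
    by (intro tendsto_divide_0[OF tendsto_const] filterlim_at_top_imp_at_infinity)
  then have "\<forall>\<^sub>F r in sequentially. T / real (n r) < d" using d(1) by (rule order_tendstoD)
  moreover have "\<forall>\<^sub>F r in sequentially. \<forall>j\<le>n r. norm (y r j - x (real j * (T / real (n r)))) \<le> e / 3"
    using e by (intro conv) simp
  ultimately show "\<forall>\<^sub>F r in sequentially. dist (y r (?k r)) (x t) < e"
  proof eventually_elim
    case (elim r)
    have g: "0 < T / real (n r)" "real (n r) * (T / real (n r)) = T" using n(1)[of r] T by auto
    note k = nat_floor_grid[OF g t]
    have "dist (real (?k r) * (T / real (n r))) t < d" using k(3) elim by (simp add: dist_real_def)
    then have "dist (x (real (?k r) * (T / real (n r)))) (x t) < e / 2" using d(2) k(2) by blast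
    moreover have "dist (y r (?k r)) (x (real (?k r) * (T / real (n r)))) \<le> e / 3"
      using elim k(1) by (auto simp: dist_norm)
    ultimately show ?case using dist_triangle[of "y r (?k r)" "x t" "x (real (?k r) * (T / real (n r)))"] e by linarith
  qed
qed

text \<open>Lower semicontinuity of the divergence in dual form. The chains become piecewise
  constant paths \<open>HX\<close> and \<open>HY\<close> by data processing; path tests are
  continuous under pointwise convergence and bounded, so both sides converge while \<open>C\<close>
  stays fixed.\<close>

lemma entropic_bound_path_law_limit:
  fixes X Y :: "real \<Rightarrow> 'a \<Rightarrow> real^'n" and XX YY :: "nat \<Rightarrow> nat \<Rightarrow> 'a \<Rightarrow> real^'n"
  assumes "prob_space M" and T: "0 < T"
    and X: "\<And>t. t \<in> {0..T} \<Longrightarrow> X t \<in> borel_measurable M" "\<And>\<omega>. \<omega> \<in> space M \<Longrightarrow> continuous_on {0..T} (\<lambda>t. X t \<omega>)"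
    and Y: "\<And>t. t \<in> {0..T} \<Longrightarrow> Y t \<in> borel_measurable M" "\<And>\<omega>. \<omega> \<in> space M \<Longrightarrow> continuous_on {0..T} (\<lambda>t. Y t \<omega>)"
    and n: "\<And>r. 0 < n r" "filterlim n at_top sequentially"
    and XXm[measurable]: "\<And>r j. XX r j \<in> borel_measurable M" and YYm[measurable]: "\<And>r j. YY r j \<in> borel_measurable M"
    and XX: "AE \<omega> in M. \<forall>e>0. \<forall>\<^sub>F r in sequentially. \<forall>j\<le>n r. norm (XX r j \<omega> - X (real j * (T / real (n r))) \<omega>) \<le> e"
    and YY: "AE \<omega> in M. \<forall>e>0. \<forall>\<^sub>F r in sequentially. \<forall>j\<le>n r. norm (YY r j \<omega> - Y (real j * (T / real (n r))) \<omega>) \<le> e"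
    and eb: "\<And>r. entropic_bound (distr M (Pi\<^sub>M {..n r} (\<lambda>_. borel)) (\<lambda>\<omega>. \<lambda>i\<in>{..n r}. XX r i \<omega>))
      (distr M (Pi\<^sub>M {..n r} (\<lambda>_. borel)) (\<lambda>\<omega>. \<lambda>i\<in>{..n r}. YY r i \<omega>)) C"
  shows "entropic_bound (path_law M T X) (path_law M T Y) C"
proof -
  interpret prob_space M by fact
  define k where "k r t = nat \<lfloor>t / (T / real (n r))\<rfloor>" for r t
  let ?P = "Pi\<^sub>M {0..T} (\<lambda>_. borel :: (real^'n) measure)"
  have kn: "k r t \<le> n r" if "t \<in> {0..T}" for r t
    unfolding k_def using n(1)[of r] T that by (intro nat_floor_grid(1)[where T = T]) auto
  define HX where "HX r \<omega> = (\<lambda>t\<in>{0..T}. XX r (k r t) \<omega>)" for r \<omega>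
  define HY where "HY r \<omega> = (\<lambda>t\<in>{0..T}. YY r (k r t) \<omega>)" for r \<omega>
  have HXm[measurable]: "HX r \<in> M \<rightarrow>\<^sub>M ?P" "HY r \<in> M \<rightarrow>\<^sub>M ?P" for r
    unfolding HX_def HY_def by (intro measurable_restrict; simp)+
  have Xp: "(\<lambda>\<omega>. \<lambda>t\<in>{0..T}. X t \<omega>) \<in> M \<rightarrow>\<^sub>M path_space T"
    using X by (rule measurable_path_space)
  have Yp: "(\<lambda>\<omega>. \<lambda>t\<in>{0..T}. Y t \<omega>) \<in> M \<rightarrow>\<^sub>M path_space T"
    using Y by (rule measurable_path_space)
  have ebH: "entropic_bound (distr M ?P (HX r)) (distr M ?P (HY r)) C" for r
  proof -
    define F where "F x = (\<lambda>t\<in>{0..T}. x (k r t))" for x :: "nat \<Rightarrow> real^'n"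
    have F[measurable]: "F \<in> Pi\<^sub>M {..n r} (\<lambda>_. borel) \<rightarrow>\<^sub>M ?P"
      unfolding F_def by (intro measurable_restrict measurable_component_singleton) (use kn in auto)
    have m: "(\<lambda>\<omega>. \<lambda>i\<in>{..n r}. XX r i \<omega>) \<in> M \<rightarrow>\<^sub>M Pi\<^sub>M {..n r} (\<lambda>_. borel)"
      "(\<lambda>\<omega>. \<lambda>i\<in>{..n r}. YY r i \<omega>) \<in> M \<rightarrow>\<^sub>M Pi\<^sub>M {..n r} (\<lambda>_. borel)"
      by (intro measurable_restrict; simp)+
    have "F \<circ> (\<lambda>\<omega>. \<lambda>i\<in>{..n r}. XX r i \<omega>) = HX r" "F \<circ> (\<lambda>\<omega>. \<lambda>i\<in>{..n r}. YY r i \<omega>) = HY r"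
      using kn by (auto simp: F_def HX_def HY_def fun_eq_iff)
    then have "distr (distr M (Pi\<^sub>M {..n r} (\<lambda>_. borel)) (\<lambda>\<omega>. \<lambda>i\<in>{..n r}. XX r i \<omega>)) ?P F = distr M ?P (HX r)"
      "distr (distr M (Pi\<^sub>M {..n r} (\<lambda>_. borel)) (\<lambda>\<omega>. \<lambda>i\<in>{..n r}. YY r i \<omega>)) ?P F = distr M ?P (HY r)"
      using distr_distr[OF F m(1)] distr_distr[OF F m(2)] by simp_all
    then show ?thesis using entropic_bound_distr[OF eb, of F r ?P] F by (simp only: measurable_distr_eq1 sets_distr)
  qed
  have limX: "AE \<omega> in M. \<forall>t\<in>{0..T}. (\<lambda>r. HX r \<omega> t) \<longlonglongrightarrow> (\<lambda>t\<in>{0..T}. X t \<omega>) t"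
    using XX AE_space
  proof eventually_elim
    case (elim \<omega>)
    show ?case
    proof
      fix t assume t: "t \<in> {0..T}"
      have "(\<lambda>r. XX r (k r t) \<omega>) \<longlonglongrightarrow> X t \<omega>"
        unfolding k_def using elim X(2) by (intro step_path_tendsto[OF T _ t n, where y = "\<lambda>r j. XX r j \<omega>"]) auto
      then show "(\<lambda>r. HX r \<omega> t) \<longlonglongrightarrow> (\<lambda>t\<in>{0..T}. X t \<omega>) t" using t by (simp add: HX_def)
    qed
  qed
  have limY: "AE \<omega> in M. \<forall>t\<in>{0..T}. (\<lambda>r. HY r \<omega> t) \<longlonglongrightarrow> (\<lambda>t\<in>{0..T}. Y t \<omega>) t"
    using YY AE_space
  proof eventually_elim
    case (elim \<omega>)
    show ?case
    proof
      fix t assume t: "t \<in> {0..T}"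
      have "(\<lambda>r. YY r (k r t) \<omega>) \<longlonglongrightarrow> Y t \<omega>"
        unfolding k_def using elim Y(2) by (intro step_path_tendsto[OF T _ t n, where y = "\<lambda>r j. YY r j \<omega>"]) auto
      then show "(\<lambda>r. HY r \<omega> t) \<longlonglongrightarrow> (\<lambda>t\<in>{0..T}. Y t \<omega>) t" using t by (simp add: HY_def)
    qed
  qed
  show ?thesis
  proof (rule entropic_bound_of_path_tests)
    show "prob_space (path_law M T X)" "prob_space (path_law M T Y)"
      unfolding path_law_def by (rule prob_space_distr[OF Xp], rule prob_space_distr[OF Yp])
    fix g :: "(real \<Rightarrow> real^'n) \<Rightarrow> real" and B :: real assume g: "g \<in> path_tests T" and B: "0 \<le> B"
    have gm[measurable]: "g \<in> borel_measurable ?P" and g01: "\<And>h. 0 \<le> g h" "\<And>h. g h \<le> 1"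
      and gc: "\<And>H h. \<forall>t\<in>{0..T}. (\<lambda>k. H k t) \<longlonglongrightarrow> h t \<Longrightarrow> (\<lambda>k. g (H k)) \<longlonglongrightarrow> g h"
      using g by (auto simp: path_tests_def)
    note gp = path_tests_measurable[OF g]
    define \<phi> where "\<phi> h = 2 * B * g h - B" for h
    have \<phi>m[measurable]: "\<phi> \<in> borel_measurable ?P" "\<phi> \<in> borel_measurable (path_space T)"
      using gp unfolding \<phi>_def by auto
    have \<phi>B: "\<bar>\<phi> h\<bar> \<le> B" for h
    proof -
      have "0 \<le> 2 * B * g h" "2 * B * g h \<le> 2 * B * 1"
        using g01[of h] B mult_left_mono[of "g h" 1 "2 * B"] by auto
      then show ?thesis by (simp add: \<phi>_def abs_le_iff)
    qed
    have \<phi>c: "(\<lambda>k. \<phi> (H k)) \<longlonglongrightarrow> \<phi> h" if "\<forall>t\<in>{0..T}. (\<lambda>k. H k t) \<longlonglongrightarrow> h t" for H h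
      unfolding \<phi>_def by (intro tendsto_intros gc that)
    have mX: "(\<lambda>\<omega>. \<phi> (\<lambda>t\<in>{0..T}. X t \<omega>)) \<in> borel_measurable M" "(\<lambda>\<omega>. \<phi> (\<lambda>t\<in>{0..T}. Y t \<omega>)) \<in> borel_measurable M"
      by (rule measurable_compose[OF Xp \<phi>m(2)], rule measurable_compose[OF Yp \<phi>m(2)])
    have step: "(\<integral>\<omega>. \<phi> (HX r \<omega>) \<partial>M) \<le> ln (\<integral>\<omega>. exp (\<phi> (HY r \<omega>)) \<partial>M) + C" for r
    proof -
      have "(\<integral>h. \<phi> h \<partial>distr M ?P (HX r)) \<le> ln (\<integral>h. exp (\<phi> h) \<partial>distr M ?P (HY r)) + C"
        by (rule entropic_boundD[OF ebH, where B = B]) (use \<phi>B in auto)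
      then show ?thesis by (simp add: integral_distr)
    qed
    have l1: "(\<lambda>r. \<integral>\<omega>. \<phi> (HX r \<omega>) \<partial>M) \<longlonglongrightarrow> (\<integral>\<omega>. \<phi> (\<lambda>t\<in>{0..T}. X t \<omega>) \<partial>M)"
    proof (rule integral_dominated_convergence[where w = "\<lambda>_. B"])
      show "AE \<omega> in M. (\<lambda>r. \<phi> (HX r \<omega>)) \<longlonglongrightarrow> \<phi> (\<lambda>t\<in>{0..T}. X t \<omega>)"
        using limX by eventually_elim (rule \<phi>c)
    qed (use \<phi>B mX in auto)
    have l2: "(\<lambda>r. \<integral>\<omega>. exp (\<phi> (HY r \<omega>)) \<partial>M) \<longlonglongrightarrow> (\<integral>\<omega>. exp (\<phi> (\<lambda>t\<in>{0..T}. Y t \<omega>)) \<partial>M)"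
    proof (rule integral_dominated_convergence[where w = "\<lambda>_. exp B"])
      show "AE \<omega> in M. (\<lambda>r. exp (\<phi> (HY r \<omega>))) \<longlonglongrightarrow> exp (\<phi> (\<lambda>t\<in>{0..T}. Y t \<omega>))"
        using limY by eventually_elim (intro tendsto_intros \<phi>c)
      show "AE \<omega> in M. norm (exp (\<phi> (HY r \<omega>))) \<le> exp B" for r
        using \<phi>B by (intro AE_I2) (auto simp: abs_le_iff)
    qed (use mX in auto)
    \<comment> \<open>The logarithm can be passed to the limit because the limiting integral is
      positive.\<close>
    have "0 < (\<integral>\<omega>. exp (\<phi> (\<lambda>t\<in>{0..T}. Y t \<omega>)) \<partial>M)"
      by (rule exp_integral_bounds(4)[where B = B]) (use mX \<phi>B in auto)
    then have "(\<integral>\<omega>. \<phi> (\<lambda>t\<in>{0..T}. X t \<omega>) \<partial>M) \<le> ln (\<integral>\<omega>. exp (\<phi> (\<lambda>t\<in>{0..T}. Y t \<omega>)) \<partial>M) + C"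
      using step by (intro LIMSEQ_le[OF l1 tendsto_add[OF tendsto_ln[OF l2] tendsto_const]]) auto
    then show "(\<integral>x. 2 * B * g x - B \<partial>path_law M T X) \<le> ln (\<integral>x. exp (2 * B * g x - B) \<partial>path_law M T Y) + C"
      unfolding path_law_def \<phi>_def[symmetric]
      by (subst integral_distr[OF Xp \<phi>m(2)], simp_all, subst integral_distr[OF Yp], simp_all)
  qed (simp_all add: path_law_def)
qed

section \<open>The Euler polygon and the linearised drift\<close>

lemma euler_eq_euler_chain: "euler f m0 h k = euler_chain h (\<lambda>_. f) m0 (\<lambda>_. 0) k"
  by (induction k) auto

text \<open>With \<open>f\<close> only locally Lipschitz, Euler iterates could leave every ball.
  They are the noise-free case of \<open>euler_chain_converges\<close>, so for fine meshes they stay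
  within distance 1 of the ODE solution, which is bounded on the interval.\<close>

lemma euler_bounded:
  fixes f :: "real^'n \<Rightarrow> real^'n"
  assumes T: "0 < T" and lip: "\<And>r. \<exists>L\<ge>0. \<forall>u u'. norm u \<le> r \<longrightarrow> norm u' \<le> r \<longrightarrow> norm (f u - f u') \<le> L * norm (u - u')"
    and m: "ode_solution T f m0 m"
  obtains r \<delta> where "0 < \<delta>" "0 \<le> r" "\<And>K k. 1 \<le> K \<Longrightarrow> T / real K < \<delta> \<Longrightarrow> k \<le> K \<Longrightarrow> norm (euler f m0 (T / real K) k) \<le> r"
proof -
  have m0: "m 0 = m0" and der: "\<And>t. t \<in> {0..T} \<Longrightarrow> (m has_vector_derivative f (m t)) (at t within {0..T})"
    using m by (auto simp: ode_solution_def)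
  have cont: "continuous_on {0..T} m"
    unfolding continuous_on_eq_continuous_within using der has_vector_derivative_continuous by blast
  have sol: "((\<lambda>s. f (m s)) has_integral (m t - m 0 - 0)) {0..t}" if t: "t \<in> {0..T}" for t
  proof -
    have "((\<lambda>s. f (m s)) has_integral (m t - m 0)) {0..t}"
    proof (rule fundamental_theorem_of_calculus)
      fix x assume "x \<in> {0..t}"
      then have "x \<in> {0..T}" using t by auto
      from der[OF this] show "(m has_vector_derivative f (m x)) (at x within {0..t})"
        by (rule has_vector_derivative_within_subset) (use t in auto)
    qed (use t in simp)
    then show ?thesis by simp
  qed
  \<comment> \<open>The drift does not depend on time, so every step number is admissible; tolerance
    1 is all that boundedness asks for.\<close>
  have "\<exists>N. \<forall>n\<in>UNIV. N \<le> n \<longrightarrow> 0 < n \<longrightarrow> (\<forall>j\<le>n.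
    norm (euler_chain (T / real n) (\<lambda>_. f) (m 0) (\<lambda>j. 0 - 0) j - m (real j * (T / real n))) \<le> 1)"
  proof (rule euler_chain_converges[OF T cont, where b = "\<lambda>_. f" and w = "\<lambda>_. 0" and c = "\<lambda>_ _. f" and A = UNIV])
    fix r
    obtain L where L: "L \<ge> 0" "\<forall>u u'. norm u \<le> r \<longrightarrow> norm u' \<le> r \<longrightarrow> norm (f u - f u') \<le> L * norm (u - u')"
      using lip by blast
    show "\<exists>L\<ge>0. \<forall>n\<in>UNIV. \<forall>j<n. \<forall>s u u'. real j * (T / real n) \<le> s \<longrightarrow> s < real (Suc j) * (T / real n) \<longrightarrow>
       norm u \<le> r \<longrightarrow> norm u' \<le> r \<longrightarrow> norm (f u - f u') \<le> L * (norm (u - u') + T / real n)"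
    proof (intro exI[of _ L] conjI L(1) ballI allI impI)
      fix n :: nat and u u' :: "real^'n" assume "norm u \<le> r" "norm u' \<le> r"
      then have "norm (f u - f u') \<le> L * norm (u - u')" using L by blast
      also have "\<dots> \<le> L * (norm (u - u') + T / real n)" using L T by (intro mult_left_mono) auto
      finally show "norm (f u - f u') \<le> L * (norm (u - u') + T / real n)" .
    qed
  qed (use sol in auto)
  then obtain N where N: "\<And>n j. N \<le> n \<Longrightarrow> 0 < n \<Longrightarrow> j \<le> n \<Longrightarrow> norm (euler f m0 (T / real n) j - m (real j * (T / real n))) \<le> 1"
    by (auto simp: euler_eq_euler_chain m0)
  have "bounded (m ` {0..T})" using cont by (intro compact_imp_bounded compact_continuous_image) auto
  then obtain r0 where r0: "\<And>t. t \<in> {0..T} \<Longrightarrow> norm (m t) \<le> r0"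
    unfolding bounded_iff by (meson imageI)
  have "0 \<le> r0" using r0[of 0] T by (auto intro: order_trans[OF norm_ge_zero])
  show ?thesis
  \<comment> \<open>A mesh below \<open>T / real (Suc N)\<close> forces \<open>K > N\<close>, the
    range in which the convergence statement applies.\<close>
  proof (rule that[of "T / real (Suc N)" "r0 + 1"])
    fix K k assume K: "1 \<le> K" "T / real K < T / real (Suc N)" "k \<le> K"
    have "\<not> K \<le> N"
    proof
      assume "K \<le> N"
      then have "T / real (Suc N) \<le> T / real K" using K(1) T by (intro divide_left_mono) auto
      then show False using K(2) by simp
    qed
    then have "N \<le> K" by simp
    moreover have "real k * (T / real K) \<in> {0..T}"
      using K T by (auto simp: field_simps)
    moreover have "norm (euler f m0 (T / real K) k) \<le> norm (m (real k * (T / real K))) + norm (euler f m0 (T / real K) k - m (real k * (T / real K)))"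
      by norm
    ultimately show "norm (euler f m0 (T / real K) k) \<le> r0 + 1"
      using N[of K k] r0[of "real k * (T / real K)"] K by linarith
  qed (use T \<open>0 \<le> r0\<close> in auto)
qed

section \<open>Linearisation error in terms of the deviation from the polygon\<close>

lemma power_add_le:
  fixes x y :: real
  assumes "0 \<le> x" "0 \<le> y"
  shows "(x + y) ^ p \<le> 2 ^ p * (x ^ p + y ^ p)"
proof -
  have "(x + y) ^ p \<le> (2 * max x y) ^ p" using assms by (intro power_mono) auto
  also have "\<dots> = 2 ^ p * max x y ^ p" by (simp add: power_mult_distrib)
  also have "max x y ^ p \<le> x ^ p + y ^ p" using assms by (auto simp: max_def)
  finally show ?thesis by simp
qed

text \<open>For \<open>d \<le> 1\<close> every positive power of \<open>d\<close> is at most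
  \<open>d\<close>, so exactly one factor \<open>d\<close> is kept; squaring later turns it into
  \<open>d\<^sup>2\<close>.\<close>

lemma power_add_small_le:
  fixes x d F :: real
  assumes "0 \<le> x" "0 \<le> d" "d \<le> 1" "0 \<le> F" "0 < p"
  shows "(x + d * F) ^ p \<le> 2 ^ p * (1 + F ^ p) * (x ^ p + d)"
proof -
  have "d ^ p \<le> d ^ 1" using assms by (intro power_decreasing) auto
  then have "(d * F) ^ p \<le> d * F ^ p" using assms by (simp add: power_mult_distrib mult_right_mono)
  moreover have "(x + d * F) ^ p \<le> 2 ^ p * (x ^ p + (d * F) ^ p)" using assms by (intro power_add_le) auto
  ultimately have "(x + d * F) ^ p \<le> 2 ^ p * (x ^ p + d * F ^ p)" by (smt (verit) mult_left_mono zero_le_power)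
  also have "x ^ p + d * F ^ p \<le> (1 + F ^ p) * (x ^ p + d)"
    using assms by (simp add: algebra_simps)
  finally show ?thesis by (simp add: mult_ac)
qed

text \<open>The Taylor expansion is centred at the Euler node \<open>p\<close>, the linear drift at
  the interpolant \<open>p + \<tau> *\<^sub>R f p\<close>; the mismatch costs a Jacobian applied to
  \<open>\<tau> *\<^sub>R f p\<close>, of order \<open>d\<close>. The exponents 4 and
  \<open>2 * s + 4\<close> are the squares of the quadratic Taylor term without and with the growth
  weight.\<close>

lemma linearisation_error:
  fixes f :: "real^'n \<Rightarrow> real^'n"
  assumes C: "0 < C" and tay: "\<And>u p. norm (f u - f p - jacobian f (at p) *v (u - p)) \<le> C * (1 + (norm p + norm (u - p)) ^ s) * (norm (u - p))\<^sup>2"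
    and L: "0 \<le> L" "\<And>p x. norm p \<le> r \<Longrightarrow> norm (jacobian f (at p) *v x) \<le> L * norm x"
    and F: "0 \<le> F" "\<And>p. norm p \<le> r \<Longrightarrow> norm (f p) \<le> F" and r: "0 \<le> r"
  obtains C' where "0 < C'" "\<And>p u \<tau> d. norm p \<le> r \<Longrightarrow> 0 \<le> \<tau> \<Longrightarrow> \<tau> \<le> d \<Longrightarrow> d \<le> 1 \<Longrightarrow>
    (norm (f p + jacobian f (at p) *v (u - (p + \<tau> *\<^sub>R f p)) - f u))\<^sup>2
      \<le> C' * (norm (u - (p + \<tau> *\<^sub>R f p)) ^ 4 + norm (u - (p + \<tau> *\<^sub>R f p)) ^ (2 * s + 4) + d\<^sup>2)"
proof -
  \<comment> \<open>\<open>a\<close> and \<open>b\<close> are the coefficients of the powers 2 and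
    \<open>s + 2\<close> after the distance to \<open>p\<close> is replaced by the deviation
    \<open>e\<close> plus \<open>d * F\<close>; the \<open>+ 1\<close> in \<open>K\<close> gives
    strict positivity.\<close>
  define a where "a = C * (1 + 2 ^ s * r ^ s) * (2 ^ 2 * (1 + F ^ 2))"
  define b where "b = C * 2 ^ s * (2 ^ (s + 2) * (1 + F ^ (s + 2)))"
  define K where "K = a + b + L * F + 1"
  have ab: "0 \<le> a" "0 \<le> b" "0 < K" using C r F L by (auto simp: a_def b_def K_def add_nonneg_pos)
  show ?thesis
  proof (rule that[of "3 * K\<^sup>2"])
    fix p u :: "real^'n" and \<tau> d :: real assume p: "norm p \<le> r" and \<tau>: "0 \<le> \<tau>" "\<tau> \<le> d" "d \<le> 1"
    define e where "e = norm (u - (p + \<tau> *\<^sub>R f p))"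
    define \<rho> where "\<rho> = norm (u - p)"
    have e0: "0 \<le> e" and \<rho>0: "0 \<le> \<rho>" by (auto simp: e_def \<rho>_def)
    have "norm (\<tau> *\<^sub>R f p) \<le> d * F" using \<tau> F p by (auto intro: mult_mono)
    moreover have "\<rho> \<le> e + norm (\<tau> *\<^sub>R f p)" unfolding \<rho>_def e_def
      using norm_triangle_ineq[of "u - (p + \<tau> *\<^sub>R f p)" "\<tau> *\<^sub>R f p"] by simp
    ultimately have \<rho>: "\<rho> \<le> e + d * F" by linarith
    have "norm (f p + jacobian f (at p) *v (u - (p + \<tau> *\<^sub>R f p)) - f u)
      = norm (- (f u - f p - jacobian f (at p) *v (u - p)) - jacobian f (at p) *v (\<tau> *\<^sub>R f p))"
      by (simp add: matrix_vector_mult_diff_distrib matrix_vector_right_distrib algebra_simps)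
    also have "\<dots> \<le> norm (f u - f p - jacobian f (at p) *v (u - p)) + norm (jacobian f (at p) *v (\<tau> *\<^sub>R f p))"
      using norm_triangle_ineq4[of "- (f u - f p - jacobian f (at p) *v (u - p))"] by (metis norm_minus_cancel)
    also have "\<dots> \<le> C * (1 + (norm p + \<rho>) ^ s) * \<rho>\<^sup>2 + L * (d * F)"
    proof (intro add_mono)
      show "norm (f u - f p - jacobian f (at p) *v (u - p)) \<le> C * (1 + (norm p + \<rho>) ^ s) * \<rho>\<^sup>2"
        using tay[of u p] by (simp add: \<rho>_def)
      have "norm (jacobian f (at p) *v (\<tau> *\<^sub>R f p)) \<le> L * norm (\<tau> *\<^sub>R f p)" using L(2) p by blast
      also have "\<dots> \<le> L * (d * F)" using \<open>norm (\<tau> *\<^sub>R f p) \<le> d * F\<close> L(1) by (intro mult_left_mono)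
      finally show "norm (jacobian f (at p) *v (\<tau> *\<^sub>R f p)) \<le> L * (d * F)" .
    qed
    also have "C * (1 + (norm p + \<rho>) ^ s) * \<rho>\<^sup>2 \<le> a * (e ^ 2 + d) + b * (e ^ (s + 2) + d)"
    proof -
      have "(norm p + \<rho>) ^ s \<le> 2 ^ s * (r ^ s + \<rho> ^ s)"
      proof -
        have "(norm p + \<rho>) ^ s \<le> (r + \<rho>) ^ s" using p \<rho>0 by (intro power_mono) auto
        also have "\<dots> \<le> 2 ^ s * (r ^ s + \<rho> ^ s)" using r \<rho>0 by (intro power_add_le)
        finally show ?thesis .
      qed
      then have "C * (1 + (norm p + \<rho>) ^ s) * \<rho>\<^sup>2 \<le> C * (1 + 2 ^ s * (r ^ s + \<rho> ^ s)) * \<rho>\<^sup>2"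
        using C by (intro mult_right_mono mult_left_mono) auto
      also have "\<dots> = C * (1 + 2 ^ s * r ^ s) * \<rho> ^ 2 + C * 2 ^ s * \<rho> ^ (s + 2)"
        by (simp add: algebra_simps power_add power2_eq_square)
      also have "\<dots> \<le> C * (1 + 2 ^ s * r ^ s) * (2 ^ 2 * (1 + F ^ 2) * (e ^ 2 + d))
          + C * 2 ^ s * (2 ^ (s + 2) * (1 + F ^ (s + 2)) * (e ^ (s + 2) + d))"
      proof (intro add_mono mult_left_mono)
        have pw: "\<rho> ^ q \<le> 2 ^ q * (1 + F ^ q) * (e ^ q + d)" if "0 < q" for q
        proof -
          have "\<rho> ^ q \<le> (e + d * F) ^ q" using \<rho> \<rho>0 by (rule power_mono)
          also have "\<dots> \<le> 2 ^ q * (1 + F ^ q) * (e ^ q + d)" using e0 \<tau> F that by (intro power_add_small_le) auto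
          finally show ?thesis .
        qed
        show "\<rho> ^ 2 \<le> 2 ^ 2 * (1 + F ^ 2) * (e ^ 2 + d)" by (rule pw) simp
        show "\<rho> ^ (s + 2) \<le> 2 ^ (s + 2) * (1 + F ^ (s + 2)) * (e ^ (s + 2) + d)" by (rule pw) simp
      qed (use C r in auto)
      finally show ?thesis by (simp add: a_def b_def mult_ac)
    qed
    also have "a * (e ^ 2 + d) + b * (e ^ (s + 2) + d) + L * (d * F) \<le> K * (e ^ 2 + e ^ (s + 2) + d)"
    proof -
      have "K * (e ^ 2 + e ^ (s + 2) + d) - (a * (e ^ 2 + d) + b * (e ^ (s + 2) + d) + L * (d * F))
        = (b + L * F + 1) * e ^ 2 + (a + L * F + 1) * e ^ (s + 2) + d"
        by (simp add: K_def algebra_simps)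
      moreover have "0 \<le> (b + L * F + 1) * e ^ 2 + (a + L * F + 1) * e ^ (s + 2) + d"
        using ab L F e0 \<tau> by (intro add_nonneg_nonneg mult_nonneg_nonneg) auto
      ultimately show ?thesis by linarith
    qed
    finally have "norm (f p + jacobian f (at p) *v (u - (p + \<tau> *\<^sub>R f p)) - f u) \<le> K * (e ^ 2 + e ^ (s + 2) + d)"
      by simp
    then have "(norm (f p + jacobian f (at p) *v (u - (p + \<tau> *\<^sub>R f p)) - f u))\<^sup>2 \<le> (K * (e ^ 2 + e ^ (s + 2) + d))\<^sup>2"
      by (intro power_mono) auto
    also have "\<dots> = K\<^sup>2 * (e ^ 2 + e ^ (s + 2) + d)\<^sup>2" by (simp add: power_mult_distrib)
    also have "\<dots> \<le> K\<^sup>2 * (3 * ((e ^ 2)\<^sup>2 + (e ^ (s + 2))\<^sup>2 + d\<^sup>2))"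
    proof (intro mult_left_mono)
      have "3 * (x\<^sup>2 + y\<^sup>2 + z\<^sup>2) - (x + y + z)\<^sup>2 = (x - y)\<^sup>2 + (y - z)\<^sup>2 + (x - z)\<^sup>2" for x y z :: real
        by (simp add: power2_eq_square algebra_simps)
      then have "0 \<le> 3 * (x\<^sup>2 + y\<^sup>2 + z\<^sup>2) - (x + y + z)\<^sup>2" for x y z :: real by simp
      from this[of "e ^ 2" "e ^ (s + 2)" d]
      show "(e ^ 2 + e ^ (s + 2) + d)\<^sup>2 \<le> 3 * ((e ^ 2)\<^sup>2 + (e ^ (s + 2))\<^sup>2 + d\<^sup>2)"
        by (simp only: diff_ge_0_iff_ge)
    qed simp
    also have "\<dots> = 3 * K\<^sup>2 * (e ^ 4 + e ^ (2 * s + 4) + d\<^sup>2)"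
    proof -
      have "(e ^ 2)\<^sup>2 = e ^ (2 * 2)" "(e ^ (s + 2))\<^sup>2 = e ^ ((s + 2) * 2)" by (simp_all only: power_mult)
      moreover have "2 * 2 = (4 :: nat)" "(s + 2) * 2 = 2 * s + 4" by simp_all
      ultimately show ?thesis by (simp only: mult_ac)
    qed
    finally show "(norm (f p + jacobian f (at p) *v (u - (p + \<tau> *\<^sub>R f p)) - f u))\<^sup>2
      \<le> 3 * K\<^sup>2 * (norm (u - (p + \<tau> *\<^sub>R f p)) ^ 4 + norm (u - (p + \<tau> *\<^sub>R f p)) ^ (2 * s + 4) + d\<^sup>2)"
      by (simp only: e_def)
  qed (use ab in simp)
qed

text \<open>A cell of the refined grid never straddles a coarse node, so the coarse index is
  constant on it and equals \<open>j div q\<close>.\<close>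

lemma step_index_fine_grid:
  assumes T: "0 < T" and K: "0 < K" and q: "0 < q"
    and s: "real j * (T / real (K * q)) \<le> s" "s < real (Suc j) * (T / real (K * q))"
  shows "step_index (T / real K) s = j div q"
proof -
  have "s / (T / real K) = s * real K / T" by simp
  have lo: "real j / real q \<le> s / (T / real K)" and up: "s / (T / real K) < real (Suc j) / real q"
    using s T K q by (simp_all add: field_simps)
  have "\<lfloor>s / (T / real K)\<rfloor> = int (j div q)"
  proof (rule floor_unique)
    have "real (j div q) \<le> real j / real q" proof -
      have "real (j div q * q) \<le> real j" unfolding of_nat_le_iff by simp
      then show ?thesis using q by (simp add: pos_le_divide_eq)
    qed
    then show "of_int (int (j div q)) \<le> s / (T / real K)" using lo by simp
    have "Suc j \<le> (j div q + 1) * q"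
      using q by (metis Suc_eq_plus1 Suc_leI dividend_less_div_times add.commute mult_Suc mult.commute plus_1_eq_Suc)
    then have "real (Suc j) \<le> real ((j div q + 1) * q)" by (simp only: of_nat_le_iff)
    then have "real (Suc j) / real q \<le> real (j div q) + 1" using q by (simp add: field_simps)
    then show "s / (T / real K) < of_int (int (j div q)) + 1" using up by simp
  qed
  then show ?thesis by (simp add: step_index_def)
qed

lemma euler_interp_fine_grid:
  fixes f :: "real^'n \<Rightarrow> real^'n" and m0 :: "real^'n"
  assumes T: "0 < T" and K: "0 < K" and q: "0 < q"
    and s: "real j * (T / real (K * q)) \<le> s" "s < real (Suc j) * (T / real (K * q))"
  defines "p \<equiv> euler f m0 (T / real K) (j div q)"
  shows "euler_interp f m0 (T / real K) s = p + (s - real (j div q) * (T / real K)) *\<^sub>R f p"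
    "euler_linear_drift f m0 (T / real K) s u = f p + jacobian f (at p) *v (u - (p + (s - real (j div q) * (T / real K)) *\<^sub>R f p))"
    "0 \<le> s - real (j div q) * (T / real K)" "s - real (j div q) * (T / real K) \<le> T / real K"
proof -
  note idx = step_index_fine_grid[OF T K q s]
  show "euler_interp f m0 (T / real K) s = p + (s - real (j div q) * (T / real K)) *\<^sub>R f p"
    "euler_linear_drift f m0 (T / real K) s u = f p + jacobian f (at p) *v (u - (p + (s - real (j div q) * (T / real K)) *\<^sub>R f p))"
    by (simp_all add: euler_interp_def euler_linear_drift_def idx Let_def p_def)
  have pos: "0 < T / real K" using T K by simp
  have "0 \<le> s" using s(1) T K q by (meson divide_nonneg_nonneg less_imp_le mult_nonneg_nonneg of_nat_0_le_iff order_trans)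
  then have "0 \<le> s / (T / real K)" using pos by (rule divide_nonneg_pos)
  then have "real (j div q) \<le> s / (T / real K)" "s / (T / real K) < real (j div q) + 1"
    using idx unfolding step_index_def by linarith+
  then have "real (j div q) * (T / real K) \<le> s" "s < (real (j div q) + 1) * (T / real K)"
    using pos by (simp_all only: pos_le_divide_eq pos_divide_less_eq)
  then show "0 \<le> s - real (j div q) * (T / real K)" "s - real (j div q) * (T / real K) \<le> T / real K"
    by (auto simp: algebra_simps)
qed

text \<open>On the fine grid the coarse polygon is again an explicit Euler recursion, with slope
  frozen at the coarse node. It is thus the exact centre of the fine linearised chain, as
  \<open>linear_chain_mgf\<close> requires.\<close>

lemma euler_interp_fine_step:
  fixes f :: "real^'n \<Rightarrow> real^'n" and m0 :: "real^'n"
  assumes T: "0 < T" and K: "0 < K" and q: "0 < q"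
  defines "h \<equiv> T / real (K * q)"
  shows "euler_interp f m0 (T / real K) (real (Suc j) * h)
    = euler_interp f m0 (T / real K) (real j * h) + h *\<^sub>R f (euler f m0 (T / real K) (j div q))"
proof -
  have h: "0 < h" using assms by simp
  have g: "real j * (T / real (K * q)) \<le> real j * h" "real j * h < real (Suc j) * (T / real (K * q))" for j
    unfolding h_def[symmetric] using h by auto
  have qh: "real q * h = T / real K" using q K by (simp add: h_def)
  define k where "k = j div q"
  define p where "p = euler f m0 (T / real K) k"
  have lhs: "euler_interp f m0 (T / real K) (real j * h) = p + (real j * h - real k * (T / real K)) *\<^sub>R f p"
    unfolding k_def p_def by (rule euler_interp_fine_grid(1)[OF T K q g])
  show ?thesis
  \<comment> \<open>If \<open>Suc j\<close> opens a new coarse cell, the interpolant there is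
    already computed from the next node; the two formulas agree by continuity of the
    polygon.\<close>
  proof (cases "Suc j div q = k")
    case True
    have "euler_interp f m0 (T / real K) (real (Suc j) * h) = p + (real (Suc j) * h - real k * (T / real K)) *\<^sub>R f p"
      unfolding p_def True[symmetric] by (rule euler_interp_fine_grid(1)[OF T K q g])
    then show ?thesis unfolding lhs k_def[symmetric] p_def[symmetric] by (simp add: algebra_simps)
  next
    case False
    then have k1: "Suc j div q = Suc k" and "Suc j mod q = 0"
      by (auto simp: div_Suc k_def split: if_splits)
    then have "Suc j = Suc k * q" by (metis add.right_neutral div_mult_mod_eq)
    then have jq: "real (Suc j) * h = real (Suc k) * (T / real K)"
      unfolding qh[symmetric] by (simp only: of_nat_mult mult.assoc)
    have "euler_interp f m0 (T / real K) (real (Suc j) * h)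
        = euler f m0 (T / real K) (Suc k) + (real (Suc j) * h - real (Suc k) * (T / real K)) *\<^sub>R f (euler f m0 (T / real K) (Suc k))"
      unfolding k1[symmetric] by (rule euler_interp_fine_grid(1)[OF T K q g])
    also have "\<dots> = euler f m0 (T / real K) (Suc k)" by (simp only: jq diff_self scaleR_zero_left add_0_right)
    also have "\<dots> = p + (T / real K) *\<^sub>R f p" by (simp add: p_def)
    finally have rhs: "euler_interp f m0 (T / real K) (real (Suc j) * h) = p + (T / real K) *\<^sub>R f p" .
    obtain D where D: "D = T / real K" by blast
    have "T / real K = (real j * h - real k * (T / real K)) + h"
      using jq unfolding D[symmetric] by (simp add: algebra_simps)
    then show ?thesis unfolding lhs rhs k_def[symmetric] p_def[symmetric]
      by (metis add.assoc scaleR_left_distrib)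
  qed
qed

section \<open>Cost of the linearised chain\<close>

lemma norm_transpose_mult_le:
  fixes A :: "real^'n^'m"
  assumes "\<And>x. norm (A *v x) \<le> L * norm x"
  shows "norm (transpose A *v w) \<le> L * norm w"
proof (cases "transpose A *v w = 0")
  case True
  have "0 \<le> L * norm (axis undefined 1 :: real^'n)" using assms norm_ge_zero order_trans by blast
  then have "0 \<le> L" by (simp add: norm_axis_1)
  then show ?thesis using True by simp
next
  case False
  let ?z = "transpose A *v w"
  have "norm ?z * norm ?z = w \<bullet> (A *v ?z)"
    by (simp add: dot_square_norm[symmetric] power2_eq_square[symmetric] dot_lmul_matrix transpose_matrix_vector flip: dot_lmul_matrix)
  also have "\<dots> \<le> norm w * (L * norm ?z)"
    using norm_cauchy_schwarz[of w "A *v ?z"] assms[of ?z] by (meson mult_left_mono norm_ge_zero order_trans)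
  finally have "norm ?z * norm ?z \<le> (L * norm w) * norm ?z" by (simp add: mult_ac)
  then show ?thesis using False by simp
qed

lemma matrix_norm_bound:
  fixes A :: "real^'n^'m"
  obtains B where "0 \<le> B" "\<And>x. norm (A *v x) \<le> B * norm x"
  using bounded_linear.nonneg_bounded[OF matrix_vector_mul_bounded_linear[of A]] by (auto simp: mult.commute)

lemma gaussian_chain_of_sde:
  assumes W: "wiener_process M W" and X: "sde_solution M W T b0 S \<mu>0 X" and T: "0 < T" and h: "0 < h"
    and b: "\<And>j. b j \<in> borel_measurable borel"
  shows "gaussian_chain M h (X 0) (\<lambda>j \<omega>. W (real (Suc j) * h) \<omega> - W (real j * h) \<omega>) b"
proof (intro gaussian_chain.intro gaussian_chain_axioms.intro)
  show "prob_space M" using W by (simp add: wiener_process_def)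
  show "prob_space.indep_vars M (\<lambda>_. borel)
    (\<lambda>i. case i of 0 \<Rightarrow> X 0 | Suc j \<Rightarrow> (\<lambda>\<omega>. W (real (Suc j) * h) \<omega> - W (real j * h) \<omega>)) {..n}" for n
    using X T h by (intro wiener_increments_indep W) (auto simp: sde_solution_def)
  have "real (Suc j) * h - real j * h = h" for j by (simp add: algebra_simps)
  then show "distr M borel (\<lambda>\<omega>. W (real (Suc j) * h) \<omega> - W (real j * h) \<omega>) = multivariate_normal 0 (h *\<^sub>R mat 1)" for j
    using wiener_increment_law[OF W, of "real j * h" "real (Suc j) * h"] h by (simp add: mult_less_cancel_right)
qed (use h b in auto)

text \<open>Additive noise makes the equation pathwise: for almost every \<open>\<omega>\<close> it
  is an integral equation driven by \<open>S *v W t \<omega>\<close>, to which the deterministic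
  convergence result applies.\<close>

lemma sde_chain_converges:
  fixes X :: "real \<Rightarrow> 'a \<Rightarrow> real^'n" and n :: "nat \<Rightarrow> nat"
  assumes W: "wiener_process M W" and X: "sde_solution M W T b S \<mu>0 X" and T: "0 < T"
    and n: "\<And>r. 0 < n r" "filterlim n at_top sequentially"
    and c: "\<And>r j. c (n r) j \<in> borel_measurable borel"
    and lip: "\<And>R. \<exists>L\<ge>0. \<forall>m\<in>range n. \<forall>j<m. \<forall>s u u'. real j * (T / real m) \<le> s \<longrightarrow> s < real (Suc j) * (T / real m) \<longrightarrow>
       norm u \<le> R \<longrightarrow> norm u' \<le> R \<longrightarrow> norm (b s u - c m j u') \<le> L * (norm (u - u') + T / real m)"
  shows "AE \<omega> in M. \<forall>e>0. \<forall>\<^sub>F r in sequentially. \<forall>j\<le>n r.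
    norm (gaussian_chain.X (T / real (n r)) S (X 0)
      (\<lambda>j \<omega>. W (real (Suc j) * (T / real (n r))) \<omega> - W (real j * (T / real (n r))) \<omega>) (c (n r)) j \<omega>
      - X (real j * (T / real (n r))) \<omega>) \<le> e"
proof -
  have sol: "AE \<omega> in M. \<forall>t\<in>{0..T}. ((\<lambda>s. b s (X s \<omega>)) has_integral (X t \<omega> - X 0 \<omega> - S *v W t \<omega>)) {0..t}"
    and cont: "\<And>\<omega>. \<omega> \<in> space M \<Longrightarrow> continuous_on {0..T} (\<lambda>t. X t \<omega>)"
    using X by (auto simp: sde_solution_def)
  show ?thesis
    using sol AE_space
  proof eventually_elim
    case (elim \<omega>)
    show ?case
    proof (intro allI impI)
      fix e :: real assume e: "0 < e"
      have "\<exists>N. \<forall>m\<in>range n. N \<le> m \<longrightarrow> 0 < m \<longrightarrow> (\<forall>j\<le>m.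
          norm (euler_chain (T / real m) (c m) (X 0 \<omega>)
            (\<lambda>j. S *v W (real (Suc j) * (T / real m)) \<omega> - S *v W (real j * (T / real m)) \<omega>) j
            - X (real j * (T / real m)) \<omega>) \<le> e)"
        using elim(1) by (intro euler_chain_converges[OF T cont[OF elim(2)] _ lip e]) auto
      then obtain N where N': "\<forall>m\<in>range n. N \<le> m \<longrightarrow> 0 < m \<longrightarrow> (\<forall>j\<le>m.
          norm (euler_chain (T / real m) (c m) (X 0 \<omega>)
            (\<lambda>j. S *v W (real (Suc j) * (T / real m)) \<omega> - S *v W (real j * (T / real m)) \<omega>) j
            - X (real j * (T / real m)) \<omega>) \<le> e)"
        by (elim exE)
      have N: "norm (euler_chain (T / real (n r)) (c (n r)) (X 0 \<omega>)
            (\<lambda>j. S *v W (real (Suc j) * (T / real (n r))) \<omega> - S *v W (real j * (T / real (n r))) \<omega>) j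
            - X (real j * (T / real (n r))) \<omega>) \<le> e" if "N \<le> n r" "j \<le> n r" for r j
        by (rule N'[rule_format]) (use that n(1) in auto)
      have "\<forall>\<^sub>F r in sequentially. N \<le> n r" using n(2) by (simp add: filterlim_at_top)
      then show "\<forall>\<^sub>F r in sequentially. \<forall>j\<le>n r.
        norm (gaussian_chain.X (T / real (n r)) S (X 0)
          (\<lambda>j \<omega>. W (real (Suc j) * (T / real (n r))) \<omega> - W (real j * (T / real (n r))) \<omega>) (c (n r)) j \<omega>
          - X (real j * (T / real (n r))) \<omega>) \<le> e"
      proof eventually_elim
        case (elim r)
        have h: "0 < T / real (n r)" using T n(1) by simp
        note gc = gaussian_chain_of_sde[OF W X T h c[of r]]
        show ?case
          unfolding gaussian_chain.X_def[OF gc] matrix_vector_mult_diff_distrib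
          by (intro allI impI N[OF elim])
      qed
    qed
  qed
qed

lemma measurable_euler_linear_drift:
  "euler_linear_drift f m0 h t \<in> borel_measurable borel"
  unfolding euler_linear_drift_def[abs_def] Let_def by measurable

text \<open>\<open>\<kappa>\<close> is the variance bound of the deviation in units of
  \<open>\<epsilon>\<close>: \<open>v0\<close> from the initial law and
  \<open>T * s1\<^sup>2 / 2\<close> from the noise, amplified by at most
  \<open>exp (2 * L * T)\<close>. \<open>mom p\<close> bounds the \<open>p\<close>-th moment in
  units of \<open>sqrt \<epsilon> ^ p\<close>. The resulting bound is free of \<open>q\<close> and
  \<open>j\<close>.\<close>

lemma linearised_chain_cost:
  fixes f :: "real^'n \<Rightarrow> real^'n" and S R :: "real^'n^'n" and m0 :: "real^'n"
    and T \<epsilon> L v0 s1 :: real and K q :: nat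
  assumes T: "0 < T" and K: "0 < K" "T / real K \<le> 1" and q: "0 < q" and \<epsilon>: "0 < \<epsilon>" "\<epsilon> \<le> 1"
  defines "h \<equiv> T / real (K * q)"
  defines "a \<equiv> \<lambda>j. euler_linear_drift f m0 (T / real K) (real j * h)"
  assumes chain: "gaussian_chain M h X0 \<Delta> a" and f: "f \<in> borel_measurable borel"
    and eul: "\<And>k. k \<le> K \<Longrightarrow> norm (euler f m0 (T / real K) k) \<le> r"
    and L: "0 \<le> L" "\<And>p x. norm p \<le> r \<Longrightarrow> norm (jacobian f (at p) *v x) \<le> L * norm x"
    and C: "0 < C" "\<And>p u \<tau> d. norm p \<le> r \<Longrightarrow> 0 \<le> \<tau> \<Longrightarrow> \<tau> \<le> d \<Longrightarrow> d \<le> 1 \<Longrightarrow>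
      (norm (f p + jacobian f (at p) *v (u - (p + \<tau> *\<^sub>R f p)) - f u))\<^sup>2
        \<le> C * (norm (u - (p + \<tau> *\<^sub>R f p)) ^ 4 + norm (u - (p + \<tau> *\<^sub>R f p)) ^ (2 * s + 4) + d\<^sup>2)"
    and S: "\<And>w. norm (S *v w) \<le> sqrt \<epsilon> * s1 * norm w"
    and R: "0 \<le> \<rho>" "\<And>x. norm (R *v x) \<le> \<rho> / sqrt \<epsilon> * norm x"
    and init: "\<And>w. (\<integral>\<^sup>+\<omega>. ennreal (exp (w \<bullet> (X0 \<omega> - m0))) \<partial>M) \<le> ennreal (exp (\<epsilon> * v0 * (norm w)\<^sup>2))" and v0: "0 \<le> v0"
  defines "\<kappa> \<equiv> exp (2 * L * T) * (v0 + T * s1\<^sup>2 / 2)"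
  defines "mom \<equiv> \<lambda>p. 2 * real CARD('n) ^ Suc p * fact p * exp \<kappa>"
  assumes j: "j < K * q"
  shows "integrable M (\<lambda>\<omega>. (norm (R *v (a j (gaussian_chain.X h S X0 \<Delta> a j \<omega>) - f (gaussian_chain.X h S X0 \<Delta> a j \<omega>))))\<^sup>2)"
    "(\<integral>\<omega>. (norm (R *v (a j (gaussian_chain.X h S X0 \<Delta> a j \<omega>) - f (gaussian_chain.X h S X0 \<Delta> a j \<omega>))))\<^sup>2 \<partial>M)
      \<le> \<rho>\<^sup>2 * C * (mom 4 + mom (2 * s + 4) + 1) * (\<epsilon> + (T / real K)\<^sup>2 / \<epsilon>)"
proof -
  interpret gaussian_chain M h S X0 \<Delta> a by fact
  define d where "d = T / real K"
  define p where "p j = euler f m0 d (j div q)" for j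
  define A where "A j = jacobian f (at (p j))" for j
  define c where "c j = euler_interp f m0 d (real j * h)" for j
  have d: "0 \<le> d" "d \<le> 1" using T K by (auto simp: d_def)
  have g: "real j * (T / real (K * q)) \<le> real j * h" "real j * h < real (Suc j) * (T / real (K * q))" for j
    unfolding h_def[symmetric] using h by auto
  define \<tau> where "\<tau> j = real j * h - real (j div q) * (T / real K)" for j
  have cj: "c j = p j + \<tau> j *\<^sub>R f (p j)" and aj: "a j u = f (p j) + A j *v (u - c j)"
    and \<tau>: "0 \<le> \<tau> j" "\<tau> j \<le> d" for j u
    unfolding c_def p_def \<tau>_def a_def A_def d_def
    using euler_interp_fine_grid(1,2)[OF T K(1) q g[of j], of f m0] euler_interp_fine_grid(3,4)[OF T K(1) q g[of j]]
    by simp_all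
  have pr: "norm (p i) \<le> r" if "i < K * q" for i
  proof -
    have "i div q \<le> K" using that q by (metis less_imp_le less_mult_imp_div_less)
    then show ?thesis unfolding p_def d_def by (rule eul)
  qed
  have c0: "c 0 = m0" by (simp add: c_def euler_interp_def step_index_def Let_def)
  have Ssym: "norm (transpose S *v w) \<le> sqrt \<epsilon> * s1 * norm w" for w
    using S by (rule norm_transpose_mult_le)
  define E where "E \<omega> = X j \<omega> - c j" for \<omega>
  have [measurable]: "E \<in> borel_measurable M" unfolding E_def by measurable
  have mgf: "(\<integral>\<^sup>+\<omega>. ennreal (exp (w \<bullet> E \<omega>)) \<partial>M) \<le> ennreal (exp (\<kappa> * (sqrt \<epsilon>)\<^sup>2 * (norm w)\<^sup>2))" for w
  proof -
    have "(\<integral>\<^sup>+\<omega>. ennreal (exp (w \<bullet> E \<omega>)) \<partial>M)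
      \<le> ennreal (exp ((1 + h * L) ^ (2 * j) * (\<epsilon> * v0 + real j * h * (sqrt \<epsilon> * s1)\<^sup>2 / 2) * (norm w)\<^sup>2))"
      unfolding E_def
    proof (rule linear_chain_mgf[where n = "K * q" and A = A and p = "\<lambda>j. f (p j)"])
      show "c (Suc i) = c i + h *\<^sub>R f (p i)" if "i < K * q" for i
        unfolding c_def p_def d_def h_def by (rule euler_interp_fine_step[OF T K(1) q])
      show "norm (transpose (A i) *v w) \<le> L * norm w" if "i < K * q" for i w
        unfolding A_def by (rule norm_transpose_mult_le) (rule L(2)[OF pr[OF that]])
    qed (use aj L(1) Ssym init v0 \<epsilon> j c0 in auto)
    also have "\<dots> \<le> ennreal (exp (\<kappa> * (sqrt \<epsilon>)\<^sup>2 * (norm w)\<^sup>2))"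
    proof (intro ennreal_leI, subst exp_le_cancel_iff, rule mult_right_mono)
      have jh: "real j * h \<le> T"
      proof -
        have "real j * h \<le> real (K * q) * h" using j h by (intro mult_right_mono) (auto simp del: of_nat_mult)
        then show ?thesis using K q by (simp add: h_def)
      qed
      have "(1 + h * L) ^ (2 * j) \<le> exp (h * L) ^ (2 * j)" using h L by (intro power_mono) auto
      also have "\<dots> = exp (2 * L * (real j * h))" by (simp add: exp_of_nat_mult[symmetric] mult_ac)
      also have "\<dots> \<le> exp (2 * L * T)" using jh L by (simp add: mult_left_mono)
      finally have e: "(1 + h * L) ^ (2 * j) \<le> exp (2 * L * T)" .
      have "\<epsilon> * v0 + real j * h * (sqrt \<epsilon> * s1)\<^sup>2 / 2 = \<epsilon> * (v0 + real j * h * s1\<^sup>2 / 2)"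
        using \<epsilon> by (simp add: power_mult_distrib algebra_simps)
      also have "\<dots> \<le> \<epsilon> * (v0 + T * s1\<^sup>2 / 2)"
        using \<epsilon> jh by (intro mult_left_mono add_left_mono divide_right_mono mult_right_mono) auto
      finally have v: "\<epsilon> * v0 + real j * h * (sqrt \<epsilon> * s1)\<^sup>2 / 2 \<le> \<epsilon> * (v0 + T * s1\<^sup>2 / 2)" .
      have "(1 + h * L) ^ (2 * j) * (\<epsilon> * v0 + real j * h * (sqrt \<epsilon> * s1)\<^sup>2 / 2) \<le> exp (2 * L * T) * (\<epsilon> * (v0 + T * s1\<^sup>2 / 2))"
        using e v \<epsilon> v0 h by (intro mult_mono) auto
      also have "\<dots> = \<kappa> * (sqrt \<epsilon>)\<^sup>2" using \<epsilon> by (simp add: \<kappa>_def mult_ac)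
      finally show "(1 + h * L) ^ (2 * j) * (\<epsilon> * v0 + real j * h * (sqrt \<epsilon> * s1)\<^sup>2 / 2) \<le> \<kappa> * (sqrt \<epsilon>)\<^sup>2" .
    qed simp
    finally show ?thesis .
  qed
  have r: "0 < sqrt \<epsilon>" using \<epsilon> by simp
  \<comment> \<open>The moment bound at length scale \<open>r = sqrt \<epsilon>\<close>, the typical
    size of the deviation.\<close>
  have m_int: "integrable M (\<lambda>\<omega>. norm (E \<omega>) ^ k)" and m_le: "(\<integral>\<omega>. norm (E \<omega>) ^ k \<partial>M) \<le> mom k * sqrt \<epsilon> ^ k" for k
    unfolding mom_def by (rule moment_bound_of_mgf[OF _ r mgf]; measurable)+
  have mom0: "0 \<le> mom k" for k by (simp add: mom_def)
  let ?q = "\<lambda>\<omega>. (norm (R *v (a j (X j \<omega>) - f (X j \<omega>))))\<^sup>2"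
  let ?B = "\<lambda>\<omega>. \<rho>\<^sup>2 / \<epsilon> * (C * (norm (E \<omega>) ^ 4 + norm (E \<omega>) ^ (2 * s + 4) + d\<^sup>2))"
  have le: "?q \<omega> \<le> ?B \<omega>" for \<omega>
  proof -
    have "?q \<omega> \<le> (\<rho> / sqrt \<epsilon> * norm (a j (X j \<omega>) - f (X j \<omega>)))\<^sup>2" using R(2) by (intro power_mono) auto
    also have "\<dots> = \<rho>\<^sup>2 / \<epsilon> * (norm (a j (X j \<omega>) - f (X j \<omega>)))\<^sup>2"
      using \<epsilon> by (simp add: power_mult_distrib power_divide)
    also have "\<dots> \<le> ?B \<omega>"
      using C(2)[OF pr[OF j] \<tau>(1)[of j] \<tau>(2)[of j] d(2), of "X j \<omega>"] \<epsilon>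
      unfolding aj A_def E_def cj by (intro mult_left_mono) auto
    finally show ?thesis .
  qed
  have Bi: "integrable M ?B" using m_int[of 4] m_int[of "2 * s + 4"] by simp
  have [measurable]: "a j \<in> borel_measurable borel" by (rule drift)
  note [measurable] = f
  show qi: "integrable M ?q"
  proof (rule Bochner_Integration.integrable_bound[OF Bi])
    show "AE \<omega> in M. norm (?q \<omega>) \<le> norm (?B \<omega>)"
    proof (rule AE_I2)
      fix \<omega>
      have "norm (?q \<omega>) = ?q \<omega>" by simp
      also note le[of \<omega>]
      also have "?B \<omega> \<le> norm (?B \<omega>)" unfolding real_norm_def by (rule abs_ge_self)
      finally show "norm (?q \<omega>) \<le> norm (?B \<omega>)" .
    qed
  qed measurable
  have "(\<integral>\<omega>. ?q \<omega> \<partial>M) \<le> (\<integral>\<omega>. ?B \<omega> \<partial>M)" using qi Bi le by (intro integral_mono)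
  also have "\<dots> = \<rho>\<^sup>2 / \<epsilon> * (C * ((\<integral>\<omega>. norm (E \<omega>) ^ 4 \<partial>M) + (\<integral>\<omega>. norm (E \<omega>) ^ (2 * s + 4) \<partial>M) + d\<^sup>2))"
    using m_int[of 4] m_int[of "2 * s + 4"] by (simp add: prob_space)
  also have "\<dots> \<le> \<rho>\<^sup>2 / \<epsilon> * (C * ((mom 4 + mom (2 * s + 4) + 1) * (\<epsilon>\<^sup>2 + d\<^sup>2)))"
  proof (intro mult_left_mono)
    have e4: "sqrt \<epsilon> ^ 4 = \<epsilon>\<^sup>2"
    proof -
      have "sqrt \<epsilon> ^ (2 * 2) = \<epsilon>\<^sup>2" unfolding power_mult using \<epsilon> by simp
      then show ?thesis by simp
    qed
    \<comment> \<open>Since \<open>\<epsilon> \<le> 1\<close>, the moment caused by the polynomial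
      growth is no worse than the fourth one.\<close>
    have "sqrt \<epsilon> ^ (2 * s + 4) \<le> sqrt \<epsilon> ^ 4" using \<epsilon> by (intro power_decreasing) auto
    then have es: "sqrt \<epsilon> ^ (2 * s + 4) \<le> \<epsilon>\<^sup>2" using e4 by simp
    have "(\<integral>\<omega>. norm (E \<omega>) ^ 4 \<partial>M) \<le> mom 4 * \<epsilon>\<^sup>2" using m_le[of 4] e4 by simp
    moreover have "(\<integral>\<omega>. norm (E \<omega>) ^ (2 * s + 4) \<partial>M) \<le> mom (2 * s + 4) * \<epsilon>\<^sup>2"
      using m_le[of "2 * s + 4"] mult_left_mono[OF es mom0[of "2 * s + 4"]] by linarith
    moreover have "0 \<le> mom 4 * d\<^sup>2" "0 \<le> mom (2 * s + 4) * d\<^sup>2" "0 \<le> \<epsilon>\<^sup>2" using mom0 by auto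
    ultimately show "(\<integral>\<omega>. norm (E \<omega>) ^ 4 \<partial>M) + (\<integral>\<omega>. norm (E \<omega>) ^ (2 * s + 4) \<partial>M) + d\<^sup>2
        \<le> (mom 4 + mom (2 * s + 4) + 1) * (\<epsilon>\<^sup>2 + d\<^sup>2)"
      by (simp only: distrib_left distrib_right mult_1_left)
  qed (use C \<epsilon> in auto)
  also have "\<dots> = \<rho>\<^sup>2 * C * (mom 4 + mom (2 * s + 4) + 1) * (\<epsilon> + d\<^sup>2 / \<epsilon>)"
    using \<epsilon> by (simp add: field_simps power2_eq_square)
  finally show "(\<integral>\<omega>. ?q \<omega> \<partial>M) \<le> \<rho>\<^sup>2 * C * (mom 4 + mom (2 * s + 4) + 1) * (\<epsilon> + (T / real K)\<^sup>2 / \<epsilon>)"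
    by (simp add: d_def)
qed

text \<open>With \<open>K\<close> fixed, the fine grids are refined indefinitely. A cost
  \<open>c\<close> valid for every refinement contributes \<open>n r\<close> terms
  \<open>T / real (n r) / 2 * c\<close>, whose sum \<open>T / 2 * c\<close> survives the limit
  unchanged.\<close>

lemma linearised_path_entropic_bound:
  fixes f :: "real^'n \<Rightarrow> real^'n" and S R :: "real^'n^'n" and m0 :: "real^'n" and T c :: real and K :: nat
  assumes T: "0 < T" and K: "0 < K" and W: "wiener_process M W"
    and v: "sde_solution M W T (\<lambda>t. f) S \<mu>0 v"
    and l: "sde_solution M W T (euler_linear_drift f m0 (T / real K)) S \<nu>0 l"
    and SR: "S ** R = mat 1" and f: "f \<in> borel_measurable borel"
    and lip: "\<And>r. \<exists>L\<ge>0. \<forall>u u'. norm u \<le> r \<longrightarrow> norm u' \<le> r \<longrightarrow> norm (f u - f u') \<le> L * norm (u - u')"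
    and eul: "\<And>k. k \<le> K \<Longrightarrow> norm (euler f m0 (T / real K) k) \<le> r"
    and L: "0 \<le> L" "\<And>p x. norm p \<le> r \<Longrightarrow> norm (jacobian f (at p) *v x) \<le> L * norm x"
    and F: "0 \<le> F" "\<And>p. norm p \<le> r \<Longrightarrow> norm (f p) \<le> F"
    and init: "entropic_bound (distr M borel (l 0)) (distr M borel (v 0)) C"
    and cost: "\<And>q X0 \<Delta> a j. 0 < q \<Longrightarrow>
      a = (\<lambda>j. euler_linear_drift f m0 (T / real K) (real j * (T / real (K * q)))) \<Longrightarrow> X0 = l 0 \<Longrightarrow>
      gaussian_chain M (T / real (K * q)) X0 \<Delta> a \<Longrightarrow> j < K * q \<Longrightarrow>
      integrable M (\<lambda>\<omega>. (norm (R *v (a j (gaussian_chain.X (T / real (K * q)) S X0 \<Delta> a j \<omega>)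
        - f (gaussian_chain.X (T / real (K * q)) S X0 \<Delta> a j \<omega>))))\<^sup>2) \<and>
      (\<integral>\<omega>. (norm (R *v (a j (gaussian_chain.X (T / real (K * q)) S X0 \<Delta> a j \<omega>)
        - f (gaussian_chain.X (T / real (K * q)) S X0 \<Delta> a j \<omega>))))\<^sup>2 \<partial>M) \<le> c"
  shows "entropic_bound (path_law M T l) (path_law M T v) (C + T / 2 * c)"
proof -
  \<comment> \<open>Multiples of \<open>K\<close> only, so that each coarse node, where the
    linearised drift may jump, is a fine grid point.\<close>
  define n where "n r = K * Suc r" for r
  define a where "a m j = euler_linear_drift f m0 (T / real K) (real j * (T / real m))" for m j
  define \<Delta> where "\<Delta> r j \<omega> = W (real (Suc j) * (T / real (n r))) \<omega> - W (real j * (T / real (n r))) \<omega>" for r j \<omega>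
  define XX where "XX r = gaussian_chain.X (T / real (n r)) S (l 0) (\<Delta> r) (a (n r))" for r
  define YY where "YY r = gaussian_chain.X (T / real (n r)) S (v 0) (\<Delta> r) (\<lambda>_. f)" for r
  have n0: "0 < n r" for r using K by (simp add: n_def)
  have ninf: "filterlim n at_top sequentially"
  proof (rule filterlim_at_top_mono[OF filterlim_ident])
    show "\<forall>\<^sub>F r in sequentially. r \<le> n r"
    proof (intro always_eventually allI)
      fix r
      have "1 * Suc r \<le> K * Suc r" using K by (intro mult_right_mono) auto
      then show "r \<le> n r" by (simp add: n_def)
    qed
  qed
  have h: "0 < T / real (n r)" for r using T n0 by simp
  have am: "a m j \<in> borel_measurable borel" for m j unfolding a_def by (rule measurable_euler_linear_drift)
  have gX: "gaussian_chain M (T / real (n r)) (l 0) (\<Delta> r) (a (n r))" for r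
    unfolding \<Delta>_def[abs_def] by (rule gaussian_chain_of_sde[OF W l T h am])
  have gY: "gaussian_chain M (T / real (n r)) (v 0) (\<Delta> r) (\<lambda>_. f)" for r
    unfolding \<Delta>_def[abs_def] by (rule gaussian_chain_of_sde[OF W v T h f])
  show ?thesis
  proof (rule entropic_bound_path_law_limit[OF _ T _ _ _ _ n0 ninf, where XX = XX and YY = YY])
    show "prob_space M" using W by (simp add: wiener_process_def)
    show "l t \<in> borel_measurable M" "v t \<in> borel_measurable M" if "t \<in> {0..T}" for t
      using l v that by (auto simp: sde_solution_def)
    show "continuous_on {0..T} (\<lambda>t. l t \<omega>)" "continuous_on {0..T} (\<lambda>t. v t \<omega>)" if "\<omega> \<in> space M" for \<omega>
      using l v that by (auto simp: sde_solution_def)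
    show "XX r j \<in> borel_measurable M" "YY r j \<in> borel_measurable M" for r j
      unfolding XX_def YY_def by (rule gaussian_chain.measurable_X[OF gX], rule gaussian_chain.measurable_X[OF gY])
    show "AE \<omega> in M. \<forall>e>0. \<forall>\<^sub>F r in sequentially. \<forall>j\<le>n r. norm (YY r j \<omega> - v (real j * (T / real (n r))) \<omega>) \<le> e"
      unfolding YY_def \<Delta>_def[abs_def]
    proof (rule sde_chain_converges[OF W v T n0 ninf, where c = "\<lambda>_ _. f"])
      fix \<rho> :: real
      obtain L' where L': "0 \<le> L'" "\<forall>u u'. norm u \<le> \<rho> \<longrightarrow> norm u' \<le> \<rho> \<longrightarrow> norm (f u - f u') \<le> L' * norm (u - u')"
        using lip by blast
      show "\<exists>L\<ge>0. \<forall>m\<in>range n. \<forall>j<m. \<forall>s u u'. real j * (T / real m) \<le> s \<longrightarrow> s < real (Suc j) * (T / real m) \<longrightarrow>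
         norm u \<le> \<rho> \<longrightarrow> norm u' \<le> \<rho> \<longrightarrow> norm (f u - f u') \<le> L * (norm (u - u') + T / real m)"
      proof (intro exI[of _ L'] conjI L'(1) ballI allI impI)
        fix m :: nat and u u' :: "real^'n" assume "norm u \<le> \<rho>" "norm u' \<le> \<rho>"
        then have "norm (f u - f u') \<le> L' * norm (u - u')" using L' by blast
        also have "\<dots> \<le> L' * (norm (u - u') + T / real m)" using L' T by (intro mult_left_mono) auto
        finally show "norm (f u - f u') \<le> L' * (norm (u - u') + T / real m)" .
      qed
    qed (rule f)
    show "AE \<omega> in M. \<forall>e>0. \<forall>\<^sub>F r in sequentially. \<forall>j\<le>n r. norm (XX r j \<omega> - l (real j * (T / real (n r))) \<omega>) \<le> e"
      unfolding XX_def \<Delta>_def[abs_def]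
    proof (rule sde_chain_converges[OF W l T n0 ninf am])
      fix \<rho> :: real
      show "\<exists>L\<ge>0. \<forall>m\<in>range n. \<forall>j<m. \<forall>s u u'. real j * (T / real m) \<le> s \<longrightarrow> s < real (Suc j) * (T / real m) \<longrightarrow>
         norm u \<le> \<rho> \<longrightarrow> norm u' \<le> \<rho> \<longrightarrow>
         norm (euler_linear_drift f m0 (T / real K) s u - a m j u') \<le> L * (norm (u - u') + T / real m)"
      \<comment> \<open>Inside a fine cell the drift is affine with a Jacobian bounded by
        \<open>L\<close>; evaluating it at the left endpoint moves its centre by at most
        \<open>F\<close> times the step, which adds \<open>L * F\<close>.\<close>
      proof (intro exI[of _ "L + L * F"] conjI ballI allI impI)
        fix m j s u u' assume "m \<in> range n" and j: "j < m"
          and s: "real j * (T / real m) \<le> s" "s < real (Suc j) * (T / real m)"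
        then obtain r' where "m = n r'" by blast
        define q where "q = Suc r'"
        have m: "m = K * q" and q: "0 < q" using \<open>m = n r'\<close> by (simp_all only: n_def q_def zero_less_Suc)
        obtain H where H: "T / real m = H" by blast
        define p where "p = euler f m0 (T / real K) (j div q)"
        have "j div q \<le> K" using j q unfolding m by (metis less_imp_le less_mult_imp_div_less)
        then have p: "norm p \<le> r" unfolding p_def by (rule eul)
        have hm: "0 < T / real m" using T K q m by simp
        have s': "real j * (T / real m) \<le> real j * (T / real m)" "real j * (T / real m) < real (Suc j) * (T / real m)"
          using hm unfolding H by simp_all
        have sj: "0 \<le> s - real j * (T / real m)" "s - real j * (T / real m) \<le> T / real m"
          using s unfolding H by (simp_all add: algebra_simps)
        define \<sigma> where "\<sigma> = real (j div q) * (T / real K)"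
        have "euler_linear_drift f m0 (T / real K) s u - a m j u'
            = jacobian f (at p) *v ((u - u') - (s - real j * (T / real m)) *\<^sub>R f p)"
          unfolding a_def euler_interp_fine_grid(2)[OF T K q s[unfolded m]]
            euler_interp_fine_grid(2)[OF T K q s'[unfolded m]] p_def[symmetric] \<sigma>_def[symmetric] m
          by (simp add: matrix_vector_mult_diff_distrib[symmetric] algebra_simps)
        also have "norm \<dots> \<le> L * norm ((u - u') - (s - real j * (T / real m)) *\<^sub>R f p)" using L(2)[OF p] .
        also have "\<dots> \<le> L * (norm (u - u') + (T / real m) * F)"
        proof (intro mult_left_mono L(1))
          have "norm ((s - real j * (T / real m)) *\<^sub>R f p) \<le> (T / real m) * F"
            unfolding norm_scaleR abs_of_nonneg[OF sj(1)] using sj F(2)[OF p] hm by (intro mult_mono) simp_all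
          then show "norm ((u - u') - (s - real j * (T / real m)) *\<^sub>R f p) \<le> norm (u - u') + (T / real m) * F"
            using norm_triangle_ineq4[of "u - u'" "(s - real j * (T / real m)) *\<^sub>R f p"] by linarith
        qed
        also have "\<dots> \<le> (L + L * F) * (norm (u - u') + T / real m)"
        proof -
          have "(L + L * F) * (norm (u - u') + T / real m) - L * (norm (u - u') + (T / real m) * F)
            = L * F * norm (u - u') + L * (T / real m)" by (simp add: algebra_simps)
          moreover have "0 \<le> L * F * norm (u - u') + L * (T / real m)"
            using L(1) F(1) hm by (intro add_nonneg_nonneg mult_nonneg_nonneg) auto
          ultimately show ?thesis by (metis diff_ge_0_iff_ge)
        qed
        finally show "norm (euler_linear_drift f m0 (T / real K) s u - a m j u') \<le> (L + L * F) * (norm (u - u') + T / real m)" .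
      qed (use L F in simp)
    qed
    show "entropic_bound (distr M (Pi\<^sub>M {..n r} (\<lambda>_. borel)) (\<lambda>\<omega>. \<lambda>i\<in>{..n r}. XX r i \<omega>))
      (distr M (Pi\<^sub>M {..n r} (\<lambda>_. borel)) (\<lambda>\<omega>. \<lambda>i\<in>{..n r}. YY r i \<omega>)) (C + T / 2 * c)" for r
    proof -
      let ?h = "T / real (n r)"
      let ?q = "\<lambda>j \<omega>. (norm (R *v (a (n r) j (XX r j \<omega>) - f (XX r j \<omega>))))\<^sup>2"
      have q: "integrable M (?q j)" "(\<integral>\<omega>. ?q j \<omega> \<partial>M) \<le> c" if "j < n r" for j
        using cost[of "Suc r" "a (n r)" "l 0" "\<Delta> r" j] gX[of r] that
        unfolding XX_def n_def a_def[abs_def] by blast+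
      have "entropic_bound (distr M (Pi\<^sub>M {..n r} (\<lambda>_. borel)) (\<lambda>\<omega>. \<lambda>i\<in>{..n r}. XX r i \<omega>))
        (distr M (Pi\<^sub>M {..n r} (\<lambda>_. borel)) (\<lambda>\<omega>. \<lambda>i\<in>{..n r}. YY r i \<omega>))
        (C + (\<Sum>j<n r. ?h / 2 * (\<integral>\<omega>. ?q j \<omega> \<partial>M)))"
        unfolding XX_def YY_def
        by (rule entropic_bound_gaussian_chain[OF gX gY SR init]) (use q(1) in \<open>simp only: XX_def\<close>)
      moreover have "(\<Sum>j<n r. ?h / 2 * (\<integral>\<omega>. ?q j \<omega> \<partial>M)) \<le> (\<Sum>j<n r. ?h / 2 * c)"
        using q(2) h[of r] by (intro sum_mono mult_left_mono) auto
      moreover have "(\<Sum>j<n r. ?h / 2 * c) = T / 2 * c" using n0[of r] by simp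
      ultimately show ?thesis by (elim entropic_bound_mono) simp
    qed
  qed
qed

theorem theorem3p2:
  fixes T :: real
    and f :: "real^'n \<Rightarrow> real^'n"
    and \<Sigma> C0 :: "real^'n^'n"
    and m0 :: "real^'n"
    and M :: "'a measure"
    and W :: "real \<Rightarrow> 'a \<Rightarrow> real^'n"
    and \<mu>0 :: "real \<Rightarrow> (real^'n) measure"
    and v :: "real \<Rightarrow> real \<Rightarrow> 'a \<Rightarrow> real^'n"
    and l :: "real \<Rightarrow> nat \<Rightarrow> real \<Rightarrow> 'a \<Rightarrow> real^'n"
  assumes "T > 0"
    and "standing_assumption T f"
    and "sym_pos_def \<Sigma>"
    and "sym_pos_semidef C0"
    and "wiener_process M W"
    and "\<And>\<epsilon>. \<epsilon> > 0 \<Longrightarrow>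
           sde_solution M W T (\<lambda>t. f) (matrix_sqrt (\<epsilon> *\<^sub>R \<Sigma>)) (\<mu>0 \<epsilon>) (v \<epsilon>)"
    and "\<And>\<epsilon> K. \<epsilon> > 0 \<Longrightarrow> K \<ge> 1 \<Longrightarrow>
           sde_solution M W T (euler_linear_drift f m0 (T / real K)) (matrix_sqrt (\<epsilon> *\<^sub>R \<Sigma>))
             (multivariate_normal m0 (\<epsilon> *\<^sub>R C0)) (l \<epsilon> K)"
  shows "\<exists>c>0. \<exists>\<epsilon>\<^sub>0>0. \<exists>\<delta>\<^sub>0>0. \<forall>\<epsilon> K. 0 < \<epsilon> \<and> \<epsilon> < \<epsilon>\<^sub>0 \<and> K \<ge> 1 \<and> T / real K < \<delta>\<^sub>0 \<longrightarrow>
           KL (path_law M T (l \<epsilon> K)) (path_law M T (v \<epsilon>))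
             \<le> KL (marginal 0 (path_law M T (l \<epsilon> K))) (\<mu>0 \<epsilon>)
                + ereal (c * \<epsilon> + c * ((T / real K)\<^sup>2 / \<epsilon>)) \<and>
           (\<forall>t\<in>{0<..T}.
              KL (marginal t (path_law M T (l \<epsilon> K))) (marginal t (path_law M T (v \<epsilon>)))
                \<le> KL (marginal 0 (path_law M T (l \<epsilon> K))) (\<mu>0 \<epsilon>)
                   + ereal (c * \<epsilon> + c * ((T / real K)\<^sup>2 / \<epsilon>)))"
proof -
  note T = assms(1) and W = assms(5) and v = assms(6) and l = assms(7)
  interpret prob_space M using W by (simp add: wiener_process_def)
  obtain C s where C: "0 < C"
    and tay: "\<And>u p. norm (f u - f p - jacobian f (at p) *v (u - p)) \<le> C * (1 + (norm p + norm (u - p)) ^ s) * (norm (u - p))\<^sup>2"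
    and diff: "\<And>p. f differentiable (at p)"
    and loc: "\<And>r. \<exists>L\<ge>0. (\<forall>u u'. norm u \<le> r \<longrightarrow> norm u' \<le> r \<longrightarrow> norm (f u - f u') \<le> L * norm (u - u')) \<and>
        (\<forall>p x. norm p \<le> r \<longrightarrow> norm (jacobian f (at p) *v x) \<le> L * norm x)"
    by (rule standing_assumption_derivatives[OF assms(2)]) blast
  have lip: "\<exists>L\<ge>0. \<forall>u u'. norm u \<le> r \<longrightarrow> norm u' \<le> r \<longrightarrow> norm (f u - f u') \<le> L * norm (u - u')" for r
    using loc[of r] by (elim exE conjE) (intro exI conjI)
  have f: "f \<in> borel_measurable borel"
    using diff by (intro borel_measurable_continuous_onI continuous_at_imp_continuous_on)
      (auto intro: differentiable_imp_continuous_within)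
  obtain m where m: "ode_solution T f m0 m" using assms(2) unfolding standing_assumption_def by blast
  obtain r \<delta> where \<delta>: "0 < \<delta>" and r: "0 \<le> r"
    and eul: "\<And>K k. 1 \<le> K \<Longrightarrow> T / real K < \<delta> \<Longrightarrow> k \<le> K \<Longrightarrow> norm (euler f m0 (T / real K) k) \<le> r"
    by (rule euler_bounded[OF T lip m]) (rule that)
  obtain L where L: "0 \<le> L" and Lf: "\<forall>u u'. norm u \<le> r \<longrightarrow> norm u' \<le> r \<longrightarrow> norm (f u - f u') \<le> L * norm (u - u')"
    and LJ: "\<forall>p x. norm p \<le> r \<longrightarrow> norm (jacobian f (at p) *v x) \<le> L * norm x"
    using loc[of r] by (elim exE conjE)
  define F where "F = norm (f 0) + L * r"
  have F0: "0 \<le> F" using L r by (simp add: F_def)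
  have F: "norm (f p) \<le> F" if p: "norm p \<le> r" for p
  proof -
    have "norm (f p - f 0) \<le> L * norm (p - 0)" using Lf[rule_format, of p 0] p r by simp
    also have "\<dots> \<le> L * r" using p L by (simp add: mult_left_mono)
    finally show ?thesis using norm_triangle_ineq2[of "f p" "f 0"] by (simp add: F_def)
  qed
  obtain C' where C': "0 < C'" and err: "\<And>p u \<tau> d. norm p \<le> r \<Longrightarrow> 0 \<le> \<tau> \<Longrightarrow> \<tau> \<le> d \<Longrightarrow> d \<le> 1 \<Longrightarrow>
    (norm (f p + jacobian f (at p) *v (u - (p + \<tau> *\<^sub>R f p)) - f u))\<^sup>2
      \<le> C' * (norm (u - (p + \<tau> *\<^sub>R f p)) ^ 4 + norm (u - (p + \<tau> *\<^sub>R f p)) ^ (2 * s + 4) + d\<^sup>2)"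
    by (rule linearisation_error[OF C tay L LJ[rule_format] F0 F r], assumption, assumption, rule that)
  obtain R1 where R1: "matrix_sqrt \<Sigma> ** R1 = mat 1" by (rule matrix_sqrt_right_inverse[OF assms(3)]) blast
  obtain s1 where s1: "0 \<le> s1" "\<And>x. norm (matrix_sqrt \<Sigma> *v x) \<le> s1 * norm x" by (rule matrix_norm_bound[of "matrix_sqrt \<Sigma>"]) blast
  obtain b0 where b0: "0 \<le> b0" "\<And>x. norm (matrix_sqrt C0 *v x) \<le> b0 * norm x" by (rule matrix_norm_bound[of "matrix_sqrt C0"]) blast
  obtain \<rho> where \<rho>: "0 \<le> \<rho>" "\<And>x. norm (R1 *v x) \<le> \<rho> * norm x" by (rule matrix_norm_bound[of R1]) blast
  \<comment> \<open>From the Gaussian transform \<open>exp ((norm (matrix_sqrt (\<epsilon> *\<^sub>R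
    C0) *v w))\<^sup>2 / 2)\<close>, with the factor \<open>\<epsilon>\<close> taken out; it remains
    valid for singular \<open>C0\<close>.\<close>
  define v0 where "v0 = b0\<^sup>2 / 2"
  define \<kappa> where "\<kappa> = exp (2 * L * T) * (v0 + T * s1\<^sup>2 / 2)"
  define mom where "mom p = 2 * real CARD('n) ^ Suc p * fact p * exp \<kappa>" for p
  define c' where "c' = \<rho>\<^sup>2 * C' * (mom 4 + mom (2 * s + 4) + 1)"
  \<comment> \<open>\<open>T / 2 * c'\<close> is the total cost over the interval; the
    \<open>+ 1\<close> makes \<open>c\<close> positive even if \<open>c'\<close> vanishes.\<close>
  define c where "c = T / 2 * c' + 1"
  have c'0: "0 \<le> c'" using C' by (simp add: c'_def mom_def)
  have c0: "0 < c" using c'0 T by (simp add: c_def add_nonneg_pos)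
  \<comment> \<open>\<open>C1\<close> stands for the divergence of the initial laws, which is
    assumed finite here; the constant \<open>c\<close> is fixed before \<open>\<epsilon>\<close>,
    \<open>K\<close> and \<open>C1\<close>.\<close>
  have main: "entropic_bound (path_law M T (l \<epsilon> K)) (path_law M T (v \<epsilon>)) (C1 + (c * \<epsilon> + c * ((T / real K)\<^sup>2 / \<epsilon>)))"
    if \<epsilon>: "0 < \<epsilon>" "\<epsilon> < 1" and K: "1 \<le> K" "T / real K < min \<delta> 1"
      and C1: "entropic_bound (distr M borel (l \<epsilon> K 0)) (distr M borel (v \<epsilon> 0)) C1" for \<epsilon> K C1
  proof -
    define S where "S = matrix_sqrt (\<epsilon> *\<^sub>R \<Sigma>)"
    define R where "R = (1 / sqrt \<epsilon>) *\<^sub>R R1"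
    have S: "S = sqrt \<epsilon> *\<^sub>R matrix_sqrt \<Sigma>"
      unfolding S_def using \<epsilon> by (intro matrix_sqrt_scaleR sym_pos_def_imp_semidef[OF assms(3)]) simp
    have SR: "S ** R = mat 1"
      using \<epsilon> R1 by (simp add: S R_def matrix_scalar_ac scalar_matrix_assoc[symmetric])
    have Sn: "norm (S *v x) \<le> sqrt \<epsilon> * s1 * norm x" for x
      using \<epsilon> s1(2)[of x] by (simp add: S scaleR_matrix_vector_assoc[symmetric] mult_left_mono mult.assoc)
    have Rn: "norm (R *v x) \<le> \<rho> / sqrt \<epsilon> * norm x" for x
      using \<epsilon> \<rho>(2)[of x] by (simp add: R_def scaleR_matrix_vector_assoc[symmetric] divide_right_mono)
    have init: "(\<integral>\<^sup>+\<omega>. ennreal (exp (w \<bullet> (l \<epsilon> K 0 \<omega> - m0))) \<partial>M) \<le> ennreal (exp (\<epsilon> * v0 * (norm w)\<^sup>2))" for w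
    proof -
      have l0: "l \<epsilon> K 0 \<in> borel_measurable M" "distr M borel (l \<epsilon> K 0) = multivariate_normal m0 (\<epsilon> *\<^sub>R C0)"
        using l[OF \<epsilon>(1) K(1)] T by (auto simp: sde_solution_def)
      have "(\<integral>\<^sup>+\<omega>. ennreal (exp (w \<bullet> (l \<epsilon> K 0 \<omega> - m0))) \<partial>M) = (\<integral>\<^sup>+z. ennreal (exp (w \<bullet> (z - m0))) \<partial>distr M borel (l \<epsilon> K 0))"
        by (rule nn_integral_distr[OF l0(1), symmetric]) measurable
      also have "\<dots> = ennreal (exp ((norm (matrix_sqrt (\<epsilon> *\<^sub>R C0) *v w))\<^sup>2 / 2))"
        unfolding l0(2) using \<epsilon> by (intro multivariate_normal_mgf sym_pos_semidef_scaleR assms(4)) simp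
      also have "\<dots> \<le> ennreal (exp (\<epsilon> * v0 * (norm w)\<^sup>2))"
      proof (intro ennreal_leI, subst exp_le_cancel_iff)
        have "norm (matrix_sqrt (\<epsilon> *\<^sub>R C0) *v w) \<le> sqrt \<epsilon> * (b0 * norm w)"
          using \<epsilon> b0(2)[of w] by (simp add: matrix_sqrt_scaleR[OF assms(4)] scaleR_matrix_vector_assoc[symmetric])
        then have "(norm (matrix_sqrt (\<epsilon> *\<^sub>R C0) *v w))\<^sup>2 \<le> (sqrt \<epsilon> * (b0 * norm w))\<^sup>2" by (intro power_mono) auto
        then show "(norm (matrix_sqrt (\<epsilon> *\<^sub>R C0) *v w))\<^sup>2 / 2 \<le> \<epsilon> * v0 * (norm w)\<^sup>2"
          using \<epsilon> by (simp add: power_mult_distrib v0_def)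
      qed
      finally show ?thesis .
    qed
    have K0: "0 < K" using K by simp
    have eulK: "norm (euler f m0 (T / real K) k) \<le> r" if "k \<le> K" for k using eul K that by simp
    have "entropic_bound (path_law M T (l \<epsilon> K)) (path_law M T (v \<epsilon>)) (C1 + T / 2 * (c' * (\<epsilon> + (T / real K)\<^sup>2 / \<epsilon>)))"
    proof (rule linearised_path_entropic_bound[where l = "l \<epsilon> K" and v = "v \<epsilon>", OF T K0 W _ _ SR f lip eulK L LJ[rule_format] F0 F C1])
      show "sde_solution M W T (\<lambda>t. f) S (\<mu>0 \<epsilon>) (v \<epsilon>)" unfolding S_def by (rule v[OF \<epsilon>(1)])
      show "sde_solution M W T (euler_linear_drift f m0 (T / real K)) S (multivariate_normal m0 (\<epsilon> *\<^sub>R C0)) (l \<epsilon> K)"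
        unfolding S_def by (rule l[OF \<epsilon>(1) K(1)])
      fix q X0 \<Delta> a j
      assume q: "0 < q" and a: "a = (\<lambda>j. euler_linear_drift f m0 (T / real K) (real j * (T / real (K * q))))"
        and X0: "X0 = l \<epsilon> K 0" and chain: "gaussian_chain M (T / real (K * q)) X0 \<Delta> a" and j: "j < K * q"
      have v0': "0 \<le> v0" by (simp add: v0_def)
      have K1: "T / real K \<le> 1" and e1: "\<epsilon> \<le> 1" using K \<epsilon> by simp_all
      show "integrable M (\<lambda>\<omega>. (norm (R *v (a j (gaussian_chain.X (T / real (K * q)) S X0 \<Delta> a j \<omega>)
          - f (gaussian_chain.X (T / real (K * q)) S X0 \<Delta> a j \<omega>))))\<^sup>2) \<and>
        (\<integral>\<omega>. (norm (R *v (a j (gaussian_chain.X (T / real (K * q)) S X0 \<Delta> a j \<omega>)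
          - f (gaussian_chain.X (T / real (K * q)) S X0 \<Delta> a j \<omega>))))\<^sup>2 \<partial>M) \<le> c' * (\<epsilon> + (T / real K)\<^sup>2 / \<epsilon>)"
        using linearised_chain_cost[OF T K0 K1 q \<epsilon>(1) e1 chain[unfolded a X0] f eulK L LJ[rule_format] C' err Sn \<rho>(1) Rn init v0' j]
        unfolding a X0 c'_def mom_def \<kappa>_def by blast
    qed
    then show ?thesis
    proof (rule entropic_bound_mono)
      have "0 \<le> \<epsilon> + (T / real K)\<^sup>2 / \<epsilon>" using \<epsilon> by simp
      then have "T / 2 * c' * (\<epsilon> + (T / real K)\<^sup>2 / \<epsilon>) \<le> c * (\<epsilon> + (T / real K)\<^sup>2 / \<epsilon>)"
        by (intro mult_right_mono) (simp_all add: c_def)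
      then show "C1 + T / 2 * (c' * (\<epsilon> + (T / real K)\<^sup>2 / \<epsilon>)) \<le> C1 + (c * \<epsilon> + c * ((T / real K)\<^sup>2 / \<epsilon>))"
        by (simp add: distrib_left mult.assoc)
    qed
  qed
  show ?thesis
  \<comment> \<open>The threshold 1 for \<open>\<epsilon>\<close> and for the mesh serves the
    comparison of powers; \<open>\<delta>\<close> confines the Euler nodes to a fixed ball.\<close>
  proof (rule exI[of _ c], rule conjI[OF c0], rule exI[of _ 1], rule conjI[OF zero_less_one],
      rule exI[of _ "min \<delta> 1"], intro conjI allI impI)
    show "0 < min \<delta> 1" using \<delta> by simp
    fix \<epsilon> :: real and K :: nat assume "0 < \<epsilon> \<and> \<epsilon> < 1 \<and> 1 \<le> K \<and> T / real K < min \<delta> 1"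
    then have \<epsilon>: "0 < \<epsilon>" "\<epsilon> < 1" and K: "1 \<le> K" "T / real K < min \<delta> 1" by auto
    define D where "D = c * \<epsilon> + c * ((T / real K)\<^sup>2 / \<epsilon>)"
    note sv = v[OF \<epsilon>(1)] and sl = l[OF \<epsilon>(1) K(1)]
    have lp: "(\<lambda>\<omega>. \<lambda>t\<in>{0..T}. l \<epsilon> K t \<omega>) \<in> M \<rightarrow>\<^sub>M path_space T"
      by (rule measurable_path_space) (use sl in \<open>auto simp: sde_solution_def\<close>)
    have vp: "(\<lambda>\<omega>. \<lambda>t\<in>{0..T}. v \<epsilon> t \<omega>) \<in> M \<rightarrow>\<^sub>M path_space T"
      by (rule measurable_path_space) (use sv in \<open>auto simp: sde_solution_def\<close>)
    have pl: "prob_space (path_law M T (l \<epsilon> K))" and pv: "prob_space (path_law M T (v \<epsilon>))"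
      unfolding path_law_def by (rule prob_space_distr[OF lp], rule prob_space_distr[OF vp])
    have sets: "sets (path_law M T (l \<epsilon> K)) = sets (path_law M T (v \<epsilon>))" by (simp add: path_law_def)
    have l0: "l \<epsilon> K 0 \<in> borel_measurable M" and v0m: "v \<epsilon> 0 \<in> borel_measurable M"
      and \<mu>0: "distr M borel (v \<epsilon> 0) = \<mu>0 \<epsilon>"
      using sl sv T by (auto simp: sde_solution_def)
    have marg0: "marginal 0 (path_law M T (l \<epsilon> K)) = distr M borel (l \<epsilon> K 0)"
    proof -
      have "distr (path_law M T (l \<epsilon> K)) borel (\<lambda>h. h 0) = distr M borel ((\<lambda>h. h 0) \<circ> (\<lambda>\<omega>. \<lambda>t\<in>{0..T}. l \<epsilon> K t \<omega>))"
        unfolding path_law_def using T by (intro distr_distr lp measurable_path_eval) simp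
      also have "(\<lambda>h. h 0) \<circ> (\<lambda>\<omega>. \<lambda>t\<in>{0..T}. l \<epsilon> K t \<omega>) = l \<epsilon> K 0" using T by (auto simp: fun_eq_iff)
      finally show ?thesis by (simp add: marginal_def)
    qed
    have "KL (path_law M T (l \<epsilon> K)) (path_law M T (v \<epsilon>)) \<le> KL (distr M borel (l \<epsilon> K 0)) (distr M borel (v \<epsilon> 0)) + ereal D \<and>
      (\<forall>t\<in>{0<..T}. KL (marginal t (path_law M T (l \<epsilon> K))) (marginal t (path_law M T (v \<epsilon>)))
        \<le> KL (distr M borel (l \<epsilon> K 0)) (distr M borel (v \<epsilon> 0)) + ereal D)"
    \<comment> \<open>An infinite initial divergence makes both right-hand sides infinite.\<close>
    proof (cases "KL (distr M borel (l \<epsilon> K 0)) (distr M borel (v \<epsilon> 0)) = \<infinity>")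
      case True
      then show ?thesis by simp
    next
      case False
      have "prob_space (distr M borel (v \<epsilon> 0))" "prob_space (distr M borel (l \<epsilon> K 0))"
        using l0 v0m by (auto intro: prob_space_distr)
      then obtain C1 where C1: "KL (distr M borel (l \<epsilon> K 0)) (distr M borel (v \<epsilon> 0)) = ereal C1"
          "entropic_bound (distr M borel (l \<epsilon> K 0)) (distr M borel (v \<epsilon> 0)) C1"
        using entropic_bound_of_KL[OF _ _ _ False] by auto
      note eb = main[OF \<epsilon> K C1(2), folded D_def]
      have "KL (path_law M T (l \<epsilon> K)) (path_law M T (v \<epsilon>)) \<le> ereal (C1 + D)"
        by (rule KL_le_of_entropic_bound[OF pv pl sets eb])
      moreover have "KL (marginal t (path_law M T (l \<epsilon> K))) (marginal t (path_law M T (v \<epsilon>))) \<le> ereal (C1 + D)"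
        \<comment> \<open>The marginals inherit the dual bound \<open>eb\<close> under evaluation at
          \<open>t\<close>, with the same constant.\<close>
        if t: "t \<in> {0<..T}" for t
      proof -
        have ev: "(\<lambda>h. h t) \<in> path_law M T (l \<epsilon> K) \<rightarrow>\<^sub>M borel" "(\<lambda>h. h t) \<in> path_law M T (v \<epsilon>) \<rightarrow>\<^sub>M borel"
          unfolding path_law_def using measurable_path_eval[of t T] t by auto
        show ?thesis
          unfolding marginal_def
          by (intro KL_le_of_entropic_bound prob_space.prob_space_distr[OF pv] prob_space.prob_space_distr[OF pl]
              entropic_bound_distr[OF eb] ev sets) simp
      qed
      ultimately show ?thesis by (simp add: C1(1))
    qed
    then show "KL (path_law M T (l \<epsilon> K)) (path_law M T (v \<epsilon>))
         \<le> KL (marginal 0 (path_law M T (l \<epsilon> K))) (\<mu>0 \<epsilon>) + ereal (c * \<epsilon> + c * ((T / real K)\<^sup>2 / \<epsilon>))"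
      "\<forall>t\<in>{0<..T}. KL (marginal t (path_law M T (l \<epsilon> K))) (marginal t (path_law M T (v \<epsilon>)))
         \<le> KL (marginal 0 (path_law M T (l \<epsilon> K))) (\<mu>0 \<epsilon>) + ereal (c * \<epsilon> + c * ((T / real K)\<^sup>2 / \<epsilon>))"
      unfolding marg0 \<mu>0 D_def by blast+
  qed
qed

end
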